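(* Let $m,n\ge 1$ and $d\ge 0$ be integers, and let $W=\wedge^d(\mathbf{C}^m\otimes\mathbf{C}^n)$, viewed as a representation of $\mathrm{GL}_m(\mathbf{C})\times\mathrm{GL}_n(\mathbf{C})$ via the defining representations on $\mathbf{C}^m$ and $\mathbf{C}^n$ and functoriality of $\wedge^d$. Then the decomposition of $W$ into irreducible representations of $\mathrm{GL}_m(\mathbf{C})\times\mathrm{GL}_n(\mathbf{C})$ is $$W\cong\bigoplus_{\lambda\vdash d}W^n_{\lambda'}\otimes W^m_\lambda,$$ where $\mathrm{GL}_n(\mathbf{C})$ acts on the factor $W^n_{\lambda'}$, $\mathrm{GL}_m(\mathbf{C})$ acts on the factor $W^m_\lambda$, and $\lambda'$ is the partition conjugate to $\lambda$.
   Context: A polynomial representation of $\mathrm{GL}_n(\mathbf{C})$ is a finite dimensional complex representation whose matrix entries are polynomials in the entries of the group element. For a polynomial representation $(\rho,W)$, its character is $\mathrm{ch}_W(x_1,\dots,x_n)=\mathrm{tr}(\rho(\mathrm{diag}(x_1,\dots,x_n)))$. A semistandard Young tableau of shape $\lambda$ in $n$ letters is a filling of the Young diagram of $\lambda$ (with $\lambda_i$ boxes in row $i$) by numbers in $\{1,\dots,n\}$, weakly increasing along rows and strictly increasing down columns; the Schur polynomial $s_\lambda(x_1,\dots,x_n)$ is the sum over all such tableaux of $x_1^{\mu_1}\cdots x_n^{\mu_n}$, where $\mu_i$ is the number of occurrences of $i$. For a partition $\lambda$ with at most $n$ nonzero parts, $W^n_\lambda$ denotes the irreducible polynomial representation of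 $\mathrm{GL}_n(\mathbf{C})$ (unique up to isomorphism) with character $s_\lambda(x_1,\dots,x_n)$. Convention: $W^n_\lambda=0$ if $\lambda$ has more than $n$ nonzero parts. The notation $\lambda\vdash d$ means that $\lambda$ is a partition of $d$. The conjugate partition $\lambda'$ is given by $\lambda'_i=\#\{j\mid\lambda_j\ge i\}$. *)

theory Defs
  imports
    "HOL-Algebra.Group"
    "HOL-Library.FuncSet"
    "HOL-Combinatorics.Permutations"
    "Jordan_Normal_Form.Determinant"
    "Jordan_Normal_Form.VS_Connect"
begin

section \<open>Partitions and Schur polynomials\<close>

definition is_partition :: "nat list \<Rightarrow> nat \<Rightarrow> bool" (infix "\<turnstile>" 50) where
  "lam \<turnstile> d \<longleftrightarrow> sorted_wrt (\<ge>) lam \<and> 0 \<notin> set lam \<and> sum_list lam = d"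

text \<open>Only the nonzero parts are listed, so the number of nonzero parts is the length. The
  conjugate lists the numbers of parts that are at least \<open>i\<close>, for \<open>i\<close> from 1 to the largest
  part; for larger \<open>i\<close> they vanish.\<close>

definition conjugate_part :: "nat list \<Rightarrow> nat list" where
  "conjugate_part lam =
     map (\<lambda>i. card {j. j < length lam \<and> lam ! j \<ge> i}) [1 ..< Suc (Max (insert 0 (set lam)))]"

definition diagram :: "nat list \<Rightarrow> (nat \<times> nat) set" where
  "diagram lam = {(i, j). i < length lam \<and> j < lam ! i}"

text \<open>The \<open>n\<close> letters are \<open>0, \<dots>, n - 1\<close>, matching the indexing of matrix entries.\<close>

definition ssyt :: "nat \<Rightarrow> nat list \<Rightarrow> (nat \<times> nat \<Rightarrow> nat) set" where
  "ssyt n lam = {T \<in> diagram lam \<rightarrow>\<^sub>E {..<n}.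
     (\<forall>i j j'. j < j' \<and> (i, j) \<in> diagram lam \<and> (i, j') \<in> diagram lam \<longrightarrow> T (i, j) \<le> T (i, j')) \<and>
     (\<forall>i i' j. i < i' \<and> (i, j) \<in> diagram lam \<and> (i', j) \<in> diagram lam \<longrightarrow> T (i, j) < T (i', j))}"

definition schur :: "nat \<Rightarrow> nat list \<Rightarrow> (nat \<Rightarrow> complex) \<Rightarrow> complex" where
  "schur n lam x =
     (\<Sum>T \<in> ssyt n lam. \<Prod>i<n. x i ^ card {c \<in> diagram lam. T c = i})"


section \<open>Finite dimensional complex representations\<close>

definition GL :: "nat \<Rightarrow> complex mat monoid" where
  "GL n = units_of (ring_mat TYPE(complex) n ())"

text \<open>A representation on \<open>\<complex>\<^sup>N\<close> is given by its dimension \<open>N\<close> and the matrices of the group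
  elements.\<close>

type_synonym 'g rep = "nat \<times> ('g \<Rightarrow> complex mat)"

definition representation :: "('g, 'b) monoid_scheme \<Rightarrow> 'g rep \<Rightarrow> bool" where
  "representation G R \<longleftrightarrow> snd R \<in> hom G (GL (fst R))"

definition irreducible_rep :: "('g, 'b) monoid_scheme \<Rightarrow> 'g rep \<Rightarrow> bool" where
  "irreducible_rep G R \<longleftrightarrow> representation G R \<and> fst R > 0 \<and>
     (\<forall>U. VectorSpace.subspace class_ring U (module_vec TYPE(complex) (fst R)) \<and>
          (\<forall>g \<in> carrier G. \<forall>u \<in> U. snd R g *\<^sub>v u \<in> U) \<longrightarrow>
          U = {0\<^sub>v (fst R)} \<or> U = carrier_vec (fst R))"

text \<open>Polynomials in the entries of an \<open>n \<times> n\<close> matrix, as functions of the matrix.\<close>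

inductive_set entry_poly :: "nat \<Rightarrow> (complex mat \<Rightarrow> complex) set" for n where
  const: "(\<lambda>A. c) \<in> entry_poly n"
| entry: "i < n \<Longrightarrow> j < n \<Longrightarrow> (\<lambda>A. A $$ (i, j)) \<in> entry_poly n"
| add: "p \<in> entry_poly n \<Longrightarrow> q \<in> entry_poly n \<Longrightarrow> (\<lambda>A. p A + q A) \<in> entry_poly n"
| mult: "p \<in> entry_poly n \<Longrightarrow> q \<in> entry_poly n \<Longrightarrow> (\<lambda>A. p A * q A) \<in> entry_poly n"

definition polynomial_rep :: "nat \<Rightarrow> complex mat rep \<Rightarrow> bool" where
  "polynomial_rep n R \<longleftrightarrow> representation (GL n) R \<and>
     (\<forall>i<fst R. \<forall>j<fst R. \<exists>p \<in> entry_poly n. \<forall>A \<in> carrier (GL n). snd R A $$ (i, j) = p A)"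

definition character :: "nat \<Rightarrow> complex mat rep \<Rightarrow> (nat \<Rightarrow> complex) \<Rightarrow> complex" where
  "character n R x = (let A = snd R (mat_diag n x) in \<Sum>i<dim_row A. A $$ (i, i))"

text \<open>The representation \<open>W\<^sup>n\<^bsub>\<lambda>\<^esub>\<close> is determined up to isomorphism only; \<open>is_W n lam R\<close> states that \<open>R\<close> is
  (a model of) it. The diagonal matrix with entries \<open>x\<^sub>i\<close> is in the group iff all \<open>x\<^sub>i\<close> are nonzero.\<close>

definition is_W :: "nat \<Rightarrow> nat list \<Rightarrow> complex mat rep \<Rightarrow> bool" where
  "is_W n lam R \<longleftrightarrow>
     (if length lam \<le> n
      then polynomial_rep n R \<and> irreducible_rep (GL n) R \<and>
           (\<forall>x. (\<forall>i<n. x i \<noteq> 0) \<longrightarrow> character n R x = schur n lam x)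
      else representation (GL n) R \<and> fst R = 0)"

definition rep_iso :: "('g, 'b) monoid_scheme \<Rightarrow> 'g rep \<Rightarrow> 'g rep \<Rightarrow> bool" where
  "rep_iso G R S \<longleftrightarrow> representation G R \<and> representation G S \<and> fst R = fst S \<and>
     (\<exists>P \<in> carrier (GL (fst R)). \<forall>g \<in> carrier G. P * snd R g = snd S g * P)"

definition pullback :: "('g \<Rightarrow> 'h) \<Rightarrow> 'h rep \<Rightarrow> 'g rep" where
  "pullback f R = (fst R, \<lambda>g. snd R (f g))"

definition defining_rep :: "nat \<Rightarrow> complex mat rep" where
  "defining_rep n = (n, \<lambda>g. g)"

definition direct_sum_rep :: "'g rep list \<Rightarrow> 'g rep" where
  "direct_sum_rep Rs = (sum_list (map fst Rs), \<lambda>g. diag_block_mat (map (\<lambda>R. snd R g) Rs))"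

text \<open>Kronecker product: the basis vector \<open>e\<^sub>i \<otimes> e\<^sub>j\<close> of \<open>\<complex>\<^sup>M \<otimes> \<complex>\<^sup>N\<close> has index \<open>i * N + j\<close>.\<close>

definition kron :: "complex mat \<Rightarrow> complex mat \<Rightarrow> complex mat" where
  "kron A B = mat (dim_row A * dim_row B) (dim_col A * dim_col B)
     (\<lambda>(i, j). A $$ (i div dim_row B, j div dim_col B) * B $$ (i mod dim_row B, j mod dim_col B))"

definition tensor_rep :: "'g rep \<Rightarrow> 'g rep \<Rightarrow> 'g rep" where
  "tensor_rep R S = (fst R * fst S, \<lambda>g. kron (snd R g) (snd S g))"


section \<open>Exterior powers\<close>

text \<open>\<open>\<And>\<^sup>d \<complex>\<^sup>N\<close> has the basis \<open>e\<^bsub>j\<^sub>1\<^esub> \<and> \<dots> \<and> e\<^bsub>j\<^sub>d\<^esub>\<close> indexed by \<open>j\<^sub>1 < \<dots> < j\<^sub>d\<close>, and the coordinates of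
  \<open>v\<^sub>1 \<and> \<dots> \<and> v\<^sub>d\<close> in it are the minors of the matrix with rows \<open>v\<^sub>1, \<dots>, v\<^sub>d\<close>. That this is indeed
  the exterior power, that is, the universal target of alternating multilinear maps of \<open>d\<close> vectors, is
  shown in \<open>wedge_universal\<close> below.\<close>

definition ext_index :: "nat \<Rightarrow> nat \<Rightarrow> nat list list" where
  "ext_index N d = filter (\<lambda>J. length J = d) (subseqs [0..<N])"

definition ext_dim :: "nat \<Rightarrow> nat \<Rightarrow> nat" where
  "ext_dim N d = length (ext_index N d)"

definition wedge :: "nat \<Rightarrow> complex vec list \<Rightarrow> complex vec" where
  "wedge N vs = (let d = length vs in
     vec (ext_dim N d) (\<lambda>k. det (mat d d (\<lambda>(r, c). vs ! r $ (ext_index N d ! k ! c)))))"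

text \<open>The matrix of \<open>\<And>\<^sup>d A\<close> (functoriality on all wedges is \<open>ext_mat_wedge\<close>): the basis vector \<open>e\<^bsub>j\<^sub>1\<^esub> \<and> \<dots> \<and> e\<^bsub>j\<^sub>d\<^esub>\<close> is sent to \<open>A e\<^bsub>j\<^sub>1\<^esub> \<and> \<dots> \<and> A e\<^bsub>j\<^sub>d\<^esub>\<close>.\<close>

definition ext_mat :: "nat \<Rightarrow> nat \<Rightarrow> complex mat \<Rightarrow> complex mat" where
  "ext_mat N d A = mat_of_cols (ext_dim N d) (map (\<lambda>J. wedge N (map (col A) J)) (ext_index N d))"

definition ext_rep :: "nat \<Rightarrow> 'g rep \<Rightarrow> 'g rep" where
  "ext_rep d R = (ext_dim (fst R) d, \<lambda>g. ext_mat (fst R) d (snd R g))"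

definition alternating :: "nat \<Rightarrow> nat \<Rightarrow> nat \<Rightarrow> (complex vec list \<Rightarrow> complex vec) \<Rightarrow> bool" where
  "alternating N d K f \<longleftrightarrow>
     (\<forall>vs. length vs = d \<and> set vs \<subseteq> carrier_vec N \<longrightarrow>
        f vs \<in> carrier_vec K \<and>
        (\<forall>i<d. \<forall>u \<in> carrier_vec N. \<forall>v \<in> carrier_vec N. \<forall>a.
           f (vs[i := u + v]) = f (vs[i := u]) + f (vs[i := v]) \<and>
           f (vs[i := a \<cdot>\<^sub>v u]) = a \<cdot>\<^sub>v f (vs[i := u])) \<and>
        (\<forall>i j. i < j \<and> j < d \<and> vs ! i = vs ! j \<longrightarrow> f vs = 0\<^sub>v K))"

lemma alternatingD:
  assumes "alternating N d K f" "length vs = d" "set vs \<subseteq> carrier_vec N"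
  shows "f vs \<in> carrier_vec K"
    and "i < d \<Longrightarrow> u \<in> carrier_vec N \<Longrightarrow> v \<in> carrier_vec N \<Longrightarrow>
           f (vs[i := u + v]) = f (vs[i := u]) + f (vs[i := v])"
    and "i < d \<Longrightarrow> u \<in> carrier_vec N \<Longrightarrow> f (vs[i := a \<cdot>\<^sub>v u]) = a \<cdot>\<^sub>v f (vs[i := u])"
    and "i < j \<Longrightarrow> j < d \<Longrightarrow> vs ! i = vs ! j \<Longrightarrow> f vs = 0\<^sub>v K"
  using assms unfolding alternating_def by blast+

lemma set_update_carrier:
  "set vs \<subseteq> carrier_vec N \<Longrightarrow> u \<in> carrier_vec N \<Longrightarrow> set (vs[i := u]) \<subseteq> carrier_vec N"
  by (metis insert_subset order_trans set_update_subset_insert)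

lemma ext_index_iff:
  "J \<in> set (ext_index N d) \<longleftrightarrow> length J = d \<and> sorted_wrt (<) J \<and> set J \<subseteq> {..<N}"
proof -
  have 1: "sorted_wrt (<) J \<and> set J \<subseteq> set xs" if "sorted_wrt (<) xs" "J \<in> set (subseqs xs)"
    for J and xs :: "nat list"
    using that
  proof (induction xs arbitrary: J)
    case (Cons x xs)
    then show ?case by (auto simp: Let_def) blast+
  qed auto
  have 2: "J \<in> set (subseqs xs)" if "sorted_wrt (<) xs" "sorted_wrt (<) J" "set J \<subseteq> set xs"
    for J and xs :: "nat list"
    using that
  proof (induction xs arbitrary: J)
    case (Cons x xs)
    show ?case
    proof (cases "x \<in> set J")
      case True
      then obtain y J' where J: "J = y # J'" by (cases J) auto
      have "y = x"
        using Cons.prems True unfolding J by (auto, metis less_asym')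
      moreover have "set J' \<subseteq> set xs"
        using Cons.prems \<open>y = x\<close> unfolding J by auto
      ultimately show ?thesis using Cons.IH[of J'] Cons.prems by (auto simp: J Let_def)
    next
      case False
      then show ?thesis using Cons.IH[of J] Cons.prems by (auto simp: Let_def)
    qed
  qed auto
  have "sorted_wrt (<) [0..<N]" by simp
  from 1[OF this] 2[OF this] show ?thesis
    unfolding ext_index_def by (auto simp: atLeast0LessThan)
qed

lemma distinct_ext_index: "distinct (ext_index N d)"
proof -
  have "distinct (subseqs [0..<N])"
    using distinct_set_subseqs[of "[0..<N]"] by (simp add: distinct_map)
  then show ?thesis by (simp add: ext_index_def)
qed

lemma ext_dim_eq: "ext_dim N d = N choose d"
proof -
  have "bij_betw set (set (ext_index N d)) {B. B \<subseteq> {..<N} \<and> card B = d}"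
  proof (intro bij_betw_imageI)
    show "inj_on set (set (ext_index N d))"
      by (auto simp: inj_on_def ext_index_iff intro: strict_sorted_equal)
    show "set ` set (ext_index N d) = {B. B \<subseteq> {..<N} \<and> card B = d}"
    proof (intro equalityI subsetI)
      fix B assume "B \<in> {B. B \<subseteq> {..<N} \<and> card B = d}"
      then have B: "B \<subseteq> {..<N}" "card B = d" "finite B" by (auto intro: finite_subset)
      then have "sorted_list_of_set B \<in> set (ext_index N d)"
        by (auto simp: ext_index_iff)
      then show "B \<in> set ` set (ext_index N d)" using B by (metis image_eqI set_sorted_list_of_set)
    qed (auto simp: ext_index_iff strict_sorted_iff distinct_card)
  qed
  then have "card (set (ext_index N d)) = N choose d"
    by (metis bij_betw_same_card card_lessThan finite_lessThan n_subsets)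
  then show ?thesis
    by (simp add: ext_dim_def distinct_card distinct_ext_index)
qed

lemma alternating_wedge: "alternating N d (ext_dim N d) (wedge N)"
proof -
  have "wedge N (vs[i := u + v]) = wedge N (vs[i := u]) + wedge N (vs[i := v])"
       "wedge N (vs[i := a \<cdot>\<^sub>v u]) = a \<cdot>\<^sub>v wedge N (vs[i := u])"
    if vs: "length vs = d" "set vs \<subseteq> carrier_vec N" and i: "i < d"
      and u: "u \<in> carrier_vec N" and v: "v \<in> carrier_vec N" for vs i u v a
  proof -
    have lt: "ext_index N d ! k ! c < N" if "k < ext_dim N d" "c < d" for k c
      using nth_mem[of k "ext_index N d"] that unfolding ext_dim_def ext_index_iff
      by (metis lessThan_iff nth_mem subsetD)
    define M where "M w k = mat d d (\<lambda>(r, c). vs[i := w] ! r $ (ext_index N d ! k ! c))" for w k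
    define R where "R w k = vec d (\<lambda>c. w $ (ext_index N d ! k ! c))" for w :: "complex vec" and k
    have M: "M w k = mat\<^sub>r d d (\<lambda>r. if r = i then R w k else R (vs ! r) k)" for w k
      unfolding M_def R_def using vs i by (intro eq_matI) auto
    have Rc: "R w k \<in> carrier_vec d" for w k by (simp add: R_def)
    have "R (u + v) k = R u k + R v k" "R (a \<cdot>\<^sub>v u) k = a \<cdot>\<^sub>v R u k" if "k < ext_dim N d" for k
      using u v lt[OF that] unfolding R_def by (auto intro!: eq_vecI)
    then have "det (M (u + v) k) = det (M u k) + det (M v k)"
      and "det (M (a \<cdot>\<^sub>v u) k) = a * det (M u k)" if "k < ext_dim N d" for k
    proof -
      assume R: "\<And>k. k < ext_dim N d \<Longrightarrow> R (u + v) k = R u k + R v k"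
                "\<And>k. k < ext_dim N d \<Longrightarrow> R (a \<cdot>\<^sub>v u) k = a \<cdot>\<^sub>v R u k"
      show "det (M (u + v) k) = det (M u k) + det (M v k)"
        using det_row_add[of "\<lambda>_. R u k" i d "\<lambda>_. R v k" "\<lambda>r. R (vs ! r) k"] R(1)[OF that] i Rc
        by (simp add: M cong: if_cong)
      have "M (a \<cdot>\<^sub>v u) k = multrow i a (M u k)"
        unfolding M R(2)[OF that] using Rc by (intro eq_matI) (auto simp: R_def)
      moreover have "M u k \<in> carrier_mat d d" by (simp add: M_def)
      ultimately show "det (M (a \<cdot>\<^sub>v u) k) = a * det (M u k)"
        using det_multrow i by metis
    qed
    moreover have "wedge N (vs[i := w]) = vec (ext_dim N d) (\<lambda>k. det (M w k))" for w
      using vs by (simp add: wedge_def M_def)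
    ultimately show "wedge N (vs[i := u + v]) = wedge N (vs[i := u]) + wedge N (vs[i := v])"
       "wedge N (vs[i := a \<cdot>\<^sub>v u]) = a \<cdot>\<^sub>v wedge N (vs[i := u])"
      by (auto intro!: eq_vecI)
  qed
  moreover have "wedge N vs = 0\<^sub>v (ext_dim N d)"
    if "length vs = d" "i < j" "j < d" "vs ! i = vs ! j" for vs i j
  proof -
    have "det (mat d d (\<lambda>(r, c). vs ! r $ (ext_index N d ! k ! c))) = 0" for k
      using that by (intro det_identical_rows[of _ d i j]) (auto intro!: eq_vecI)
    then show ?thesis using that by (auto simp: wedge_def Let_def intro!: eq_vecI)
  qed
  ultimately show ?thesis
    unfolding alternating_def by (auto simp: wedge_def Let_def)
qed

lemma wedge_basis:
  assumes "k < ext_dim N d"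
  shows "wedge N (map (unit_vec N) (ext_index N d ! k)) = unit_vec (ext_dim N d) k"
proof (rule eq_vecI)
  define J where "J l = ext_index N d ! l" for l
  have J: "length (J l) = d" "sorted_wrt (<) (J l)" "set (J l) \<subseteq> {..<N}" if "l < ext_dim N d" for l
    using that ext_index_iff[of "J l" N d] nth_mem[of l "ext_index N d"]
    unfolding J_def ext_dim_def by auto
  fix l assume "l < dim_vec (unit_vec (ext_dim N d) k)"
  then have l: "l < ext_dim N d" by simp
  define M where "M = mat d d (\<lambda>(r, c). map (unit_vec N) (J k) ! r $ (J l ! c) :: complex)"
  have lt: "J l ! c < N" "J k ! c < N" if "c < d" for c
    using J(1,3)[OF l] J(1,3)[OF assms] that by (metis lessThan_iff nth_mem subsetD)+
  have M: "M = mat d d (\<lambda>(r, c). if J l ! c = J k ! r then 1 else 0)"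
    unfolding M_def using J(1)[OF assms] lt by (intro eq_matI) auto
  have *: "wedge N (map (unit_vec N) (J k)) $ l = det M"
    using J(1)[OF assms] l by (simp add: wedge_def M_def J_def)
  show "wedge N (map (unit_vec N) (ext_index N d ! k)) $ l = unit_vec (ext_dim N d) k $ l"
  proof (cases "l = k")
    case True
    have "distinct (J k)" using J(2)[OF assms] strict_sorted_iff by blast
    then have "M = 1\<^sub>m d"
      unfolding M True using J(1)[OF assms] by (intro eq_matI) (auto simp: nth_eq_iff_index_eq)
    then show ?thesis using * True l by (simp add: J_def)
  next
    case False
    have dist: "distinct (J k)" "distinct (J l)"
      using J(2)[OF assms] J(2)[OF l] strict_sorted_iff by blast+
    have "J k \<noteq> J l"
      using False assms l distinct_ext_index[of N d]
      by (simp add: J_def ext_dim_def nth_eq_iff_index_eq)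
    then have "set (J k) \<noteq> set (J l)"
      using J(2)[OF assms] J(2)[OF l] strict_sorted_equal by blast
    moreover have "card (set (J k)) = card (set (J l))"
      using dist J(1)[OF assms] J(1)[OF l] by (simp add: distinct_card)
    ultimately have "\<not> set (J k) \<subseteq> set (J l)"
      using card_subset_eq[of "set (J l)" "set (J k)"] by auto
    then obtain r where r: "r < d" "J k ! r \<notin> set (J l)"
      using J(1)[OF assms] by (metis in_set_conv_nth subsetI)
    have "M = mat\<^sub>r d d (\<lambda>i. if i = r then 0\<^sub>v d else row M i)"
    proof (rule eq_matI)
      fix i j assume "i < dim_row (mat\<^sub>r d d (\<lambda>i. if i = r then 0\<^sub>v d else row M i))"
        "j < dim_col (mat\<^sub>r d d (\<lambda>i. if i = r then 0\<^sub>v d else row M i))"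
      then have ij: "i < d" "j < d" by auto
      then have "J l ! j \<in> set (J l)" using J(1)[OF l] by simp
      then have "J l ! j \<noteq> J k ! r" using r(2) by metis
      then show "M $$ (i, j) = mat\<^sub>r d d (\<lambda>i. if i = r then 0\<^sub>v d else row M i) $$ (i, j)"
        using ij by (auto simp: M)
    qed (auto simp: M)
    moreover have "det (mat\<^sub>r d d (\<lambda>i. if i = r then 0\<^sub>v d else row M i)) = 0"
      using r(1) by (intro det_row_0) (auto simp: M)
    ultimately have "det M = 0" by metis
    then show ?thesis using * False l assms by (simp add: J_def)
  qed
qed (use assms nth_mem[of k "ext_index N d"] ext_index_iff in \<open>auto simp: wedge_def ext_dim_def Let_def\<close>)

lemma alternating_swap:
  assumes f: "alternating N d K f" and vs: "length vs = d" "set vs \<subseteq> carrier_vec N"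
    and ij: "i < d" "j < d" "i \<noteq> j" and uv: "u \<in> carrier_vec N" "v \<in> carrier_vec N"
  shows "f (vs[i := u, j := v]) + f (vs[i := v, j := u]) = 0\<^sub>v K"
proof -
  define w where "w a b = f (vs[i := a, j := b])" for a b
  have w': "w a b = f (vs[j := b, i := a])" for a b
    using ij by (simp add: w_def list_update_swap)
  have c: "w a b \<in> carrier_vec K" if "a \<in> carrier_vec N" "b \<in> carrier_vec N" for a b
    unfolding w_def using that vs by (intro alternatingD(1)[OF f] set_update_carrier) auto
  have z: "w a a = 0\<^sub>v K" if "a \<in> carrier_vec N" for a
  proof (cases "i < j")
    case True
    show ?thesis unfolding w_def using that vs ij True
      by (intro alternatingD(4)[OF f, of _ i j] set_update_carrier) auto
  next
    case False
    show ?thesis unfolding w_def using that vs ij False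
      by (intro alternatingD(4)[OF f, of _ j i] set_update_carrier) auto
  qed
  have 1: "w a (u + v) = w a u + w a v" if "a \<in> carrier_vec N" for a
    unfolding w_def using that vs ij uv by (intro alternatingD(2)[OF f] set_update_carrier) auto
  have 2: "w (u + v) b = w u b + w v b" if "b \<in> carrier_vec N" for b
    unfolding w' using that vs ij uv by (intro alternatingD(2)[OF f] set_update_carrier) auto
  have "0\<^sub>v K = w (u + v) (u + v)" using z uv by simp
  also have "\<dots> = (w u u + w v u) + (w u v + w v v)"
    using uv by (simp add: 1 2)
  also have "\<dots> = w u v + w v u"
    using z uv c[of u v] c[of v u] by (simp add: comm_add_vec)
  finally show ?thesis by (simp add: w_def)
qed

lemma alternating_eq_zero:
  assumes f: "alternating N d K f"
    and zero: "\<And>J. J \<in> set (ext_index N d) \<Longrightarrow> f (map (unit_vec N) J) = 0\<^sub>v K"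
    and vs: "length vs = d" "set vs \<subseteq> carrier_vec N"
  shows "f vs = 0\<^sub>v K"
proof -
  have unit: "f (map (unit_vec N) J) = 0\<^sub>v K" if J: "length J = d" "set J \<subseteq> {..<N}" for J
  proof (cases "distinct J")
    case False
    then obtain i j where ij: "i < j" "j < d" "J ! i = J ! j"
      using J(1) by (metis distinct_conv_nth linorder_neqE_nat)
    then show ?thesis
      using J by (intro alternatingD(4)[OF f, of _ i j]) auto
  next
    case True
    define I where "I = sort J"
    have I: "I \<in> set (ext_index N d)" "length I = d" "set I \<subseteq> {..<N}"
      using J True by (auto simp: ext_index_iff I_def strict_sorted_iff)
    have "mset J = mset I" by (simp add: I_def)
    then obtain p where p: "p permutes {..<length I}" "permute_list p I = J"
      by (rule mset_eq_permutation)
    have "f (map (unit_vec N) (permute_list p I)) = 0\<^sub>v K"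
      using finite_lessThan p(1)
    proof (induction rule: permutes_rev_induct)
      case id
      then show ?case using zero[OF I(1)] by simp
    next
      case (swap a b p)
      define us :: "complex vec list" where "us = map (unit_vec N) (permute_list p I)"
      have us: "length us = d" "set us \<subseteq> carrier_vec N" "f us = 0\<^sub>v K"
        using swap I(2) by (auto simp: us_def)
      have ab: "a < d" "b < d" using swap I by auto
      have in_c: "us ! a \<in> carrier_vec N" "us ! b \<in> carrier_vec N"
        using us(1,2) ab by (auto intro!: subsetD[OF us(2)])
      have "map (unit_vec N) (permute_list (p \<circ> Transposition.transpose a b) I)
          = us[a := us ! b, b := us ! a]"
        using ab I(2) swap(3)
        by (intro nth_equalityI)
           (auto simp: us_def permute_list_def nth_list_update Transposition.transpose_def)
      moreover have "f (us[a := us ! b, b := us ! a]) + f (us[a := us ! a, b := us ! b]) = 0\<^sub>v K"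
        using alternating_swap[OF f us(1,2) ab swap(3) in_c(2,1)] .
      moreover have "us[a := us ! a, b := us ! b] = us" by simp
      moreover have "f (us[a := us ! b, b := us ! a]) \<in> carrier_vec K"
        using us in_c by (intro alternatingD(1)[OF f] set_update_carrier) auto
      ultimately show ?case using us(3) by (metis right_zero_vec)
    qed
    then show ?thesis using p by simp
  qed
  have "f vs = 0\<^sub>v K"
    if "k \<le> d" "length vs = d" "set vs \<subseteq> carrier_vec N"
      "\<And>i. k \<le> i \<Longrightarrow> i < d \<Longrightarrow> vs ! i \<in> unit_vec N ` {..<N}" for k vs
    using that
  proof (induction k arbitrary: vs)
    case 0
    then have "\<forall>i. \<exists>j. i < d \<longrightarrow> vs ! i = unit_vec N j \<and> j < N" by blast
    then obtain h where h: "\<And>i. i < d \<Longrightarrow> vs ! i = unit_vec N (h i) \<and> h i < N" by metis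
    then have "vs = map (unit_vec N) (map h [0..<d])"
      using 0 by (intro nth_equalityI) auto
    moreover have "f (map (unit_vec N) (map h [0..<d])) = 0\<^sub>v K"
      using h by (intro unit) auto
    ultimately show ?case by simp
  next
    case (Suc k)
    then have k: "k < d" by simp
    define v where "v = vs ! k"
    have v: "v \<in> carrier_vec N" using Suc.prems k by (auto simp: v_def intro!: subsetD[OF Suc.prems(3)])
    have e: "f (vs[k := unit_vec N n]) = 0\<^sub>v K" if "n < N" for n
    proof (rule Suc.IH)
      fix i assume "k \<le> i" "i < d"
      then show "vs[k := unit_vec N n] ! i \<in> unit_vec N ` {..<N}"
        using Suc.prems that k by (cases "i = k") auto
    qed (use Suc.prems k in \<open>simp_all add: set_update_carrier\<close>)
    have "f (vs[k := vec N (\<lambda>i. if i < n then v $ i else 0)]) = 0\<^sub>v K" if "n \<le> N" for n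
      using that
    proof (induction n)
      case 0
      have "vec N (\<lambda>i. if i < 0 then v $ i else 0) = 0 \<cdot>\<^sub>v (0\<^sub>v N :: complex vec)"
        by (intro eq_vecI) auto
      moreover have "f (vs[k := 0 \<cdot>\<^sub>v 0\<^sub>v N]) = 0 \<cdot>\<^sub>v f (vs[k := 0\<^sub>v N])"
        using Suc.prems k by (intro alternatingD(3)[OF f]) auto
      moreover have "f (vs[k := 0\<^sub>v N]) \<in> carrier_vec K"
        using Suc.prems by (intro alternatingD(1)[OF f] set_update_carrier) auto
      ultimately show ?case by auto
    next
      case (Suc n)
      define a where "a = vec N (\<lambda>i. if i < n then v $ i else 0)"
      have "vec N (\<lambda>i. if i < Suc n then v $ i else 0) = a + v $ n \<cdot>\<^sub>v unit_vec N n"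
        using Suc.prems by (intro eq_vecI) (auto simp: a_def less_Suc_eq)
      moreover have "f (vs[k := a + v $ n \<cdot>\<^sub>v unit_vec N n])
        = f (vs[k := a]) + f (vs[k := v $ n \<cdot>\<^sub>v unit_vec N n])"
        using \<open>length vs = d\<close> \<open>set vs \<subseteq> _\<close> k by (intro alternatingD(2)[OF f]) (auto simp: a_def)
      moreover have "f (vs[k := v $ n \<cdot>\<^sub>v unit_vec N n]) = v $ n \<cdot>\<^sub>v f (vs[k := unit_vec N n])"
        using \<open>length vs = d\<close> \<open>set vs \<subseteq> _\<close> k by (intro alternatingD(3)[OF f]) auto
      moreover have "v $ n \<cdot>\<^sub>v 0\<^sub>v K = 0\<^sub>v K" by (intro eq_vecI) auto
      ultimately show ?case using Suc e[of n] by (simp add: a_def)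
    qed
    from this[of N] have "f (vs[k := vec N (\<lambda>i. if i < N then v $ i else 0)]) = 0\<^sub>v K" by simp
    moreover have "vec N (\<lambda>i. if i < N then v $ i else 0) = v"
      using v by (intro eq_vecI) auto
    moreover have "vs[k := v] = vs" by (simp add: v_def)
    ultimately show ?case by simp
  qed
  from this[of d vs] vs show ?thesis by simp
qed

lemma alternating_unique:
  assumes f: "alternating N d K f" and g: "alternating N d K g"
    and eq: "\<And>J. J \<in> set (ext_index N d) \<Longrightarrow> f (map (unit_vec N) J) = g (map (unit_vec N) J)"
    and vs: "length vs = d" "set vs \<subseteq> carrier_vec N"
  shows "f vs = g vs"
proof -
  have fc: "f us \<in> carrier_vec K" and gc: "g us \<in> carrier_vec K"
    if "length us = d" "set us \<subseteq> carrier_vec N" for us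
    using that alternatingD(1)[OF f] alternatingD(1)[OF g] by auto
  have "alternating N d K (\<lambda>vs. f vs - g vs)"
    unfolding alternating_def
  proof (intro allI impI conjI ballI; (elim conjE)?)
    fix us :: "complex vec list" and i and u v :: "complex vec" and a :: complex
    assume us: "length us = d" "set us \<subseteq> carrier_vec N" and i: "i < d"
      and u: "u \<in> carrier_vec N" and v: "v \<in> carrier_vec N"
    have c: "f (us[i := w]) \<in> carrier_vec K" "g (us[i := w]) \<in> carrier_vec K"
      if "w \<in> carrier_vec N" for w
      using us that by (simp_all add: fc gc set_update_carrier)
    note [simp] = alternatingD(2,3)[OF f us i] alternatingD(2,3)[OF g us i]
    show "f (us[i := u + v]) - g (us[i := u + v])
        = f (us[i := u]) - g (us[i := u]) + (f (us[i := v]) - g (us[i := v]))"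
      using u v c[OF u] c[OF v] by (auto intro!: eq_vecI)
    show "f (us[i := a \<cdot>\<^sub>v u]) - g (us[i := a \<cdot>\<^sub>v u]) = a \<cdot>\<^sub>v (f (us[i := u]) - g (us[i := u]))"
      using u c[OF u] by (auto intro!: eq_vecI simp: algebra_simps)
  next
    fix us :: "complex vec list" and i j
    assume us: "length us = d" "set us \<subseteq> carrier_vec N" "i < j" "j < d" "us ! i = us ! j"
    show "f us - g us = 0\<^sub>v K"
      using alternatingD(4)[OF f us] alternatingD(4)[OF g us] by auto
  qed (auto intro!: minus_carrier_vec fc gc)
  moreover have "f (map (unit_vec N) J) - g (map (unit_vec N) J) = 0\<^sub>v K"
    if "J \<in> set (ext_index N d)" for J
    using eq[OF that] that by (auto simp: ext_index_iff intro!: minus_cancel_vec gc)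
  ultimately have "f vs - g vs = 0\<^sub>v K" using vs by (rule alternating_eq_zero)
  then have "(f vs - g vs) $ i = 0" if "i < K" for i using that by simp
  then show ?thesis using fc[OF vs] gc[OF vs] by (intro eq_vecI) auto
qed

lemma alternating_mult_mat:
  assumes f: "alternating N d K f" and F: "F \<in> carrier_mat L K"
  shows "alternating N d L (\<lambda>vs. F *\<^sub>v f vs)"
  unfolding alternating_def
proof (intro allI impI conjI ballI; (elim conjE)?)
  fix us :: "complex vec list" and i and u v :: "complex vec" and a :: complex
  assume us: "length us = d" "set us \<subseteq> carrier_vec N" and i: "i < d"
    and u: "u \<in> carrier_vec N" and v: "v \<in> carrier_vec N"
  have c: "f (us[i := w]) \<in> carrier_vec K" if "w \<in> carrier_vec N" for w
    using us that by (simp add: alternatingD(1)[OF f] set_update_carrier)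
  show "F *\<^sub>v f (us[i := u + v]) = F *\<^sub>v f (us[i := u]) + F *\<^sub>v f (us[i := v])"
    using alternatingD(2)[OF f us i u v] mult_add_distrib_mat_vec[OF F c[OF u] c[OF v]] by simp
  show "F *\<^sub>v f (us[i := a \<cdot>\<^sub>v u]) = a \<cdot>\<^sub>v (F *\<^sub>v f (us[i := u]))"
    using alternatingD(3)[OF f us i u] mult_mat_vec[OF F c[OF u]] by simp
next
  fix us :: "complex vec list" and i j
  assume us: "length us = d" "set us \<subseteq> carrier_vec N" "i < j" "j < d" "us ! i = us ! j"
  show "F *\<^sub>v f us = 0\<^sub>v L"
    using alternatingD(4)[OF f us] F by (auto intro!: eq_vecI)
qed (use F in \<open>auto intro!: mult_mat_vec_carrier alternatingD(1)[OF f]\<close>)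

lemma mult_mat_unit_vec:
  assumes "A \<in> carrier_mat r n" "j < n"
  shows "(A :: complex mat) *\<^sub>v unit_vec n j = col A j"
  using assms by (intro eq_vecI) auto

theorem wedge_universal:
  assumes f: "alternating N d K f"
  shows "\<exists>!F. F \<in> carrier_mat K (ext_dim N d) \<and>
           (\<forall>vs. length vs = d \<and> set vs \<subseteq> carrier_vec N \<longrightarrow> f vs = F *\<^sub>v wedge N vs)"
proof -
  define F where "F = mat_of_cols K (map (\<lambda>J. f (map (unit_vec N) J)) (ext_index N d))"
  have F: "F \<in> carrier_mat K (ext_dim N d)" using mat_of_cols_carrier(1) by (metis F_def ext_dim_def length_map)
  have idx: "length (ext_index N d ! k) = d" "ext_index N d ! k \<in> set (ext_index N d)"
    if "k < ext_dim N d" for k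
    using that nth_mem[of k "ext_index N d"] ext_index_iff by (auto simp: ext_dim_def)
  have colF: "col F k = f (map (unit_vec N) (ext_index N d ! k))" if "k < ext_dim N d" for k
    using that alternatingD(1)[OF f, of "map (unit_vec N) (ext_index N d ! k)"] idx(1)[OF that]
      image_subsetI[of "set (ext_index N d ! k)" "unit_vec N" "carrier_vec N"]
    unfolding F_def by (subst col_mat_of_cols) (auto simp: ext_dim_def)
  have Fw: "f vs = F *\<^sub>v wedge N vs" if "length vs = d" "set vs \<subseteq> carrier_vec N" for vs
  proof (rule alternating_unique[OF f alternating_mult_mat[OF alternating_wedge F] _ that])
    fix J assume "J \<in> set (ext_index N d)"
    then obtain k where k: "k < ext_dim N d" "J = ext_index N d ! k"
      by (auto simp: in_set_conv_nth ext_dim_def)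
    then show "f (map (unit_vec N) J) = F *\<^sub>v wedge N (map (unit_vec N) J)"
      by (simp add: wedge_basis mult_mat_unit_vec[OF F] colF)
  qed
  show ?thesis
  proof (rule ex1I[of _ F])
    fix F' assume F': "F' \<in> carrier_mat K (ext_dim N d) \<and>
      (\<forall>vs. length vs = d \<and> set vs \<subseteq> carrier_vec N \<longrightarrow> f vs = F' *\<^sub>v wedge N vs)"
    have "col F' k = col F k" if k: "k < ext_dim N d" for k
    proof -
      have "f (map (unit_vec N) (ext_index N d ! k))
          = F' *\<^sub>v wedge N (map (unit_vec N) (ext_index N d ! k))"
        using idx(1)[OF k] by (intro conjunct2[OF F', rule_format]) auto
      then show ?thesis using k by (simp add: wedge_basis mult_mat_unit_vec[OF conjunct1[OF F']] colF)
    qed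
    then show "F' = F" using F F' by (intro mat_col_eqI) auto
  qed (use F Fw in auto)
qed

theorem ext_mat_wedge:
  assumes A: "A \<in> carrier_mat N N" and vs: "length vs = d" "set vs \<subseteq> carrier_vec N"
  shows "ext_mat N d A *\<^sub>v wedge N vs = wedge N (map (\<lambda>v. A *\<^sub>v v) vs)"
proof -
  have E: "ext_mat N d A \<in> carrier_mat (ext_dim N d) (ext_dim N d)"
    using mat_of_cols_carrier(1) by (metis ext_mat_def ext_dim_def length_map)
  have "alternating N d (ext_dim N d) (\<lambda>vs. wedge N (map (\<lambda>v. A *\<^sub>v v) vs))"
    unfolding alternating_def
  proof (intro allI impI conjI ballI; (elim conjE)?)
    fix us :: "complex vec list"
    assume us: "length us = d" "set us \<subseteq> carrier_vec N"
    have Aus: "length (map (\<lambda>v. A *\<^sub>v v) us) = d" "set (map (\<lambda>v. A *\<^sub>v v) us) \<subseteq> carrier_vec N"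
      using us A by (auto intro!: mult_mat_vec_carrier)
    note W = alternatingD[OF alternating_wedge Aus]
    show "wedge N (map (\<lambda>v. A *\<^sub>v v) us) \<in> carrier_vec (ext_dim N d)" by (rule W(1))
    fix i
    {
      fix u v :: "complex vec" and a :: complex
      assume i: "i < d" and uv: "u \<in> carrier_vec N" "v \<in> carrier_vec N"
      have Auv: "A *\<^sub>v u \<in> carrier_vec N" "A *\<^sub>v v \<in> carrier_vec N"
        using A uv by (auto intro!: mult_mat_vec_carrier)
      show "wedge N (map (\<lambda>v. A *\<^sub>v v) (us[i := u + v])) =
          wedge N (map (\<lambda>v. A *\<^sub>v v) (us[i := u])) + wedge N (map (\<lambda>v. A *\<^sub>v v) (us[i := v]))"
        using W(2)[OF i Auv] mult_add_distrib_mat_vec[OF A uv] by (simp add: map_update)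
      show "wedge N (map (\<lambda>v. A *\<^sub>v v) (us[i := a \<cdot>\<^sub>v u])) =
          a \<cdot>\<^sub>v wedge N (map (\<lambda>v. A *\<^sub>v v) (us[i := u]))"
        using W(3)[OF i Auv(1)] mult_mat_vec[OF A uv(1)] by (simp add: map_update)
    next
      fix j assume "i < j" "j < d" "us ! i = us ! j"
      then show "wedge N (map (\<lambda>v. A *\<^sub>v v) us) = 0\<^sub>v (ext_dim N d)"
        using us by (intro W(4)[of i j]) auto
    }
  qed
  then show ?thesis
  proof (rule alternating_unique[OF alternating_mult_mat[OF alternating_wedge E] _ _ vs])
    fix J assume JI: "J \<in> set (ext_index N d)"
    then obtain k where k: "k < ext_dim N d" "J = ext_index N d ! k"
      by (auto simp: in_set_conv_nth ext_dim_def)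
    have J: "length J = d" "set J \<subseteq> {..<N}"
      using JI by (auto simp: ext_index_iff)
    have "map (\<lambda>v. A *\<^sub>v v) (map (unit_vec N) J) = map (col A) J"
      using J by (auto simp: mult_mat_unit_vec[OF A])
    moreover have "col (ext_mat N d A) k = wedge N (map (col A) J)"
      unfolding ext_mat_def using k J by (subst col_mat_of_cols) (auto simp: ext_dim_def wedge_def Let_def)
    ultimately show "ext_mat N d A *\<^sub>v wedge N (map (unit_vec N) J)
        = wedge N (map (\<lambda>v. A *\<^sub>v v) (map (unit_vec N) J))"
      using k by (simp add: wedge_basis mult_mat_unit_vec[OF E] del: map_map)
  qed
qed

end

theory Submission
  imports Defs
begin

text \<open>
  The vectors \<open>w\<^sub>\<lambda>\<close>, the wedge of all \<open>e\<^sub>i \<otimes> e\<^sub>j\<close> with \<open>(i, j)\<close> in the diagram of \<open>\<lambda>\<close>, are highest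
  weight vectors of weight \<open>(\<lambda>, \<lambda>')\<close> in the exterior power. They are the only ones: with raising
  operators \<open>E\<^bsub>ab\<^esub>\<close> for \<open>GL\<^sub>m\<close> and \<open>F\<^bsub>ab\<^esub>\<close> for \<open>GL\<^sub>n\<close>, the operator
  \<open>\<Sum> E\<^bsub>ba\<^esub> E\<^bsub>ab\<^esub> + \<Sum> F\<^bsub>ba\<^esub> F\<^bsub>ab\<^esub>\<close> is diagonal in the monomial basis, and its eigenvalue at a
  set \<open>S\<close> of \<open>d\<close> cells is the sum of all (zero-based) coordinates of \<open>S\<close> minus the number of pairs
  of cells in a common row or column, which vanishes exactly when \<open>S\<close> is a Young diagram. Hence no
  vector is killed by all translates of the forms \<open>w\<^sub>\<lambda>\<close>, and, transposing, no form by all translates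
  of the vectors \<open>w\<^sub>\<lambda>\<close>.

  In a representation with character \<open>s\<^sub>\<lambda>\<close> the top weight space of a one-parameter torus is a line,
  since only the tableau with all entries of row \<open>i\<close> equal to \<open>i\<close> attains the top degree. This gives
  a highest weight vector \<open>v\<close> and a lowest weight form \<open>\<phi>\<close>, and \<open>v \<phi>\<close> lies in the span of the group,
  which makes tensor products of two such representations irreducible.

  Finally a representation is determined by the matrix coefficients of a separating family of vectors
  and forms. Here these coefficients agree on the big cell of lower times upper triangular matrices,
  hence everywhere, on the exterior power and on the direct sum.
\<close>

section \<open>Linear algebra\<close>

text \<open>\<open>is_W\<close> supplies irreducibility and a character but no model, so the two
  sides cannot be matched basis by basis, and equal characters alone would leave complete
  reducibility to be proved. What is the same in every model is the number
  \<open>\<phi> \<bullet> (g v)\<close> for a highest weight vector \<open>v\<close> and a lowest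
  weight form \<open>\<phi>\<close> with \<open>\<phi> \<bullet> v = 1\<close>: for
  \<open>g = l u\<close> with \<open>l\<close> lower and \<open>u\<close> upper triangular it is the
  weight at \<open>l\<close> times the weight at \<open>u\<close>.

  Highest weight vectors are found by degree. The exponents \<open>n, ..., 1\<close> of
  \<open>torus\<close> decrease strictly, so conjugation by it multiplies each entry above the
  diagonal of a triangular matrix by a positive power of \<open>t\<close>; at \<open>t = 0\<close>
  only the diagonal is left, and a vector of top degree cannot see the difference. This argument
  serves both \<open>GL n\<close> on one \<open>W\<close> and the pair of groups on the exterior
  power. The raising operators enter only as the first-order terms in \<open>s\<close> of elementary
  matrices \<open>1 + s E\<close>, so that the group alone has to act.\<close>

lemma scalar_prod_mult_mat_vec:
  assumes "A \<in> carrier_mat nr nc" "x \<in> carrier_vec nc" "y \<in> carrier_vec nr"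
  shows "y \<bullet> (A *\<^sub>v x) = (transpose_mat A *\<^sub>v y) \<bullet> (x :: complex vec)"
  using transpose_vec_mult_scalar[OF assms] by simp

lemma vec_eq_0_iff_scalar_prod:
  assumes "(x :: complex vec) \<in> carrier_vec N"
  shows "x = 0\<^sub>v N \<longleftrightarrow> (\<forall>y \<in> carrier_vec N. y \<bullet> x = 0)"
proof
  assume *: "\<forall>y \<in> carrier_vec N. y \<bullet> x = 0"
  show "x = 0\<^sub>v N"
  proof (rule eq_vecI)
    fix i assume "i < dim_vec (0\<^sub>v N :: complex vec)"
    then have "i < N" by simp
    then show "x $ i = 0\<^sub>v N $ i" using *[rule_format, of "unit_vec N i"] assms by simp
  qed (use assms in simp)
qed auto

lemma mat_eqI_mult_vec:
  assumes "A \<in> carrier_mat nr nc" "B \<in> carrier_mat nr nc"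
    and eq: "\<And>x. x \<in> carrier_vec nc \<Longrightarrow> A *\<^sub>v x = B *\<^sub>v (x :: complex vec)"
  shows "A = B"
proof (rule mat_col_eqI)
  fix j assume "j < dim_col B"
  then have j: "j < nc" using assms by simp
  show "col A j = col B j"
    using eq[of "unit_vec nc j"] mult_mat_unit_vec[OF assms(1) j] mult_mat_unit_vec[OF assms(2) j] by simp
qed (use assms in auto)

lemma mult_mat_zero_vec: "A \<in> carrier_mat nr nc \<Longrightarrow> A *\<^sub>v 0\<^sub>v nc = (0\<^sub>v nr :: complex vec)"
  by (intro eq_vecI) auto

text \<open>Zero rows pad the matrix to a square one. Since \<open>k < N\<close>, its row
  \<open>k\<close> is zero and its determinant vanishes.\<close>

lemma nonzero_kernel:
  assumes A: "(A :: complex mat) \<in> carrier_mat k N" and "k < N"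
  shows "\<exists>x \<in> carrier_vec N. x \<noteq> 0\<^sub>v N \<and> A *\<^sub>v x = 0\<^sub>v k"
proof -
  define B where "B = mat N N (\<lambda>(i, j). if i < k then A $$ (i, j) else 0)"
  have B: "B \<in> carrier_mat N N" by (simp add: B_def)
  have "B = mat\<^sub>r N N (\<lambda>i. if i = k then 0\<^sub>v N else row B i)"
    by (rule eq_matI) (auto simp: B_def)
  then have "det B = det (mat\<^sub>r N N (\<lambda>i. if i = k then 0\<^sub>v N else row B i))" by (rule arg_cong)
  also have "\<dots> = 0" using assms(2) by (intro det_row_0) (auto simp: B_def)
  finally obtain x where x: "x \<in> carrier_vec N" "x \<noteq> 0\<^sub>v N" "B *\<^sub>v x = 0\<^sub>v N"
    using det_0_iff_vec_prod_zero_field[OF B] by blast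
  have "A *\<^sub>v x = 0\<^sub>v k"
  proof (rule eq_vecI)
    fix i assume "i < dim_vec (0\<^sub>v k :: complex vec)"
    then have i: "i < k" by simp
    then have "row A i = row B i" using A assms(2) by (intro eq_vecI) (auto simp: B_def)
    then have "(A *\<^sub>v x) $ i = (B *\<^sub>v x) $ i" using A B i assms(2) by simp
    then show "(A *\<^sub>v x) $ i = 0\<^sub>v k $ i" using x(3) i assms(2) by simp
  qed (use A in simp)
  then show ?thesis using x by blast
qed

text \<open>A biorthogonal system grows one pair at a time. Fewer than \<open>N\<close> forms have a
  common nonzero zero \<open>z\<close>; some \<open>t\<close> in \<open>S\<close> does not vanish at
  \<open>z\<close>, so \<open>t\<close> and a multiple of \<open>z\<close> form the next pair.
  Subtracting multiples of that vector from the earlier \<open>x j\<close> makes \<open>t\<close>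
  vanish on them and leaves the earlier relations intact, because the earlier forms kill
  \<open>z\<close>.\<close>

lemma dual_system:
  assumes S: "S \<subseteq> carrier_vec N"
    and ann: "\<And>y. y \<in> carrier_vec N \<Longrightarrow> (\<And>s. s \<in> S \<Longrightarrow> s \<bullet> y = 0) \<Longrightarrow> y = 0\<^sub>v N"
    and "k \<le> N"
  shows "\<exists>s x. (\<forall>i<k. s i \<in> S \<and> x i \<in> carrier_vec N) \<and>
           (\<forall>i<k. \<forall>j<k. s i \<bullet> x j = (if i = j then 1 else (0 :: complex)))"
  using \<open>k \<le> N\<close>
proof (induction k)
  case 0
  then show ?case by simp
next
  case (Suc k)
  then have "k \<le> N" by simp
  from Suc.IH[OF this] obtain s x where *: "\<forall>i<k. s i \<in> S \<and> x i \<in> carrier_vec N"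
    and **: "\<forall>i<k. \<forall>j<k. s i \<bullet> x j = (if i = j then 1 else 0)" by (elim exE conjE)
  have s: "\<And>i. i < k \<Longrightarrow> s i \<in> S" and x: "\<And>i. i < k \<Longrightarrow> x i \<in> carrier_vec N" using * by auto
  have sx: "\<And>i j. i < k \<Longrightarrow> j < k \<Longrightarrow> s i \<bullet> x j = (if i = j then 1 else 0)" using ** by blast
  have sc: "\<And>i. i < k \<Longrightarrow> s i \<in> carrier_vec N" using s S by auto
  define A where "A = mat k N (\<lambda>(i, j). s i $ j)"
  obtain z where z: "z \<in> carrier_vec N" "z \<noteq> 0\<^sub>v N" "A *\<^sub>v z = 0\<^sub>v k"
    using nonzero_kernel[of A k N] Suc.prems by (auto simp: A_def)
  have sz: "s i \<bullet> z = 0" if "i < k" for i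
  proof -
    have "row A i = s i" using that sc[OF that] by (intro eq_vecI) (auto simp: A_def)
    then have "s i \<bullet> z = (A *\<^sub>v z) $ i" using that by (simp add: A_def)
    then show ?thesis using z(3) that by simp
  qed
  obtain t where t: "t \<in> S" "t \<bullet> z \<noteq> 0" using ann[OF z(1)] z(2) by blast
  have tc: "t \<in> carrier_vec N" using t S by auto
  define y where "y = (1 / (t \<bullet> z)) \<cdot>\<^sub>v z"
  have y: "y \<in> carrier_vec N" "t \<bullet> y = 1" "\<And>i. i < k \<Longrightarrow> s i \<bullet> y = 0"
    using z t tc sc sz by (auto simp: y_def)
  define s' where "s' = s(k := t)"
  define x' where "x' = (\<lambda>j. if j = k then y else x j - (t \<bullet> x j) \<cdot>\<^sub>v y)"
  have "s' i \<bullet> x' j = (if i = j then 1 else 0)" if "i < Suc k" "j < Suc k" for i j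
    using that y x sx sc tc
    by (auto simp: s'_def x'_def less_Suc_eq scalar_prod_minus_distrib[where n = N])
  moreover have "\<forall>i<Suc k. s' i \<in> S \<and> x' i \<in> carrier_vec N"
    using s t x y by (auto simp: s'_def x'_def less_Suc_eq)
  ultimately show ?case by blast
qed

text \<open>A set with no common nonzero zero contains a basis: \<open>dual_system\<close> with
  \<open>k = N\<close> yields the rows of a matrix together with its inverse.\<close>

lemma invertible_rows:
  assumes S: "S \<subseteq> carrier_vec N"
    and ann: "\<And>y. y \<in> carrier_vec N \<Longrightarrow> (\<And>s. s \<in> S \<Longrightarrow> s \<bullet> y = 0) \<Longrightarrow> y = 0\<^sub>v N"
  obtains s X where "\<And>i. i < N \<Longrightarrow> s i \<in> S" "X \<in> carrier_mat N N"
    "mat N N (\<lambda>(i, j). s i $ j) * X = 1\<^sub>m N" "X * mat N N (\<lambda>(i, j). s i $ j) = (1\<^sub>m N :: complex mat)"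
proof -
  obtain s x where *: "\<forall>i<N. s i \<in> S \<and> x i \<in> carrier_vec N"
    and **: "\<forall>i<N. \<forall>j<N. s i \<bullet> x j = (if i = j then 1 else 0)"
    using dual_system[OF S ann order_refl] by blast
  have s: "\<And>i. i < N \<Longrightarrow> s i \<in> S" and x: "\<And>i. i < N \<Longrightarrow> x i \<in> carrier_vec N" using * by auto
  have sx: "\<And>i j. i < N \<Longrightarrow> j < N \<Longrightarrow> s i \<bullet> x j = (if i = j then 1 else 0)" using ** by blast
  define A where "A = mat N N (\<lambda>(i, j). s i $ j)"
  define X where "X = mat N N (\<lambda>(i, j). x j $ i)"
  have "row A i = s i" if "i < N" for i
    using that s[OF that] S by (intro eq_vecI) (auto simp: A_def)
  moreover have "col X j = x j" if "j < N" for j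
    using that x[OF that] by (intro eq_vecI) (auto simp: X_def)
  ultimately have AX: "A * X = 1\<^sub>m N"
    using sx by (intro eq_matI) (auto simp: A_def X_def)
  have c: "A \<in> carrier_mat N N" "X \<in> carrier_mat N N" by (auto simp: A_def X_def)
  show ?thesis
    using that[OF s c(2) AX[unfolded A_def] mat_mult_left_right_inverse[OF c AX, unfolded A_def]] .
qed

text \<open>Used to turn a proper subspace into a nonzero form that vanishes on it. The rows from
  \<open>invertible_rows\<close> are a basis inside \<open>Z\<close>, so \<open>Z\<close> contains
  all their combinations.\<close>

lemma subspace_eq_carrier:
  assumes Z: "Z \<subseteq> carrier_vec N" "0\<^sub>v N \<in> Z"
    and add: "\<And>x y. x \<in> Z \<Longrightarrow> y \<in> Z \<Longrightarrow> x + y \<in> Z"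
    and smult: "\<And>a x. x \<in> Z \<Longrightarrow> a \<cdot>\<^sub>v x \<in> Z"
    and ann: "\<And>y. y \<in> carrier_vec N \<Longrightarrow> (\<And>z. z \<in> Z \<Longrightarrow> z \<bullet> y = (0 :: complex)) \<Longrightarrow> y = 0\<^sub>v N"
  shows "Z = carrier_vec N"
proof
  show "carrier_vec N \<subseteq> Z"
  proof
    fix y :: "complex vec" assume y: "y \<in> carrier_vec N"
    obtain s X where s: "\<And>i. i < N \<Longrightarrow> s i \<in> Z" and X: "X \<in> carrier_mat N N"
      "X * mat N N (\<lambda>(i, j). s i $ j) = 1\<^sub>m N"
      using invertible_rows[OF Z(1) ann] by metis
    define A where "A = mat N N (\<lambda>(i, j). s i $ j)"
    have A: "A \<in> carrier_mat N N" by (simp add: A_def)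
    \<comment> \<open>The coordinates of \<open>y\<close> in the basis \<open>s\<close>.\<close>
    define c where "c = transpose_mat X *\<^sub>v y"
    have c: "c \<in> carrier_vec N" using X y by (simp add: c_def)
    have "transpose_mat A * transpose_mat X = 1\<^sub>m N"
      using X A transpose_mult[OF X(1) A] by (simp add: A_def)
    then have yc: "y = transpose_mat A *\<^sub>v c"
      using A X y by (simp add: c_def flip: assoc_mult_mat_vec[of _ N N _ N])
    have "vec N (\<lambda>j. \<Sum>i<k. c $ i * s i $ j) \<in> Z" if "k \<le> N" for k
      using that
    proof (induction k)
      case 0
      have "vec N (\<lambda>j. \<Sum>i<0. c $ i * s i $ j) = 0\<^sub>v N" by (intro eq_vecI) auto
      then show ?case using Z(2) by simp
    next
      case (Suc k)
      have "vec N (\<lambda>j. \<Sum>i<Suc k. c $ i * s i $ j) = vec N (\<lambda>j. \<Sum>i<k. c $ i * s i $ j) + c $ k \<cdot>\<^sub>v s k"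
        using s[of k] Z(1) Suc.prems by (intro eq_vecI) auto
      then show ?case using Suc add smult s[of k] by simp
    qed
    from this[of N] have "vec N (\<lambda>j. \<Sum>i<N. c $ i * s i $ j) \<in> Z" by simp
    moreover have "vec N (\<lambda>j. \<Sum>i<N. c $ i * s i $ j) = y"
      using c unfolding yc by (intro eq_vecI) (auto simp: A_def scalar_prod_def atLeast0LessThan mult.commute)
    ultimately show "y \<in> Z" by simp
  qed
qed (rule Z(1))

section \<open>Families of matrix coefficients\<close>

lemma GL_simps:
  "carrier (GL n) = Units (ring_mat TYPE(complex) n ())" "x \<otimes>\<^bsub>GL n\<^esub> y = x * y" "\<one>\<^bsub>GL n\<^esub> = 1\<^sub>m n"
  by (simp_all add: GL_def units_of_def ring_mat_simps)

lemma group_GL: "group (GL n)"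
proof -
  interpret ring "ring_mat TYPE(complex) n ()" by (rule ring_mat)
  show ?thesis unfolding GL_def by (rule units_group)
qed

lemma GL_iff: "A \<in> carrier (GL n) \<longleftrightarrow> A \<in> carrier_mat n n \<and> det A \<noteq> 0"
  using unit_imp_det_non_zero[of A n "()"] det_non_zero_imp_unit[of A n "()"]
  by (auto simp: GL_simps Units_def ring_mat_simps)

lemma GL_inverseI:
  assumes "A \<in> carrier_mat n n" "B \<in> carrier_mat n n" "A * B = 1\<^sub>m n"
  shows "A \<in> carrier (GL n)"
proof -
  have "det A * det B = 1" using assms by (metis det_mult det_one)
  then show ?thesis using assms by (auto simp: GL_iff)
qed

lemma repD:
  assumes "group G" "representation G R"
  shows "g \<in> carrier G \<Longrightarrow> snd R g \<in> carrier_mat (fst R) (fst R)"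
    and "g \<in> carrier G \<Longrightarrow> h \<in> carrier G \<Longrightarrow> snd R (g \<otimes>\<^bsub>G\<^esub> h) = snd R g * snd R h"
    and "snd R \<one>\<^bsub>G\<^esub> = 1\<^sub>m (fst R)"
proof -
  have h: "snd R \<in> hom G (GL (fst R))" using assms by (simp add: representation_def)
  then show "g \<in> carrier G \<Longrightarrow> snd R g \<in> carrier_mat (fst R) (fst R)"
    and "g \<in> carrier G \<Longrightarrow> h \<in> carrier G \<Longrightarrow> snd R (g \<otimes>\<^bsub>G\<^esub> h) = snd R g * snd R h"
    using GL_iff[of "snd R g" "fst R"] by (auto simp: hom_def Pi_def GL_simps(2) simp del: GL_simps(1))
  interpret G: group G by fact
  interpret group_hom G "GL (fst R)" "snd R"
    using h group_GL by (simp add: group_hom_def group_hom_axioms_def assms)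
  show "snd R \<one>\<^bsub>G\<^esub> = 1\<^sub>m (fst R)" by (metis GL_simps(3) hom_one)
qed

lemma representationI:
  assumes "group G" "\<And>g. g \<in> carrier G \<Longrightarrow> snd R g \<in> carrier_mat (fst R) (fst R)"
    and "\<And>g h. g \<in> carrier G \<Longrightarrow> h \<in> carrier G \<Longrightarrow> snd R (g \<otimes>\<^bsub>G\<^esub> h) = snd R g * snd R h"
    and "snd R \<one>\<^bsub>G\<^esub> = 1\<^sub>m (fst R)"
  shows "representation G R"
proof -
  interpret G: group G by fact
  have "snd R g \<in> carrier (GL (fst R))" if g: "g \<in> carrier G" for g
    using assms(3)[OF g G.inv_closed[OF g]] assms(2)[OF g] assms(2)[OF G.inv_closed[OF g]] assms(4) g
    by (intro GL_inverseI[of _ _ "snd R (inv\<^bsub>G\<^esub> g)"]) auto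
  then show ?thesis using assms(3) by (auto simp: representation_def hom_def GL_simps)
qed

text \<open>The linear forms \<open>\<phi> i\<close> act by the dot product. These data determine the representation up to
  isomorphism, see \<open>framed_iso\<close>.\<close>

definition framed :: "('g, 'b) monoid_scheme \<Rightarrow> 'g rep \<Rightarrow> 'i set \<Rightarrow> ('i \<Rightarrow> complex vec) \<Rightarrow>
    ('i \<Rightarrow> complex vec) \<Rightarrow> ('i \<Rightarrow> 'g \<Rightarrow> complex) \<Rightarrow> bool" where
  "framed G R I v \<phi> c \<longleftrightarrow> representation G R \<and>
     (\<forall>i\<in>I. v i \<in> carrier_vec (fst R) \<and> \<phi> i \<in> carrier_vec (fst R)) \<and>
     (\<forall>x\<in>carrier_vec (fst R). (\<forall>i\<in>I. \<forall>g\<in>carrier G. \<phi> i \<bullet> (snd R g *\<^sub>v x) = 0) \<longrightarrow> x = 0\<^sub>v (fst R)) \<and>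
     (\<forall>\<psi>\<in>carrier_vec (fst R). (\<forall>i\<in>I. \<forall>g\<in>carrier G. \<psi> \<bullet> (snd R g *\<^sub>v v i) = 0) \<longrightarrow> \<psi> = 0\<^sub>v (fst R)) \<and>
     (\<forall>i\<in>I. \<forall>j\<in>I. \<forall>g\<in>carrier G. \<phi> i \<bullet> (snd R g *\<^sub>v v j) = (if i = j then c i g else 0))"

lemma framedD:
  assumes "framed G R I v \<phi> c"
  shows "representation G R"
    and "i \<in> I \<Longrightarrow> v i \<in> carrier_vec (fst R)" "i \<in> I \<Longrightarrow> \<phi> i \<in> carrier_vec (fst R)"
    and "x \<in> carrier_vec (fst R) \<Longrightarrow>
           (\<And>i g. i \<in> I \<Longrightarrow> g \<in> carrier G \<Longrightarrow> \<phi> i \<bullet> (snd R g *\<^sub>v x) = 0) \<Longrightarrow> x = 0\<^sub>v (fst R)"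
    and "x \<in> carrier_vec (fst R) \<Longrightarrow>
           (\<And>i g. i \<in> I \<Longrightarrow> g \<in> carrier G \<Longrightarrow> x \<bullet> (snd R g *\<^sub>v v i) = 0) \<Longrightarrow> x = 0\<^sub>v (fst R)"
    and "i \<in> I \<Longrightarrow> j \<in> I \<Longrightarrow> g \<in> carrier G \<Longrightarrow>
           \<phi> i \<bullet> (snd R g *\<^sub>v v j) = (if i = j then c i g else 0)"
  using assms unfolding framed_def by blast+

text \<open>Among the translates of the forms, and among those of the vectors, there is a basis.
  Only the indices \<open>p\<close>, \<open>q\<close> and the group elements \<open>a\<close>,
  \<open>b\<close> are recorded, so that the same choice can be made in another representation with
  the same coefficients.\<close>

lemma framed_invertible:
  assumes G: "group G" and F: "framed G R I v \<phi> c" and N: "N = fst R"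
  shows "\<exists>p q a b X Y. (\<forall>i<N. p i \<in> I \<and> q i \<in> I \<and> a i \<in> carrier G \<and> b i \<in> carrier G) \<and>
    X \<in> carrier_mat N N \<and> Y \<in> carrier_mat N N \<and>
    mat N N (\<lambda>(i, j). (transpose_mat (snd R (a i)) *\<^sub>v \<phi> (p i)) $ j) * X = 1\<^sub>m N \<and>
    mat N N (\<lambda>(i, j). (snd R (b j) *\<^sub>v v (q j)) $ i) * Y = 1\<^sub>m N"
proof -
  note D = framedD[OF F, folded N] and r = repD[OF G framedD(1)[OF F], folded N]
  define S where "S = {transpose_mat (snd R g) *\<^sub>v \<phi> i |i g. i \<in> I \<and> g \<in> carrier G}"
  have S: "S \<subseteq> carrier_vec N" using D(3) r(1) by (fastforce simp: S_def)
  have "y = 0\<^sub>v N" if y: "y \<in> carrier_vec N" and z: "\<And>s. s \<in> S \<Longrightarrow> s \<bullet> y = 0" for y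
  proof (rule D(4)[OF y])
    fix i g assume "i \<in> I" "g \<in> carrier G"
    then show "\<phi> i \<bullet> (snd R g *\<^sub>v y) = 0"
      using z[of "transpose_mat (snd R g) *\<^sub>v \<phi> i"] D(3) r(1) y
      by (auto simp: S_def scalar_prod_mult_mat_vec[of _ N N])
  qed
  from invertible_rows[OF S this] obtain s X where s: "\<And>i. i < N \<Longrightarrow> s i \<in> S"
    and X: "X \<in> carrier_mat N N" "mat N N (\<lambda>(i, j). s i $ j) * X = 1\<^sub>m N" by metis
  have "\<forall>i. \<exists>p a. i < N \<longrightarrow> p \<in> I \<and> a \<in> carrier G \<and> s i = transpose_mat (snd R a) *\<^sub>v \<phi> p"
    using s unfolding S_def by blast
  then obtain p a where pa: "\<And>i. i < N \<Longrightarrow> p i \<in> I \<and> a i \<in> carrier G \<and>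
      s i = transpose_mat (snd R (a i)) *\<^sub>v \<phi> (p i)" by metis
  define T where "T = {snd R g *\<^sub>v v i |i g. i \<in> I \<and> g \<in> carrier G}"
  have T: "T \<subseteq> carrier_vec N" using D(2) r(1) by (fastforce simp: T_def)
  have "y = 0\<^sub>v N" if y: "y \<in> carrier_vec N" and z: "\<And>s. s \<in> T \<Longrightarrow> s \<bullet> y = 0" for y
  proof (rule D(5)[OF y])
    fix i g assume ig: "i \<in> I" "g \<in> carrier G"
    then have "snd R g *\<^sub>v v i \<in> T" by (auto simp: T_def)
    then show "y \<bullet> (snd R g *\<^sub>v v i) = 0" using z T y comm_scalar_prod[of y N] by auto
  qed
  from invertible_rows[OF T this] obtain t Y where t: "\<And>i. i < N \<Longrightarrow> t i \<in> T"
    and Y: "Y \<in> carrier_mat N N" "Y * mat N N (\<lambda>(i, j). t i $ j) = 1\<^sub>m N" by metis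
  have "\<forall>i. \<exists>q b. i < N \<longrightarrow> q \<in> I \<and> b \<in> carrier G \<and> t i = snd R b *\<^sub>v v q"
    using t unfolding T_def by blast
  then obtain q b where qb: "\<And>i. i < N \<Longrightarrow> q i \<in> I \<and> b i \<in> carrier G \<and> t i = snd R (b i) *\<^sub>v v (q i)"
    by metis
  have "mat N N (\<lambda>(i, j). t j $ i) * transpose_mat Y = 1\<^sub>m N"
  proof -
    have "transpose_mat (Y * mat N N (\<lambda>(i, j). t i $ j)) = 1\<^sub>m N" using Y(2) by simp
    moreover have "transpose_mat (mat N N (\<lambda>(i, j). t i $ j)) = mat N N (\<lambda>(i, j). t j $ i)"
      by (intro eq_matI) auto
    ultimately show ?thesis using Y(1) by (simp add: transpose_mult[of _ N N _ N])
  qed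
  moreover have "mat N N (\<lambda>(i, j). t j $ i) = mat N N (\<lambda>(i, j). (snd R (b j) *\<^sub>v v (q j)) $ i)"
    using qb by (intro eq_matI) auto
  moreover have "mat N N (\<lambda>(i, j). s i $ j) = mat N N (\<lambda>(i, j). (transpose_mat (snd R (a i)) *\<^sub>v \<phi> (p i)) $ j)"
    using pa by (intro eq_matI) auto
  ultimately show ?thesis using pa qb X Y
    by (intro exI[of _ p] exI[of _ q] exI[of _ a] exI[of _ b] exI[of _ X] exI[of _ "transpose_mat Y"]) auto
qed

text \<open>Carrying \<open>a i\<close> over to the vector turns each product into a coefficient at
  \<open>a i \<otimes> b j\<close>, so the right side knows only \<open>c\<close>, while the left
  side factors through dimension \<open>N\<close>. The size \<open>K\<close> is separate from
  \<open>N\<close> because the choice may come from another representation.\<close>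

lemma coefficient_factor:
  assumes G: "group G" and F: "framed G R I v \<phi> c" and N: "N = fst R"
    and pq: "\<And>i. i < K \<Longrightarrow> p i \<in> I \<and> q i \<in> I \<and> a i \<in> carrier G \<and> b i \<in> carrier G"
  shows "mat K N (\<lambda>(i, j). (transpose_mat (snd R (a i)) *\<^sub>v \<phi> (p i)) $ j) *
           mat N K (\<lambda>(i, j). (snd R (b j) *\<^sub>v v (q j)) $ i) =
         mat K K (\<lambda>(i, j). if p i = q j then c (p i) (a i \<otimes>\<^bsub>G\<^esub> b j) else 0)"
    (is "?A * ?B = ?C")
proof (rule eq_matI)
  interpret group G by fact
  note D = framedD[OF F, folded N] and r = repD[OF G framedD(1)[OF F], folded N]
  fix i j assume "i < dim_row ?C" "j < dim_col ?C"
  then have ij: "i < K" "j < K" by auto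
  have c: "snd R (a i) \<in> carrier_mat N N" "snd R (b j) \<in> carrier_mat N N"
    "\<phi> (p i) \<in> carrier_vec N" "v (q j) \<in> carrier_vec N"
    using pq[OF ij(1)] pq[OF ij(2)] D(2,3) r(1) by auto
  have "row ?A i = transpose_mat (snd R (a i)) *\<^sub>v \<phi> (p i)" using ij c by (intro eq_vecI) auto
  moreover have "col ?B j = snd R (b j) *\<^sub>v v (q j)" using ij c by (intro eq_vecI) auto
  ultimately have "(?A * ?B) $$ (i, j) = (transpose_mat (snd R (a i)) *\<^sub>v \<phi> (p i)) \<bullet> (snd R (b j) *\<^sub>v v (q j))"
    using ij by simp
  also have "\<dots> = \<phi> (p i) \<bullet> (snd R (a i) *\<^sub>v (snd R (b j) *\<^sub>v v (q j)))"
    using c by (intro scalar_prod_mult_mat_vec[symmetric]) auto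
  also have "\<dots> = \<phi> (p i) \<bullet> (snd R (a i \<otimes>\<^bsub>G\<^esub> b j) *\<^sub>v v (q j))"
    using c pq[OF ij(1)] pq[OF ij(2)] by (simp add: r(2) assoc_mult_mat_vec[of _ N N _ N])
  finally show "(?A * ?B) $$ (i, j) = ?C $$ (i, j)"
    using ij pq[OF ij(1)] pq[OF ij(2)] by (simp add: D(6))
qed auto

text \<open>Otherwise the coefficient matrix of \<open>R\<close>, a product of two invertible
  matrices, would factor through the smaller dimension of \<open>S\<close> and so have a
  kernel.\<close>

lemma framed_dim_le:
  assumes G: "group G" and R: "framed G R I v \<phi> c" and S: "framed G S I w \<theta> c"
  shows "fst R \<le> fst S"
proof (rule ccontr)
  define N where "N = fst R"
  define M where "M = fst S"
  assume "\<not> fst R \<le> fst S"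
  then have "M < N" by (simp add: M_def N_def)
  obtain p q a b X Y where "\<forall>i<N. p i \<in> I \<and> q i \<in> I \<and> a i \<in> carrier G \<and> b i \<in> carrier G"
    and X: "X \<in> carrier_mat N N" and Y: "Y \<in> carrier_mat N N"
    and AX: "mat N N (\<lambda>(i, j). (transpose_mat (snd R (a i)) *\<^sub>v \<phi> (p i)) $ j) * X = 1\<^sub>m N" (is "?A * X = _")
    and BY: "mat N N (\<lambda>(i, j). (snd R (b j) *\<^sub>v v (q j)) $ i) * Y = 1\<^sub>m N" (is "?B * Y = _")
    using framed_invertible[OF G R N_def] by (elim exE conjE)
  then have pq: "\<And>i. i < N \<Longrightarrow> p i \<in> I \<and> q i \<in> I \<and> a i \<in> carrier G \<and> b i \<in> carrier G" by blast
  define A' where "A' = mat N M (\<lambda>(i, j). (transpose_mat (snd S (a i)) *\<^sub>v \<theta> (p i)) $ j)"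
  define B' where "B' = mat M N (\<lambda>(i, j). (snd S (b j) *\<^sub>v w (q j)) $ i)"
  have c: "?A \<in> carrier_mat N N" "?B \<in> carrier_mat N N" "A' \<in> carrier_mat N M" "B' \<in> carrier_mat M N"
    by (auto simp: A'_def B'_def)
  have eq: "?A * ?B = A' * B'"
    unfolding A'_def B'_def 
    by (rule trans[OF coefficient_factor[OF G R N_def pq] coefficient_factor[OF G S M_def pq, symmetric]])
  obtain x where x: "x \<in> carrier_vec N" "x \<noteq> 0\<^sub>v N" "B' *\<^sub>v x = 0\<^sub>v M"
    using nonzero_kernel[OF c(4) \<open>M < N\<close>] by blast
  have "?A *\<^sub>v (?B *\<^sub>v x) = (?A * ?B) *\<^sub>v x"
    by (rule assoc_mult_mat_vec[OF c(1,2) x(1), symmetric])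
  also have "\<dots> = A' *\<^sub>v (B' *\<^sub>v x)"
    unfolding eq by (rule assoc_mult_mat_vec[OF c(3,4) x(1)])
  also have "\<dots> = 0\<^sub>v N" unfolding x(3) using c by auto
  finally have "?A *\<^sub>v (?B *\<^sub>v x) = 0\<^sub>v N" .
  moreover have "X * ?A = 1\<^sub>m N" "Y * ?B = 1\<^sub>m N"
    using mat_mult_left_right_inverse[OF c(1) X AX] mat_mult_left_right_inverse[OF c(2) Y BY] .
  then have "x = Y *\<^sub>v (X *\<^sub>v (?A *\<^sub>v (?B *\<^sub>v x)))"
  proof -
    have "X *\<^sub>v (?A *\<^sub>v (?B *\<^sub>v x)) = (X * ?A) *\<^sub>v (?B *\<^sub>v x)"
      by (rule assoc_mult_mat_vec[OF X c(1) mult_mat_vec_carrier[OF c(2) x(1)], symmetric])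
    also have "\<dots> = ?B *\<^sub>v x" unfolding \<open>X * ?A = _\<close>
      by (rule one_mult_mat_vec[OF mult_mat_vec_carrier[OF c(2) x(1)]])
    finally have "Y *\<^sub>v (X *\<^sub>v (?A *\<^sub>v (?B *\<^sub>v x))) = (Y * ?B) *\<^sub>v x"
      using c x Y by (simp add: assoc_mult_mat_vec[of _ N N _ N])
    then show ?thesis unfolding \<open>Y * ?B = _\<close> using x by simp
  qed
  ultimately have "x = 0\<^sub>v N" by (simp add: mult_mat_zero_vec[OF X] mult_mat_zero_vec[OF Y])
  then show False using x by simp
qed

text \<open>\<open>P\<close> sends a basis of translates in \<open>R\<close> to the corresponding
  translates in \<open>S\<close>. Equal coefficients mean that a translate of a form takes at
  \<open>P x\<close> the value that its counterpart takes at \<open>x\<close>; since the forms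
  separate the vectors of \<open>S\<close>, \<open>P\<close> commutes with the group.\<close>

theorem framed_iso:
  assumes G: "group G" and R: "framed G R I v \<phi> c" and S: "framed G S I w \<theta> c"
  shows "rep_iso G R S"
proof -
  interpret group G by fact
  define N where "N = fst R"
  have N': "N = fst S" unfolding N_def using framed_dim_le[OF G R S] framed_dim_le[OF G S R] by (rule antisym)
  note D = framedD[OF R, folded N_def] and r = repD[OF G framedD(1)[OF R], folded N_def]
  note D' = framedD[OF S, folded N'] and r' = repD[OF G framedD(1)[OF S], folded N']
  obtain p q a b X Y where "\<forall>i<N. p i \<in> I \<and> q i \<in> I \<and> a i \<in> carrier G \<and> b i \<in> carrier G"
    and X: "X \<in> carrier_mat N N" and Y: "Y \<in> carrier_mat N N"
    and AX: "mat N N (\<lambda>(i, j). (transpose_mat (snd R (a i)) *\<^sub>v \<phi> (p i)) $ j) * X = 1\<^sub>m N"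
    and BY: "mat N N (\<lambda>(i, j). (snd R (b j) *\<^sub>v v (q j)) $ i) * Y = 1\<^sub>m N"
    using framed_invertible[OF G R N_def] by (elim exE conjE)
  then have pq: "\<And>i. i < N \<Longrightarrow> p i \<in> I \<and> q i \<in> I \<and> a i \<in> carrier G \<and> b i \<in> carrier G" by blast
  define A where "A = mat N N (\<lambda>(i, j). (transpose_mat (snd R (a i)) *\<^sub>v \<phi> (p i)) $ j)"
  define B where "B = mat N N (\<lambda>(i, j). (snd R (b j) *\<^sub>v v (q j)) $ i)"
  define A' where "A' = mat N N (\<lambda>(i, j). (transpose_mat (snd S (a i)) *\<^sub>v \<theta> (p i)) $ j)"
  define B' where "B' = mat N N (\<lambda>(i, j). (snd S (b j) *\<^sub>v w (q j)) $ i)"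
  have c: "A \<in> carrier_mat N N" "B \<in> carrier_mat N N" "A' \<in> carrier_mat N N" "B' \<in> carrier_mat N N"
    by (auto simp: A_def B_def A'_def B'_def)
  have eq: "A * B = A' * B'"
    unfolding A_def B_def A'_def B'_def
    by (rule trans[OF coefficient_factor[OF G R N_def pq] coefficient_factor[OF G S N' pq, symmetric]])
  \<comment> \<open>As \<open>Y\<close> inverts \<open>B\<close>, this is the matrix that takes the
    columns of \<open>B\<close> to those of \<open>B'\<close>.\<close>
  define P where "P = B' * Y"
  have P: "P \<in> carrier_mat N N" using c Y by (simp add: P_def)
  have BY': "B * Y = 1\<^sub>m N" "Y * B = 1\<^sub>m N"
    using BY mat_mult_left_right_inverse[OF c(2) Y] by (auto simp: B_def)
  have AX': "X * A = 1\<^sub>m N"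
    using AX mat_mult_left_right_inverse[OF c(1) X] by (auto simp: A_def)
  have "A' * P = (A' * B') * Y" using c Y by (simp add: P_def)
  also have "\<dots> = (A * B) * Y" by (simp add: eq)
  also have "\<dots> = A * (B * Y)" using c Y by simp
  also have "\<dots> = A" using c BY' by simp
  finally have "A' * P = A" .
  then have "(X * A') * P = 1\<^sub>m N" using c X P AX' by simp
  then have PG: "P \<in> carrier (GL N)"
    using mat_mult_left_right_inverse[of "X * A'" N P] c X P by (intro GL_inverseI[of _ _ "X * A'"]) auto
  have PB: "P * B = B'" using c Y BY' by (simp add: P_def)
  \<comment> \<open>Both sides are forms in \<open>x\<close>, namely \<open>\<alpha>\<close> and
    \<open>\<beta>\<close>. It is enough to compare them on the columns of \<open>B\<close>, a basis
    of translates, where they are coefficients at \<open>k \<otimes> b j\<close>.\<close>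
  have coeff: "\<theta> i \<bullet> (snd S k *\<^sub>v (P *\<^sub>v x)) = \<phi> i \<bullet> (snd R k *\<^sub>v x)"
    if "i \<in> I" "k \<in> carrier G" "x \<in> carrier_vec N" for i k x
  proof -
    define \<alpha> where "\<alpha> = transpose_mat (snd S k * P) *\<^sub>v \<theta> i"
    define \<beta> where "\<beta> = transpose_mat (snd R k) *\<^sub>v \<phi> i"
    have ab: "\<alpha> \<in> carrier_vec N" "\<beta> \<in> carrier_vec N"
      using r'(1)[OF that(2)] r(1)[OF that(2)] P D(3)[OF that(1)] D'(3)[OF that(1)]
      by (auto simp: \<alpha>_def \<beta>_def intro!: mult_mat_vec_carrier[of _ N N])
    have "transpose_mat B *\<^sub>v \<alpha> = transpose_mat B *\<^sub>v \<beta>"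
    proof (rule eq_vecI)
      fix j assume "j < dim_vec (transpose_mat B *\<^sub>v \<beta>)"
      then have j: "j < N" using c by simp
      note pj = pq[OF j]
      have cols: "col B j = snd R (b j) *\<^sub>v v (q j)" "col B' j = snd S (b j) *\<^sub>v w (q j)"
        using j r(1)[of "b j"] r'(1)[of "b j"] pj by (auto simp: B_def B'_def intro!: eq_vecI)
      have Pc: "P *\<^sub>v col B j = col B' j" using PB c j P by (metis carrier_matD(2) col_mult2)
      have Bc: "col B j \<in> carrier_vec N" "row (transpose_mat B) j = col B j" using c j by auto
      have "(transpose_mat B *\<^sub>v \<alpha>) $ j = \<alpha> \<bullet> col B j"
        using c j by (simp add: comm_scalar_prod[OF ab(1) Bc(1)])
      also have "\<dots> = \<theta> i \<bullet> (snd S k *\<^sub>v col B' j)"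
        using r'(1)[OF that(2)] P D'(3)[OF that(1)] Bc
        by (simp add: \<alpha>_def scalar_prod_mult_mat_vec[symmetric, of _ N N] assoc_mult_mat_vec[of _ N N _ N] Pc)
      also have "\<dots> = \<theta> i \<bullet> (snd S (k \<otimes>\<^bsub>G\<^esub> b j) *\<^sub>v w (q j))"
        using pj that r'(1)[OF that(2)] r'(1)[of "b j"] D'(2)[of "q j"] by (simp add: cols r'(2))
      also have "\<dots> = \<phi> i \<bullet> (snd R (k \<otimes>\<^bsub>G\<^esub> b j) *\<^sub>v v (q j))"
        using pj that by (simp add: D(6) D'(6))
      also have "\<dots> = \<phi> i \<bullet> (snd R k *\<^sub>v col B j)"
        using pj that r(1)[OF that(2)] r(1)[of "b j"] D(2)[of "q j"] by (simp add: cols r(2))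
      also have "\<dots> = \<beta> \<bullet> col B j"
        using r(1)[OF that(2)] D(3)[OF that(1)] Bc
        by (simp add: \<beta>_def scalar_prod_mult_mat_vec[symmetric, of _ N N])
      also have "\<dots> = (transpose_mat B *\<^sub>v \<beta>) $ j"
        using c j by (simp add: comm_scalar_prod[OF ab(2) Bc(1)])
      finally show "(transpose_mat B *\<^sub>v \<alpha>) $ j = (transpose_mat B *\<^sub>v \<beta>) $ j" .
    qed simp
    moreover have "transpose_mat Y * transpose_mat B = 1\<^sub>m N"
      using BY' transpose_mult[OF c(2) Y] by simp
    then have "transpose_mat Y *\<^sub>v (transpose_mat B *\<^sub>v z) = z" if "z \<in> carrier_vec N" for z
      using that c Y by (simp flip: assoc_mult_mat_vec[of _ N N _ N])
    ultimately have "\<alpha> = \<beta>" using ab by metis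
    moreover have "\<theta> i \<bullet> (snd S k *\<^sub>v (P *\<^sub>v x)) = \<alpha> \<bullet> x"
      using r'(1)[OF that(2)] P D'(3)[OF that(1)] that(3)
      by (simp add: \<alpha>_def scalar_prod_mult_mat_vec[symmetric, of _ N N])
    moreover have "\<phi> i \<bullet> (snd R k *\<^sub>v x) = \<beta> \<bullet> x"
      using r(1)[OF that(2)] D(3)[OF that(1)] that(3)
      by (simp add: \<beta>_def scalar_prod_mult_mat_vec[symmetric, of _ N N])
    ultimately show ?thesis by simp
  qed
  have "P * snd R g = snd S g * P" if g: "g \<in> carrier G" for g
  proof (rule mat_eqI_mult_vec)
    show "P * snd R g \<in> carrier_mat N N" "snd S g * P \<in> carrier_mat N N"
      using P r(1)[OF g] r'(1)[OF g] by auto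
    fix x :: "complex vec" assume x: "x \<in> carrier_vec N"
    define y where "y = P *\<^sub>v (snd R g *\<^sub>v x)"
    define z where "z = snd S g *\<^sub>v (P *\<^sub>v x)"
    have yz: "y \<in> carrier_vec N" "z \<in> carrier_vec N"
      using x P r(1)[OF g] r'(1)[OF g] by (auto simp: y_def z_def)
    have "y - z = 0\<^sub>v N"
    proof (rule D'(4))
      fix i k assume ik: "i \<in> I" "k \<in> carrier G"
      have "\<theta> i \<bullet> (snd S k *\<^sub>v y) = \<phi> i \<bullet> (snd R k *\<^sub>v (snd R g *\<^sub>v x))"
        unfolding y_def using ik x r(1)[OF g] by (intro coeff) auto
      also have "\<dots> = \<phi> i \<bullet> (snd R (k \<otimes>\<^bsub>G\<^esub> g) *\<^sub>v x)"
        using ik g x r(1)[OF g] r(1)[OF ik(2)] by (simp add: r(2))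
      also have "\<dots> = \<theta> i \<bullet> (snd S (k \<otimes>\<^bsub>G\<^esub> g) *\<^sub>v (P *\<^sub>v x))"
        using ik g x by (intro coeff[symmetric]) auto
      also have "\<dots> = \<theta> i \<bullet> (snd S k *\<^sub>v z)"
        using ik g x P r'(1)[OF g] r'(1)[OF ik(2)] by (simp add: z_def r'(2))
      finally show "\<theta> i \<bullet> (snd S k *\<^sub>v (y - z)) = 0"
        using yz r'(1)[OF ik(2)] D'(3)[OF ik(1)]
        by (simp add: mult_minus_distrib_mat_vec[of _ N N] scalar_prod_minus_distrib[of _ N])
    qed (use yz in simp)
    then have "y = z" using yz minus_add_minus_vec[of y N z] by (metis add_diff_cancel_right' index_minus_vec(1) eq_vecI carrier_vecD index_zero_vec(1) eq_iff_diff_eq_0)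
    then show "(P * snd R g) *\<^sub>v x = (snd S g * P) *\<^sub>v x"
      using x P r(1)[OF g] r'(1)[OF g] by (simp add: y_def z_def)
  qed
  then show ?thesis
    using PG N' D(1) D'(1) unfolding rep_iso_def by (auto simp: N_def)
qed

lemma zero_mat_mult_vec: "x \<in> carrier_vec nc \<Longrightarrow> 0\<^sub>m nr nc *\<^sub>v x = (0\<^sub>v nr :: complex vec)"
  by (intro eq_vecI) auto

section \<open>Polynomial functions of one variable\<close>

definition polyfun :: "(complex \<Rightarrow> complex) \<Rightarrow> bool" where
  "polyfun f \<longleftrightarrow> (\<exists>p. \<forall>t. f t = poly p t)"

lemma polyfun_const: "polyfun (\<lambda>t. c)"
  unfolding polyfun_def by (rule exI[of _ "[:c:]"]) simp

lemma polyfun_id: "polyfun (\<lambda>t. t)"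
  unfolding polyfun_def by (rule exI[of _ "[:0, 1:]"]) simp

lemma polyfun_add: "polyfun f \<Longrightarrow> polyfun g \<Longrightarrow> polyfun (\<lambda>t. f t + g t)"
  unfolding polyfun_def by (metis poly_add)

lemma polyfun_mult: "polyfun f \<Longrightarrow> polyfun g \<Longrightarrow> polyfun (\<lambda>t. f t * g t)"
  unfolding polyfun_def by (metis poly_mult)

lemma polyfun_diff: "polyfun f \<Longrightarrow> polyfun g \<Longrightarrow> polyfun (\<lambda>t. f t - g t)"
  unfolding polyfun_def by (metis poly_diff)

lemma polyfun_power: "polyfun f \<Longrightarrow> polyfun (\<lambda>t. f t ^ k)"
  unfolding polyfun_def by (metis poly_power)

lemma polyfun_sum: "(\<And>i. i \<in> S \<Longrightarrow> polyfun (f i)) \<Longrightarrow> polyfun (\<lambda>t. \<Sum>i\<in>S. f i t)"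
  by (induction S rule: infinite_finite_induct) (auto intro: polyfun_const polyfun_add)

lemma polyfun_prod: "(\<And>i. i \<in> S \<Longrightarrow> polyfun (f i)) \<Longrightarrow> polyfun (\<lambda>t. \<Prod>i\<in>S. f i t)"
  by (induction S rule: infinite_finite_induct) (auto intro: polyfun_const polyfun_mult)

lemma polyfun_if: "(b \<Longrightarrow> polyfun f) \<Longrightarrow> (\<not> b \<Longrightarrow> polyfun g) \<Longrightarrow> polyfun (\<lambda>t. if b then f t else g t)"
  by (cases b) simp_all

lemmas polyfun_intros = polyfun_const polyfun_id polyfun_add polyfun_mult polyfun_diff polyfun_power
  polyfun_sum polyfun_prod polyfun_if

lemma polyfun_det:
  assumes "\<And>t. M t \<in> carrier_mat n n"
    and "\<And>i j. i < n \<Longrightarrow> j < n \<Longrightarrow> polyfun (\<lambda>t. M t $$ (i, j))"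
  shows "polyfun (\<lambda>t. det (M t))"
  unfolding det_def'[OF assms(1)]
  by (intro polyfun_intros assms(2)) (auto dest: permutes_in_image)

lemma bilinear_expand:
  assumes "A \<in> carrier_mat n n" "x \<in> carrier_vec n" "y \<in> carrier_vec n"
  shows "y \<bullet> (A *\<^sub>v x) = (\<Sum>i<n. \<Sum>j<n. y $ i * A $$ (i, j) * (x $ j :: complex))"
  using assms by (auto simp: scalar_prod_def atLeast0LessThan sum_distrib_left mult.assoc)

lemma polyfun_bilinear:
  assumes "\<And>t. M t \<in> carrier_mat n n" "x \<in> carrier_vec n" "y \<in> carrier_vec n"
    and "\<And>i j. i < n \<Longrightarrow> j < n \<Longrightarrow> polyfun (\<lambda>t. M t $$ (i, j))"
  shows "polyfun (\<lambda>t. y \<bullet> (M t *\<^sub>v x))"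
  unfolding bilinear_expand[OF assms(1-3)] by (intro polyfun_intros assms(4)) auto

lemma polyfun_eq:
  assumes "polyfun f" "polyfun g" "finite S" "\<And>t. t \<notin> S \<Longrightarrow> f t = g t"
  shows "f t = g t"
proof -
  obtain p q where p: "\<And>t. f t = poly p t" and q: "\<And>t. g t = poly q t"
    using assms(1,2) unfolding polyfun_def by metis
  have "p - q = 0"
  proof (rule ccontr)
    assume "p - q \<noteq> 0"
    then have "finite {t. poly (p - q) t = 0}" by (rule poly_roots_finite)
    moreover have "UNIV - S \<subseteq> {t. poly (p - q) t = 0}" using assms(4) p q by auto
    ultimately have "finite (UNIV - S)" by (rule rev_finite_subset)
    then show False using assms(3) infinite_UNIV_char_0[where 'a = complex] by simp
  qed
  then show ?thesis using p q by simp
qed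

lemma polyfun_nonzero_finite:
  assumes "polyfun f" "f a \<noteq> 0"
  shows "finite {t. f t = 0}"
proof -
  obtain p where p: "\<And>t. f t = poly p t" using assms(1) unfolding polyfun_def by metis
  then have "p \<noteq> 0" using assms(2) by auto
  then show ?thesis using poly_roots_finite[of p] p by simp
qed

lemma coeffs_unique:
  assumes eq: "\<And>t :: complex. t \<noteq> 0 \<Longrightarrow> (\<Sum>k\<le>D. t ^ k * a k) = (\<Sum>k\<le>D. t ^ k * b k)" and "k \<le> D"
  shows "a k = b k"
proof -
  define p where "p c = (\<Sum>k\<le>D. monom (c k) k)" for c :: "nat \<Rightarrow> complex"
  have poly: "poly (p c) t = (\<Sum>k\<le>D. t ^ k * c k)" for c t
    by (simp add: p_def poly_sum poly_monom mult.commute)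
  have coeff: "coeff (p c) k = c k" for c using \<open>k \<le> D\<close> by (simp add: p_def coeff_sum)
  have "polyfun (poly (p a))" "polyfun (poly (p b))" by (auto simp: polyfun_def)
  then have "poly (p a) t = poly (p b) t" for t
    by (rule polyfun_eq[of _ _ "{0}"]) (use eq poly in auto)
  then have "poly (p a) = poly (p b)" by auto
  then have "p a = p b" by (simp add: poly_eq_poly_eq_iff)
  then show ?thesis using coeff by metis
qed

text \<open>Unless \<open>g\<close> vanishes, the left side has degree \<open>K\<close> plus the
  degree of \<open>g\<close>, while the right side has degree at most \<open>K\<close>.\<close>

lemma polyfun_constant:
  assumes "polyfun g" and eq: "\<And>t. t \<noteq> 0 \<Longrightarrow> t ^ K * g t = (\<Sum>k\<le>K. t ^ k * a k)"
  shows "g s = g t"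
proof -
  obtain p where p: "\<And>t. g t = poly p t" using assms(1) unfolding polyfun_def by metis
  define q where "q = (\<Sum>k\<le>K. monom (a k) k)"
  have poly: "poly q t = (\<Sum>k\<le>K. t ^ k * a k)" for t
    by (simp add: q_def poly_sum poly_monom mult.commute)
  have "polyfun (poly (monom 1 K * p))" "polyfun (poly q)" unfolding polyfun_def by blast+
  then have "poly (monom 1 K * p) t = poly q t" for t
    by (rule polyfun_eq[of _ _ "{0}"]) (use eq poly p in \<open>auto simp: poly_monom\<close>)
  then have "poly (monom 1 K * p) = poly q" by auto
  then have q: "monom 1 K * p = q" by (simp add: poly_eq_poly_eq_iff)
  have "degree q \<le> K" unfolding q_def by (intro degree_sum_le) (auto intro: order_trans[OF degree_monom_le])
  then have "degree p = 0" using degree_mult_eq[of "monom 1 K" p] q by (cases "p = 0") (auto simp: degree_monom_eq)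
  then obtain c where "p = [:c:]" by (rule degree_eq_zeroE)
  then show ?thesis by (simp add: p)
qed

section \<open>Gradings by one-parameter subgroups\<close>

text \<open>The weight decomposition under a one-parameter group: \<open>T t\<close> is the sum of
  the \<open>t ^ k P k\<close>, stated through all pairs of vectors to avoid sums of matrices. Only
  \<open>t \<noteq> 0\<close> is constrained, as the torus has no point over 0.\<close>

definition graded :: "nat \<Rightarrow> (complex \<Rightarrow> complex mat) \<Rightarrow> nat \<Rightarrow> (nat \<Rightarrow> complex mat) \<Rightarrow> bool" where
  "graded N T D P \<longleftrightarrow> (\<forall>k. P k \<in> carrier_mat N N) \<and> (\<forall>t. t \<noteq> 0 \<longrightarrow> T t \<in> carrier_mat N N) \<and>
     (\<forall>t x y. t \<noteq> 0 \<longrightarrow> x \<in> carrier_vec N \<longrightarrow> y \<in> carrier_vec N \<longrightarrow>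
        y \<bullet> (T t *\<^sub>v x) = (\<Sum>k\<le>D. t ^ k * (y \<bullet> (P k *\<^sub>v x)))) \<and>
     (\<forall>k\<le>D. \<forall>l\<le>D. P k * P l = (if k = l then P k else 0\<^sub>m N N))"

lemma gradedD:
  assumes "graded N T D P"
  shows "P k \<in> carrier_mat N N" "t \<noteq> 0 \<Longrightarrow> T t \<in> carrier_mat N N"
    and "t \<noteq> 0 \<Longrightarrow> x \<in> carrier_vec N \<Longrightarrow> y \<in> carrier_vec N \<Longrightarrow>
        y \<bullet> (T t *\<^sub>v x) = (\<Sum>k\<le>D. t ^ k * (y \<bullet> (P k *\<^sub>v x)))"
    and "k \<le> D \<Longrightarrow> l \<le> D \<Longrightarrow> P k * P l = (if k = l then P k else 0\<^sub>m N N)"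
  using assms unfolding graded_def by auto

lemma vec_eqI_scalar_prod:
  assumes "x \<in> carrier_vec N" "z \<in> carrier_vec N" "\<And>y. y \<in> carrier_vec N \<Longrightarrow> y \<bullet> x = y \<bullet> (z :: complex vec)"
  shows "x = z"
proof (rule eq_vecI)
  fix i assume "i < dim_vec z"
  then show "x $ i = z $ i" using assms(3)[of "unit_vec N i"] assms(1,2) by simp
qed (use assms in simp)

text \<open>\<open>P k\<close> collects the coefficients of \<open>t ^ k\<close> in the entries.
  Multiplicativity, compared coefficientwise in \<open>t\<close> and then in \<open>s\<close>, makes
  the \<open>P k\<close> orthogonal idempotents.\<close>

lemma graded_exists:
  assumes c: "\<And>t. t \<noteq> 0 \<Longrightarrow> T t \<in> carrier_mat N N"
    and hom: "\<And>s t. s \<noteq> 0 \<Longrightarrow> t \<noteq> 0 \<Longrightarrow> T (s * t) = T s * T t"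
    and poly: "\<And>i j. i < N \<Longrightarrow> j < N \<Longrightarrow> \<exists>f. polyfun f \<and> (\<forall>t. t \<noteq> 0 \<longrightarrow> T t $$ (i, j) = f t)"
  obtains D P where "graded N T D P"
proof -
  have "\<forall>i j. \<exists>p. i < N \<and> j < N \<longrightarrow> (\<forall>t. t \<noteq> 0 \<longrightarrow> T t $$ (i, j) = poly p t)"
    using poly unfolding polyfun_def by metis
  then obtain p where p: "\<And>i j t. i < N \<Longrightarrow> j < N \<Longrightarrow> t \<noteq> 0 \<Longrightarrow> T t $$ (i, j) = poly (p i j) t"
    by metis
  define D where "D = (\<Sum>i<N. \<Sum>j<N. degree (p i j))"
  define P where "P k = mat N N (\<lambda>(i, j). coeff (p i j) k)" for k
  have P: "P k \<in> carrier_mat N N" for k by (simp add: P_def)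
  have ent: "T t $$ (i, j) = (\<Sum>k\<le>D. t ^ k * P k $$ (i, j))" if ij: "i < N" "j < N" and t: "t \<noteq> 0" for i j t
  proof -
    have "degree (p i j) \<le> (\<Sum>j<N. degree (p i j))" using ij by (intro member_le_sum) auto
    also have "\<dots> \<le> D" unfolding D_def using ij by (intro member_le_sum) auto
    finally have "(\<Sum>k\<le>degree (p i j). coeff (p i j) k * t ^ k) = (\<Sum>k\<le>D. coeff (p i j) k * t ^ k)"
      by (intro sum.mono_neutral_left) (auto simp: coeff_eq_0)
    then show ?thesis using ij t by (simp add: p poly_altdef P_def mult.commute)
  qed
  have bil: "y \<bullet> (T t *\<^sub>v x) = (\<Sum>k\<le>D. t ^ k * (y \<bullet> (P k *\<^sub>v x)))"
    if "t \<noteq> 0" "x \<in> carrier_vec N" "y \<in> carrier_vec N" for t x y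
  proof -
    have "y \<bullet> (T t *\<^sub>v x) = (\<Sum>i<N. \<Sum>j<N. \<Sum>k\<le>D. t ^ k * (y $ i * P k $$ (i, j) * x $ j))"
      unfolding bilinear_expand[OF c[OF that(1)] that(2,3)]
      by (intro sum.cong refl) (simp add: ent that(1) sum_distrib_left sum_distrib_right mult_ac)
    also have "\<dots> = (\<Sum>k\<le>D. \<Sum>i<N. \<Sum>j<N. t ^ k * (y $ i * P k $$ (i, j) * x $ j))"
      by (simp only: sum.swap[of _ "{..D}" "{..<N}"])
    also have "\<dots> = (\<Sum>k\<le>D. t ^ k * (y \<bullet> (P k *\<^sub>v x)))"
      by (simp add: bilinear_expand[OF P that(2,3)] sum_distrib_left)
    finally show ?thesis .
  qed
  have orth: "P k * P l = (if k = l then P k else 0\<^sub>m N N)" if kl: "k \<le> D" "l \<le> D" for k l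
  proof (rule mat_eqI_mult_vec)
    fix x :: "complex vec" assume x: "x \<in> carrier_vec N"
    show "(P k * P l) *\<^sub>v x = (if k = l then P k else 0\<^sub>m N N) *\<^sub>v x"
    proof (rule vec_eqI_scalar_prod)
      fix y :: "complex vec" assume y: "y \<in> carrier_vec N"
      have 1: "y \<bullet> (P k *\<^sub>v (T s *\<^sub>v x)) = s ^ k * (y \<bullet> (P k *\<^sub>v x))" if s: "s \<noteq> 0" for s
      proof (rule coeffs_unique[OF _ kl(1), where a = "\<lambda>k. y \<bullet> (P k *\<^sub>v (T s *\<^sub>v x))"])
        fix t :: complex assume t: "t \<noteq> 0"
        have "(\<Sum>k\<le>D. t ^ k * (y \<bullet> (P k *\<^sub>v (T s *\<^sub>v x)))) = y \<bullet> (T t *\<^sub>v (T s *\<^sub>v x))"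
          using t x y c[OF s] by (intro bil[symmetric]) auto
        also have "\<dots> = y \<bullet> (T (t * s) *\<^sub>v x)" using assoc_mult_mat_vec[OF c[OF t] c[OF s] x] hom[OF t s] by simp
        also have "\<dots> = (\<Sum>k\<le>D. t ^ k * (s ^ k * (y \<bullet> (P k *\<^sub>v x))))"
          using s t x y by (simp add: bil power_mult_distrib mult_ac)
        finally show "(\<Sum>k\<le>D. t ^ k * (y \<bullet> (P k *\<^sub>v (T s *\<^sub>v x)))) =
          (\<Sum>k\<le>D. t ^ k * (s ^ k * (y \<bullet> (P k *\<^sub>v x))))" .
      qed
      define z where "z = transpose_mat (P k) *\<^sub>v y"
      have z: "z \<in> carrier_vec N" using P[of k] y by (auto simp: z_def intro!: mult_mat_vec_carrier)
      have zy: "z \<bullet> u = y \<bullet> (P k *\<^sub>v u)" if "u \<in> carrier_vec N" for u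
        unfolding z_def by (rule scalar_prod_mult_mat_vec[OF P that y, symmetric])
      have "z \<bullet> (P l *\<^sub>v x) = (if l = k then y \<bullet> (P k *\<^sub>v x) else 0)"
      proof (rule coeffs_unique[OF _ kl(2), where a = "\<lambda>l. z \<bullet> (P l *\<^sub>v x)"])
        fix s :: complex assume s: "s \<noteq> 0"
        have "(\<Sum>l\<le>D. s ^ l * (z \<bullet> (P l *\<^sub>v x))) = z \<bullet> (T s *\<^sub>v x)"
          using s x z by (intro bil[symmetric]) auto
        also have "\<dots> = s ^ k * (y \<bullet> (P k *\<^sub>v x))"
          using s x c[OF s] by (simp add: zy 1)
        also have "\<dots> = (\<Sum>l\<le>D. s ^ l * (if l = k then y \<bullet> (P k *\<^sub>v x) else 0))"
          using kl(1) by (simp add: if_distrib cong: if_cong)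
        finally show "(\<Sum>l\<le>D. s ^ l * (z \<bullet> (P l *\<^sub>v x))) =
          (\<Sum>l\<le>D. s ^ l * (if l = k then y \<bullet> (P k *\<^sub>v x) else 0))" .
      qed
      moreover have "z \<bullet> (P l *\<^sub>v x) = y \<bullet> ((P k * P l) *\<^sub>v x)"
        using zy[of "P l *\<^sub>v x"] P[of l] assoc_mult_mat_vec[OF P P x, of k l] x
        by (simp add: mult_mat_vec_carrier[OF P x])
      ultimately show "y \<bullet> ((P k * P l) *\<^sub>v x) = y \<bullet> ((if k = l then P k else 0\<^sub>m N N) *\<^sub>v x)"
        using x y by (auto simp: zero_mat_mult_vec)
    qed (use P[of k] P[of l] x in \<open>auto simp: zero_mat_mult_vec\<close>)
  qed (use P[of k] P[of l] in auto)
  have "graded N T D P" unfolding graded_def using P c bil orth by auto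
  then show ?thesis by (rule that)
qed

lemma graded_eigen:
  assumes g: "graded N T D P" and "k \<le> D" "t \<noteq> 0" "x \<in> carrier_vec N"
  shows "T t *\<^sub>v (P k *\<^sub>v x) = t ^ k \<cdot>\<^sub>v (P k *\<^sub>v x)"
proof (rule vec_eqI_scalar_prod)
  note G = gradedD[OF g]
  fix y :: "complex vec" assume y: "y \<in> carrier_vec N"
  have Px: "P l *\<^sub>v x \<in> carrier_vec N" for l using mult_mat_vec_carrier[OF G(1) assms(4)] .
  have "P l *\<^sub>v (P k *\<^sub>v x) = (if l = k then P k *\<^sub>v x else 0\<^sub>v N)" if "l \<le> D" for l
    using that assms(2,4) G(4)[of l k] assoc_mult_mat_vec[OF G(1) G(1) assms(4), of l k]
    by (auto simp: zero_mat_mult_vec)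
  then have "y \<bullet> (T t *\<^sub>v (P k *\<^sub>v x)) = (\<Sum>l\<le>D. t ^ l * (if l = k then y \<bullet> (P k *\<^sub>v x) else 0))"
    using y Px assms(3) by (auto simp: G(3) intro!: sum.cong)
  also have "\<dots> = t ^ k * (y \<bullet> (P k *\<^sub>v x))" using assms(2) by (simp add: if_distrib cong: if_cong)
  finally show "y \<bullet> (T t *\<^sub>v (P k *\<^sub>v x)) = y \<bullet> (t ^ k \<cdot>\<^sub>v (P k *\<^sub>v x))" using y Px by simp
qed (use gradedD(1,2)[OF g] assms in \<open>auto intro!: mult_mat_vec_carrier\<close>)

text \<open>At \<open>t = 1\<close> the projections add up to \<open>T 1\<close>, the
  identity.\<close>

lemma graded_separates:
  assumes g: "graded N T D P" and "T 1 = 1\<^sub>m N" and x: "x \<in> carrier_vec N"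
    and "\<And>k. k \<le> D \<Longrightarrow> P k *\<^sub>v x = 0\<^sub>v N"
  shows "x = 0\<^sub>v N"
proof (rule vec_eqI_scalar_prod)
  fix y :: "complex vec" assume y: "y \<in> carrier_vec N"
  show "y \<bullet> x = y \<bullet> 0\<^sub>v N" using gradedD(3)[OF g, of 1 x y] assms y by simp
qed (use x in auto)

lemma graded_commute:
  assumes g: "graded N T D P" and A: "A \<in> carrier_mat N N"
    and AT: "\<And>t. t \<noteq> 0 \<Longrightarrow> A * T t = T t * A" and k: "k \<le> D"
  shows "A * P k = P k * A"
proof (rule mat_eqI_mult_vec)
  note G = gradedD[OF g]
  fix x :: "complex vec" assume x: "x \<in> carrier_vec N"
  show "(A * P k) *\<^sub>v x = (P k * A) *\<^sub>v x"
  proof (rule vec_eqI_scalar_prod)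
    fix y :: "complex vec" assume y: "y \<in> carrier_vec N"
    define z where "z = transpose_mat A *\<^sub>v y"
    have z: "z \<in> carrier_vec N" using A y by (auto simp: z_def intro!: mult_mat_vec_carrier)
    have zy: "z \<bullet> u = y \<bullet> (A *\<^sub>v u)" if "u \<in> carrier_vec N" for u
      unfolding z_def by (rule scalar_prod_mult_mat_vec[OF A that y, symmetric])
    have Ax: "A *\<^sub>v x \<in> carrier_vec N" using mult_mat_vec_carrier[OF A x] .
    have "z \<bullet> (P k *\<^sub>v x) = y \<bullet> (P k *\<^sub>v (A *\<^sub>v x))"
    proof (rule coeffs_unique[OF _ k, where a = "\<lambda>k. z \<bullet> (P k *\<^sub>v x)"])
      fix t :: complex assume t: "t \<noteq> 0"
      have "(\<Sum>k\<le>D. t ^ k * (z \<bullet> (P k *\<^sub>v x))) = z \<bullet> (T t *\<^sub>v x)"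
        using G(3)[OF t x z] by simp
      also have "\<dots> = y \<bullet> ((A * T t) *\<^sub>v x)"
        using zy[OF mult_mat_vec_carrier[OF G(2)[OF t] x]] assoc_mult_mat_vec[OF A G(2)[OF t] x] by simp
      also have "\<dots> = y \<bullet> (T t *\<^sub>v (A *\<^sub>v x))"
        unfolding AT[OF t] using assoc_mult_mat_vec[OF G(2)[OF t] A x] by simp
      also have "\<dots> = (\<Sum>k\<le>D. t ^ k * (y \<bullet> (P k *\<^sub>v (A *\<^sub>v x))))"
        using G(3)[OF t Ax y] by simp
      finally show "(\<Sum>k\<le>D. t ^ k * (z \<bullet> (P k *\<^sub>v x))) = (\<Sum>k\<le>D. t ^ k * (y \<bullet> (P k *\<^sub>v (A *\<^sub>v x))))" .
    qed
    then show "y \<bullet> ((A * P k) *\<^sub>v x) = y \<bullet> ((P k * A) *\<^sub>v x)"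
      using zy[OF mult_mat_vec_carrier[OF G(1) x, of k]]
        assoc_mult_mat_vec[OF A G(1) x, of k] assoc_mult_mat_vec[OF G(1) A x, of k] by simp
  qed (use A G(1)[of k] x in auto)
qed (use A gradedD(1)[OF g, of k] in auto)

text \<open>If \<open>f\<close> has top degree \<open>K\<close> in the module it generates, then \<open>B 1\<close>, which is \<open>B t\<close> conjugated by
  \<open>T t\<close>, may be replaced by its limit \<open>B 0\<close>: the coefficients of \<open>t ^ K \<cdot> B t f\<close> have degree at most \<open>K\<close>.\<close>

lemma contraction:
  assumes g: "graded N T D P" and K: "K \<le> D"
    and B: "\<And>t. B t \<in> carrier_mat N N"
    and poly: "\<And>i j. i < N \<Longrightarrow> j < N \<Longrightarrow> polyfun (\<lambda>t. B t $$ (i, j))"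
    and TB: "\<And>t. t \<noteq> 0 \<Longrightarrow> T t * B 1 = B t * T t"
    and f: "f \<in> carrier_vec N" "\<And>t. t \<noteq> 0 \<Longrightarrow> T t *\<^sub>v f = t ^ K \<cdot>\<^sub>v f"
    and top: "\<And>l. K < l \<Longrightarrow> l \<le> D \<Longrightarrow> P l *\<^sub>v (B 1 *\<^sub>v f) = 0\<^sub>v N"
  shows "B 1 *\<^sub>v f = B 0 *\<^sub>v f"
proof (rule vec_eqI_scalar_prod)
  note G = gradedD[OF g]
  have Bf: "B t *\<^sub>v f \<in> carrier_vec N" for t using mult_mat_vec_carrier[OF B f(1)] .
  then show "B 1 *\<^sub>v f \<in> carrier_vec N" "B 0 *\<^sub>v f \<in> carrier_vec N" by auto
  fix y :: "complex vec" assume y: "y \<in> carrier_vec N"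
  show "y \<bullet> (B 1 *\<^sub>v f) = y \<bullet> (B 0 *\<^sub>v f)"
  proof (rule polyfun_constant[where g = "\<lambda>t. y \<bullet> (B t *\<^sub>v f)" and a = "\<lambda>k. y \<bullet> (P k *\<^sub>v (B 1 *\<^sub>v f))"])
    show "polyfun (\<lambda>t. y \<bullet> (B t *\<^sub>v f))" by (rule polyfun_bilinear[OF B f(1) y poly])
    fix t :: complex assume t: "t \<noteq> 0"
    have "t ^ K * (y \<bullet> (B t *\<^sub>v f)) = y \<bullet> (B t *\<^sub>v (t ^ K \<cdot>\<^sub>v f))"
      using mult_mat_vec[OF B f(1)] Bf[of t] y by simp
    also have "\<dots> = y \<bullet> ((T t * B 1) *\<^sub>v f)"
      using assoc_mult_mat_vec[OF B G(2)[OF t] f(1)] f(2)[OF t] TB[OF t] by simp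
    also have "\<dots> = y \<bullet> (T t *\<^sub>v (B 1 *\<^sub>v f))"
      using assoc_mult_mat_vec[OF G(2)[OF t] B f(1)] by simp
    also have "\<dots> = (\<Sum>k\<le>D. t ^ k * (y \<bullet> (P k *\<^sub>v (B 1 *\<^sub>v f))))"
      using G(3)[OF t Bf y] .
    also have "\<dots> = (\<Sum>k\<le>K. t ^ k * (y \<bullet> (P k *\<^sub>v (B 1 *\<^sub>v f))))"
      using K top y by (intro sum.mono_neutral_right) auto
    finally show "t ^ K * (y \<bullet> (B t *\<^sub>v f)) = (\<Sum>k\<le>K. t ^ k * (y \<bullet> (P k *\<^sub>v (B 1 *\<^sub>v f))))" .
  qed
qed

section \<open>Idempotent matrices\<close>

text \<open>Take \<open>r\<close> largest such that \<open>r\<close> columns fixed by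
  \<open>P\<close> and \<open>r\<close> rows fixed by \<open>P\<close> are dual to each other;
  \<open>r \<le> N\<close> because \<open>F V = 1\<close> makes \<open>V\<close> injective. The
  remainder \<open>R = P - V F\<close> is idempotent and is killed by \<open>F\<close> from the left
  and by \<open>V\<close> from the right. A nonzero entry of \<open>R\<close> would supply one more
  dual pair, so \<open>R = 0\<close>.\<close>

lemma idempotent_rank_factorization:
  assumes P: "(P :: complex mat) \<in> carrier_mat N N" and PP: "P * P = P"
  obtains r V F where "V \<in> carrier_mat N r" "F \<in> carrier_mat r N" "F * V = 1\<^sub>m r" "P = V * F"
proof -
  define Q where "Q k \<longleftrightarrow> (\<exists>V F. V \<in> carrier_mat N k \<and> F \<in> carrier_mat k N \<and> F * V = 1\<^sub>m k \<and>
    P * V = V \<and> F * P = F)" for k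
  have "Q 0"
    unfolding Q_def using P by (intro exI[of _ "0\<^sub>m N 0"] exI[of _ "0\<^sub>m 0 N"]) auto
  moreover have "k \<le> N" if Qk: "Q k" for k
  proof (rule ccontr)
    obtain V F where V: "V \<in> carrier_mat N k" and F: "F \<in> carrier_mat k N" and FV: "F * V = 1\<^sub>m k"
      and "P * V = V" "F * P = F"
      using Qk unfolding Q_def by (elim exE conjE)
    assume "\<not> k \<le> N"
    then obtain x where x: "x \<in> carrier_vec k" "x \<noteq> 0\<^sub>v k" "V *\<^sub>v x = 0\<^sub>v N"
      using nonzero_kernel[OF V] by auto
    have "x = (F * V) *\<^sub>v x" using FV x by simp
    also have "\<dots> = 0\<^sub>v k" using assoc_mult_mat_vec[OF F V x(1)] x(3) mult_mat_zero_vec[OF F] by simp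
    finally show False using x(2) by simp
  qed
  ultimately obtain r where r: "Q r" and max: "\<And>k. Q k \<Longrightarrow> k \<le> r"
    using GreatestI_nat[of Q 0 N] Greatest_le_nat[of Q _ N] by blast
  obtain V F where V: "V \<in> carrier_mat N r" and F: "F \<in> carrier_mat r N" and FV: "F * V = 1\<^sub>m r"
    and PV: "P * V = V" and FP: "F * P = F" using r unfolding Q_def by (elim exE conjE)
  define R where "R = P - V * F"
  have VF: "V * F \<in> carrier_mat N N" using V F by simp
  have R: "R \<in> carrier_mat N N" unfolding R_def by (rule minus_carrier_mat[OF VF])
  have "P * (V * F) = V * F" using PV P V F by (simp flip: assoc_mult_mat[of _ N N _ r _ N])
  then have PR: "P * R = R" unfolding R_def using mult_minus_distrib_mat[OF P P VF] PP by simp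
  have "(V * F) * P = V * F" using FP P V F by (simp add: assoc_mult_mat[of _ N r _ N _ N])
  then have RP: "R * P = R" unfolding R_def using minus_mult_distrib_mat[OF P VF P] PP by simp
  have "F * (V * F) = F" using FV V F by (simp flip: assoc_mult_mat[of _ r N _ r _ N])
  then have FR: "F * R = 0\<^sub>m r N" unfolding R_def using mult_minus_distrib_mat[OF F P VF] FP F by simp
  have "(V * F) * V = V" using FV V F by (simp add: assoc_mult_mat[of _ N r _ N _ r])
  then have RV: "R * V = 0\<^sub>m N r" unfolding R_def using minus_mult_distrib_mat[OF P VF V] PV V by simp
  have "R * (V * F) = 0\<^sub>m N N" using RV R V F by (simp flip: assoc_mult_mat[of _ N N _ r _ N])
  then have RR: "R * R = R"
    using mult_minus_distrib_mat[OF R P VF] RP R by (auto simp flip: R_def intro!: eq_matI)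
  have "R = 0\<^sub>m N N"
  proof (rule ccontr)
    assume "R \<noteq> 0\<^sub>m N N"
    then obtain a b where ab: "a < N" "b < N" "R $$ (a, b) \<noteq> 0" using R by (auto simp: mat_eq_iff)
    \<comment> \<open>The new column is column \<open>b\<close> of \<open>R\<close>, and the new row
      is row \<open>a\<close> divided by \<open>R $$ (a, b)\<close>; as \<open>R\<close> is
      idempotent, their product is 1.\<close>
    define V' where "V' = mat N (Suc r) (\<lambda>(i, j). if j < r then V $$ (i, j) else R $$ (i, b))"
    define F' where "F' = mat (Suc r) N (\<lambda>(i, j). if i < r then F $$ (i, j) else R $$ (a, j) / R $$ (a, b))"
    have V': "V' \<in> carrier_mat N (Suc r)" and F': "F' \<in> carrier_mat (Suc r) N"
      by (auto simp: V'_def F'_def)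
    have colV: "col V' j = (if j < r then col V j else col R b)" if "j < Suc r" for j
      using that V R ab by (intro eq_vecI) (auto simp: V'_def)
    have rowF: "row F' i = (if i < r then row F i else (1 / R $$ (a, b)) \<cdot>\<^sub>v row R a)" if "i < Suc r" for i
      using that F R ab by (intro eq_vecI) (auto simp: F'_def)
    have ent: "row A i \<bullet> col B j = (A * B) $$ (i, j)" if "i < dim_row A" "j < dim_col B" for A B :: "complex mat" and i j
      using that by simp
    have rR: "row R a \<in> carrier_vec N" "col R b \<in> carrier_vec N" using R ab by auto
    have "F' * V' = 1\<^sub>m (Suc r)"
    proof (rule eq_matI)
      fix i j assume "i < dim_row (1\<^sub>m (Suc r) :: complex mat)" "j < dim_col (1\<^sub>m (Suc r) :: complex mat)"
      then have ij: "i < Suc r" "j < Suc r" by auto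
      have cj: "j < r \<Longrightarrow> col V j \<in> carrier_vec N" using V by auto
      have 1: "i < r \<Longrightarrow> j < r \<Longrightarrow> row F i \<bullet> col V j = (if i = j then 1 else 0)"
        using ent[of i F j V] F V FV by simp
      have 2: "i < r \<Longrightarrow> row F i \<bullet> col R b = 0" using ent[of i F b R] F R ab FR by simp
      have 3: "j < r \<Longrightarrow> row R a \<bullet> col V j = 0" using ent[of a R j V] V R ab RV by simp
      have 4: "row R a \<bullet> col R b = R $$ (a, b)" using ent[of a R b R] R ab RR by simp
      have "(F' * V') $$ (i, j) = row F' i \<bullet> col V' j" using ij V' F' by simp
      also have "\<dots> = (if i = j then 1 else 0)"
        using ij 1 2 3 4 rR cj ab by (auto simp: colV rowF less_Suc_eq)
      finally show "(F' * V') $$ (i, j) = 1\<^sub>m (Suc r) $$ (i, j)" using ij by simp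
    qed (use V' F' in auto)
    moreover have "P * V' = V'"
    proof (rule mat_col_eqI)
      fix j assume "j < dim_col V'"
      then have j: "j < Suc r" using V' by simp
      have "col (P * V') j = P *\<^sub>v col V' j" using j P V' by (intro col_mult2) auto
      also have "\<dots> = col V' j"
        using j PV PR P V R ab col_mult2[OF P V, of j] col_mult2[OF P R, of b] by (auto simp: colV)
      finally show "col (P * V') j = col V' j" .
    qed (use P V' in auto)
    moreover have "F' * P = F'"
    proof (rule eq_matI)
      fix i j assume "i < dim_row F'" "j < dim_col F'"
      then have ij: "i < Suc r" "j < N" using F' by auto
      have cP: "col P j \<in> carrier_vec N" using P ij by auto
      have 1: "i < r \<Longrightarrow> row F i \<bullet> col P j = F $$ (i, j)" using ent[of i F j P] F P ij FP by simp
      have 2: "row R a \<bullet> col P j = R $$ (a, j)" using ent[of a R j P] R P ij ab RP by simp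
      have "(F' * P) $$ (i, j) = row F' i \<bullet> col P j" using ij P F' by simp
      also have "\<dots> = (if i < r then F $$ (i, j) else R $$ (a, j) / R $$ (a, b))"
        unfolding rowF[OF ij(1)] using ij 1 2 rR cP by auto
      also have "\<dots> = F' $$ (i, j)" using ij by (simp add: F'_def)
      finally show "(F' * P) $$ (i, j) = F' $$ (i, j)" .
    qed (use P F' in auto)
    ultimately have "Q (Suc r)" unfolding Q_def using V' F' by blast
    then show False using max by fastforce
  qed
  then have "P = V * F"
    using P V F unfolding R_def by (auto simp: mat_eq_iff)
  then show ?thesis using that V F FV by blast
qed

definition tr :: "complex mat \<Rightarrow> complex" where
  "tr A = (\<Sum>i<dim_row A. A $$ (i, i))"

lemma tr_mult_commute:
  assumes "A \<in> carrier_mat n m" "B \<in> carrier_mat m n"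
  shows "tr (A * B) = tr (B * A)"
proof -
  have "tr (A * B) = (\<Sum>i<n. \<Sum>j<m. A $$ (i, j) * B $$ (j, i))"
    using assms by (auto simp: tr_def scalar_prod_def atLeast0LessThan intro!: sum.cong)
  also have "\<dots> = (\<Sum>j<m. \<Sum>i<n. A $$ (i, j) * B $$ (j, i))" by (rule sum.swap)
  also have "\<dots> = tr (B * A)"
    using assms by (auto simp: tr_def scalar_prod_def atLeast0LessThan mult.commute intro!: sum.cong)
  finally show ?thesis .
qed

text \<open>The trace of an idempotent is its rank, because
  \<open>tr (V F) = tr (F V)\<close>.\<close>

lemma idempotent_tr_0:
  assumes "P \<in> carrier_mat N N" "P * P = P" "tr P = 0"
  shows "P = 0\<^sub>m N N"
proof -
  obtain r V F where V: "V \<in> carrier_mat N r" and F: "F \<in> carrier_mat r N" and FV: "F * V = 1\<^sub>m r"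
    and "P = V * F" using idempotent_rank_factorization[OF assms(1,2)] .
  then have "r = 0" using assms(3) tr_mult_commute[OF V F] by (simp add: tr_def)
  then show ?thesis using V F \<open>P = V * F\<close> by (intro eq_matI) (auto simp: scalar_prod_def)
qed

lemma idempotent_tr_1:
  assumes "P \<in> carrier_mat N N" "P * P = P" "tr P = 1"
  obtains v \<phi> where "v \<in> carrier_vec N" "\<phi> \<in> carrier_vec N" "\<phi> \<bullet> v = 1"
    "\<And>i j. i < N \<Longrightarrow> j < N \<Longrightarrow> P $$ (i, j) = v $ i * \<phi> $ j"
proof -
  obtain r V F where V: "V \<in> carrier_mat N r" and F: "F \<in> carrier_mat r N" and FV: "F * V = 1\<^sub>m r"
    and P: "P = V * F" using idempotent_rank_factorization[OF assms(1,2)] .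
  then have r: "r = 1" using assms(3) tr_mult_commute[OF V F] by (simp add: tr_def)
  show ?thesis
  proof (rule that[of "col V 0" "row F 0"])
    have "row F 0 \<bullet> col V 0 = (F * V) $$ (0, 0)" using V F r by simp
    then show "row F 0 \<bullet> col V 0 = 1" using FV r by simp
    show "P $$ (i, j) = col V 0 $ i * row F 0 $ j" if "i < N" "j < N" for i j
      using that V F r by (simp add: P scalar_prod_def)
  qed (use V F r in auto)
qed

section \<open>Irreducible representations\<close>

lemma subspace_iff:
  "VectorSpace.subspace class_ring U (module_vec TYPE(complex) N) \<longleftrightarrow>
     U \<subseteq> carrier_vec N \<and> 0\<^sub>v N \<in> U \<and> (\<forall>x\<in>U. \<forall>y\<in>U. x + y \<in> U) \<and> (\<forall>a. \<forall>x\<in>U. a \<cdot>\<^sub>v x \<in> U)"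
proof -
  have "Module.module class_ring (module_vec TYPE(complex) N)"
    using vec_module by auto
  then show ?thesis
    by (auto simp: VectorSpace.subspace_def submodule_def vec_vs module_vec_simps)
qed

text \<open>The vectors all of whose translates are killed by a given form are an invariant
  subspace, hence zero or everything. A nonzero form does not kill everything, which is the first
  claim. If the subspace contains a nonzero \<open>v\<close>, it is everything and the form is zero,
  which is the second.\<close>

lemma irreducible_separates:
  assumes G: "group G" and irr: "irreducible_rep G R"
  shows "\<phi> \<in> carrier_vec (fst R) \<Longrightarrow> \<phi> \<noteq> 0\<^sub>v (fst R) \<Longrightarrow> x \<in> carrier_vec (fst R) \<Longrightarrow>
      (\<And>g. g \<in> carrier G \<Longrightarrow> \<phi> \<bullet> (snd R g *\<^sub>v x) = 0) \<Longrightarrow> x = 0\<^sub>v (fst R)"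
    and "v \<in> carrier_vec (fst R) \<Longrightarrow> v \<noteq> 0\<^sub>v (fst R) \<Longrightarrow> x \<in> carrier_vec (fst R) \<Longrightarrow>
      (\<And>g. g \<in> carrier G \<Longrightarrow> x \<bullet> (snd R g *\<^sub>v v) = 0) \<Longrightarrow> x = 0\<^sub>v (fst R)"
proof -
  interpret group G by fact
  define N where "N = fst R"
  have rep: "representation G R" using irr by (simp add: irreducible_rep_def)
  note r = repD[OF G rep, folded N_def]
  have main: "{x \<in> carrier_vec N. \<forall>g\<in>carrier G. \<phi> \<bullet> (snd R g *\<^sub>v x) = 0} \<in> {{0\<^sub>v N}, carrier_vec N}"
    (is "?Z \<in> _") if \<phi>: "\<phi> \<in> carrier_vec N" for \<phi>
  proof -
    have 1: "snd R g *\<^sub>v (x + y) = snd R g *\<^sub>v x + snd R g *\<^sub>v y" "snd R g *\<^sub>v (a \<cdot>\<^sub>v x) = a \<cdot>\<^sub>v (snd R g *\<^sub>v x)"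
      "snd R g *\<^sub>v x \<in> carrier_vec N"
      if "g \<in> carrier G" "x \<in> carrier_vec N" "y \<in> carrier_vec N" for g x y a
      using r(1)[OF that(1)] that
      by (auto simp: mult_add_distrib_mat_vec[of _ N N] mult_mat_vec[of _ N N])
    have "VectorSpace.subspace class_ring ?Z (module_vec TYPE(complex) N)"
      unfolding subspace_iff
      using \<phi> 1 r(1) by (auto simp: scalar_prod_add_distrib[of _ N] mult_mat_zero_vec[of _ N N])
    moreover have "snd R h *\<^sub>v x \<in> ?Z" if "h \<in> carrier G" "x \<in> ?Z" for h x
    proof -
      have "snd R g *\<^sub>v (snd R h *\<^sub>v x) = snd R (g \<otimes>\<^bsub>G\<^esub> h) *\<^sub>v x" if "g \<in> carrier G" for g
        using assoc_mult_mat_vec[OF r(1)[OF that] r(1)[OF \<open>h \<in> carrier G\<close>], of x] \<open>x \<in> ?Z\<close>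
          r(2)[OF that \<open>h \<in> carrier G\<close>] by simp
      then show ?thesis using that 1(3) by auto
    qed
    ultimately show ?thesis using irr unfolding irreducible_rep_def N_def by blast
  qed
  show "x = 0\<^sub>v (fst R)" if "\<phi> \<in> carrier_vec (fst R)" "\<phi> \<noteq> 0\<^sub>v (fst R)" "x \<in> carrier_vec (fst R)"
    "\<And>g. g \<in> carrier G \<Longrightarrow> \<phi> \<bullet> (snd R g *\<^sub>v x) = 0"
  proof -
    have "{x \<in> carrier_vec N. \<forall>g\<in>carrier G. \<phi> \<bullet> (snd R g *\<^sub>v x) = 0} \<noteq> carrier_vec N"
    proof
      assume "{x \<in> carrier_vec N. \<forall>g\<in>carrier G. \<phi> \<bullet> (snd R g *\<^sub>v x) = 0} = carrier_vec N"
      then have "\<phi> \<bullet> (snd R \<one>\<^bsub>G\<^esub> *\<^sub>v y) = 0" if "y \<in> carrier_vec N" for y using that by blast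
      then have "y \<bullet> \<phi> = 0" if "y \<in> carrier_vec N" for y
        using that r(3) comm_scalar_prod[OF that \<open>\<phi> \<in> _\<close>[folded N_def]] by simp
      then show False using that(1,2) vec_eq_0_iff_scalar_prod[of \<phi> N] by (auto simp: N_def)
    qed
    then show ?thesis using main[of \<phi>] that by (auto simp: N_def)
  qed
  show "x = 0\<^sub>v (fst R)" if "v \<in> carrier_vec (fst R)" "v \<noteq> 0\<^sub>v (fst R)" "x \<in> carrier_vec (fst R)"
    "\<And>g. g \<in> carrier G \<Longrightarrow> x \<bullet> (snd R g *\<^sub>v v) = 0"
  proof -
    have "{y \<in> carrier_vec N. \<forall>g\<in>carrier G. x \<bullet> (snd R g *\<^sub>v y) = 0} = carrier_vec N"
      using main[of x] that by (auto simp: N_def)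
    then have "x \<bullet> (snd R \<one>\<^bsub>G\<^esub> *\<^sub>v y) = 0" if "y \<in> carrier_vec N" for y using that by blast
    then have "y \<bullet> x = 0" if "y \<in> carrier_vec N" for y
      using that r(3) comm_scalar_prod[OF that \<open>x \<in> _\<close>[folded N_def]] by simp
    then show ?thesis using that(3) vec_eq_0_iff_scalar_prod[of x N] by (auto simp: N_def)
  qed
qed

section \<open>Highest weight vectors of polynomial representations\<close>

text \<open>Polynomial dependence is tested only along polynomial curves of matrices in one
  variable, which may leave the group at some \<open>t\<close>. All limits and density arguments
  below take place on such curves.\<close>

definition regular :: "nat \<Rightarrow> nat \<Rightarrow> (complex mat \<Rightarrow> complex mat) \<Rightarrow> bool" where
  "regular n N \<rho> \<longleftrightarrow> (\<forall>M. (\<forall>t. M t \<in> carrier_mat n n) \<longrightarrow>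
     (\<forall>i<n. \<forall>j<n. polyfun (\<lambda>t. M t $$ (i, j))) \<longrightarrow>
     (\<forall>i<N. \<forall>j<N. \<exists>f. polyfun f \<and> (\<forall>t. M t \<in> carrier (GL n) \<longrightarrow> \<rho> (M t) $$ (i, j) = f t)))"

lemma regularD:
  assumes "regular n N \<rho>" "\<And>t. M t \<in> carrier_mat n n" "\<And>i j. i < n \<Longrightarrow> j < n \<Longrightarrow> polyfun (\<lambda>t. M t $$ (i, j))"
    "i < N" "j < N"
  obtains f where "polyfun f" "\<And>t. M t \<in> carrier (GL n) \<Longrightarrow> \<rho> (M t) $$ (i, j) = f t"
  using assms(1)[unfolded regular_def, rule_format, OF assms(2,3,4,5)] that by auto

lemma polyfun_entry_poly:
  assumes "p \<in> entry_poly n" "\<And>i j. i < n \<Longrightarrow> j < n \<Longrightarrow> polyfun (\<lambda>t. M t $$ (i, j))"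
  shows "polyfun (\<lambda>t. p (M t))"
  using assms(1) by induction (auto intro: polyfun_intros assms(2))

lemma polynomial_rep_regular:
  assumes "polynomial_rep n R"
  shows "regular n (fst R) (snd R)"
  unfolding regular_def
proof (intro allI impI)
  fix M :: "complex \<Rightarrow> complex mat" and i j
  assume M: "\<forall>i<n. \<forall>j<n. polyfun (\<lambda>t. M t $$ (i, j))" and ij: "i < fst R" "j < fst R"
  then obtain p where p: "p \<in> entry_poly n" "\<And>A. A \<in> carrier (GL n) \<Longrightarrow> snd R A $$ (i, j) = p A"
    using assms unfolding polynomial_rep_def by blast
  then show "\<exists>f. polyfun f \<and> (\<forall>t. M t \<in> carrier (GL n) \<longrightarrow> snd R (M t) $$ (i, j) = f t)"
    using polyfun_entry_poly[OF p(1), of M] M by blast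
qed

lemma regular_bilinear:
  assumes reg: "regular n N \<rho>" and c: "\<And>g. g \<in> carrier (GL n) \<Longrightarrow> \<rho> g \<in> carrier_mat N N"
    and M: "\<And>t. M t \<in> carrier_mat n n" "\<And>i j. i < n \<Longrightarrow> j < n \<Longrightarrow> polyfun (\<lambda>t. M t $$ (i, j))"
    and xy: "x \<in> carrier_vec N" "y \<in> carrier_vec N"
  obtains f where "polyfun f" "\<And>t. M t \<in> carrier (GL n) \<Longrightarrow> y \<bullet> (\<rho> (M t) *\<^sub>v x) = f t"
proof -
  have "\<exists>f. polyfun f \<and> (\<forall>t. M t \<in> carrier (GL n) \<longrightarrow> \<rho> (M t) $$ (i, j) = f t)" if "i < N" "j < N" for i j
    by (rule regularD[OF reg M that]) auto
  then have "\<forall>i j. \<exists>f. i < N \<longrightarrow> j < N \<longrightarrow> polyfun f \<and> (\<forall>t. M t \<in> carrier (GL n) \<longrightarrow> \<rho> (M t) $$ (i, j) = f t)"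
    by blast
  then obtain f where f: "\<And>i j. i < N \<Longrightarrow> j < N \<Longrightarrow> polyfun (f i j)"
      "\<And>i j t. i < N \<Longrightarrow> j < N \<Longrightarrow> M t \<in> carrier (GL n) \<Longrightarrow> \<rho> (M t) $$ (i, j) = f i j t"
    by metis
  show ?thesis
  proof (rule that[of "\<lambda>t. \<Sum>i<N. \<Sum>j<N. y $ i * f i j t * x $ j"])
    show "polyfun (\<lambda>t. \<Sum>i<N. \<Sum>j<N. y $ i * f i j t * x $ j)"
      using f(1) by (intro polyfun_intros) auto
    show "y \<bullet> (\<rho> (M t) *\<^sub>v x) = (\<Sum>i<N. \<Sum>j<N. y $ i * f i j t * x $ j)" if "M t \<in> carrier (GL n)" for t
      unfolding bilinear_expand[OF c[OF that] xy] using f(2) that by (intro sum.cong refl) auto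
  qed
qed

section \<open>Triangular matrices and one-parameter tori\<close>

lemma det_upper_triangular_prod:
  assumes "upper_triangular A" "(A :: complex mat) \<in> carrier_mat n n"
  shows "det A = (\<Prod>i<n. A $$ (i, i))"
proof -
  have "det A = prod_list (map (\<lambda>i. A $$ (i, i)) [0..<n])"
    using det_upper_triangular[OF assms] assms(2) by (simp add: diag_mat_def)
  also have "\<dots> = (\<Prod>i<n. A $$ (i, i))"
    by (subst prod.distinct_set_conv_list[symmetric]) (auto simp: atLeast0LessThan)
  finally show ?thesis .
qed

lemma mat_diag_GL: "mat_diag n x \<in> carrier (GL n) \<longleftrightarrow> (\<forall>i<n. x i \<noteq> 0)"
proof -
  have "det (mat_diag n x) = (\<Prod>i<n. mat_diag n x $$ (i, i))"
    by (rule det_upper_triangular_prod) (auto simp: mat_diag_def)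
  then show ?thesis by (auto simp: GL_iff mat_diag_def)
qed

lemma upper_triangular_GL:
  assumes "upper_triangular b" "b \<in> carrier_mat n n"
  shows "b \<in> carrier (GL n) \<longleftrightarrow> (\<forall>i<n. b $$ (i, i) \<noteq> 0)"
  using det_upper_triangular_prod[OF assms] assms(2) by (auto simp: GL_iff)

text \<open>For upper triangular \<open>b\<close> this is \<open>t^c b t^-c\<close> with \<open>t^c = diag (t^n, \<dots>, t)\<close>, extended to \<open>t = 0\<close>.\<close>

definition conj_torus :: "complex mat \<Rightarrow> complex \<Rightarrow> complex mat" where
  "conj_torus b t = mat (dim_row b) (dim_col b) (\<lambda>(i, j). if i \<le> j then b $$ (i, j) * t ^ (j - i) else 0)"

definition torus :: "nat \<Rightarrow> complex \<Rightarrow> complex mat" where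
  "torus n t = mat_diag n (\<lambda>i. t ^ (n - i))"

lemma torus_simps:
  "torus n t \<in> carrier_mat n n" "torus n (s * t) = torus n s * torus n t" "torus n 1 = 1\<^sub>m n"
  "t \<noteq> 0 \<Longrightarrow> torus n t \<in> carrier (GL n)"
  by (auto simp: torus_def mat_diag_diag power_mult_distrib mat_diag_GL)

lemma polyfun_torus: "i < n \<Longrightarrow> j < n \<Longrightarrow> polyfun (\<lambda>t. torus n t $$ (i, j))"
  by (simp add: torus_def mat_diag_def) (intro polyfun_intros)

lemma mat_diag_mult_commute: "mat_diag n x * mat_diag n y = mat_diag n y * mat_diag n (x :: nat \<Rightarrow> complex)"
  by (simp add: mat_diag_diag mult.commute)

lemma conj_torus:
  assumes b: "upper_triangular b" "b \<in> carrier_mat n n"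
  shows "conj_torus b t \<in> carrier_mat n n"
    and "upper_triangular (conj_torus b t)"
    and "i < n \<Longrightarrow> j < n \<Longrightarrow> polyfun (\<lambda>t. conj_torus b t $$ (i, j))"
    and "torus n t * b = conj_torus b t * torus n t"
    and "conj_torus b 1 = b"
    and "conj_torus b 0 = mat_diag n (\<lambda>i. b $$ (i, i))"
    and "b \<in> carrier (GL n) \<Longrightarrow> conj_torus b t \<in> carrier (GL n)"
proof -
  have c: "conj_torus b t \<in> carrier_mat n n" for t using b by (simp add: conj_torus_def)
  then show "conj_torus b t \<in> carrier_mat n n" .
  show u: "upper_triangular (conj_torus b t)" using b by (auto simp: conj_torus_def)
  show "i < n \<Longrightarrow> j < n \<Longrightarrow> polyfun (\<lambda>t. conj_torus b t $$ (i, j))"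
    using b by (simp add: conj_torus_def) (intro polyfun_intros)
  show "torus n t * b = conj_torus b t * torus n t"
  proof (rule eq_matI)
    fix i j assume "i < dim_row (conj_torus b t * torus n t)" "j < dim_col (conj_torus b t * torus n t)"
    then have ij: "i < n" "j < n" using c[of t] torus_simps(1)[of n t] by auto
    have "t ^ (n - i) = t ^ (j - i) * t ^ (n - j)" if "i \<le> j"
      using that ij by (simp flip: power_add)
    moreover have "b $$ (i, j) = 0" if "\<not> i \<le> j" using b that ij by (auto simp: upper_triangular_def)
    ultimately show "(torus n t * b) $$ (i, j) = (conj_torus b t * torus n t) $$ (i, j)"
      unfolding torus_def mat_diag_mult_left[OF b(2)] mat_diag_mult_right[OF c]
      using ij b(2) by (auto simp: conj_torus_def)
  qed (use b c[of t] torus_simps(1)[of n t] in auto)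
  show "conj_torus b 1 = b"
    using b by (intro eq_matI) (auto simp: conj_torus_def upper_triangular_def)
  show "conj_torus b 0 = mat_diag n (\<lambda>i. b $$ (i, i))"
    using b by (intro eq_matI) (auto simp: conj_torus_def mat_diag_def power_0_left)
  show "b \<in> carrier (GL n) \<Longrightarrow> conj_torus b t \<in> carrier (GL n)"
    unfolding upper_triangular_GL[OF b] upper_triangular_GL[OF u c]
    using b by (auto simp: conj_torus_def)
qed

text \<open>No degree above \<open>K\<close> occurs anywhere, so \<open>contraction\<close> applies
  to the curve \<open>conj_torus b t\<close>, which runs from the diagonal of \<open>b\<close> at
  \<open>t = 0\<close> to \<open>b\<close> at \<open>t = 1\<close>.\<close>

lemma top_vector_triangular:
  assumes reg: "regular n N \<rho>" and c: "\<And>g. g \<in> carrier (GL n) \<Longrightarrow> \<rho> g \<in> carrier_mat N N"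
    and hom: "\<And>g h. g \<in> carrier (GL n) \<Longrightarrow> h \<in> carrier (GL n) \<Longrightarrow> \<rho> (g * h) = \<rho> g * \<rho> h"
    and g: "graded N (\<lambda>t. \<rho> (torus n t)) D P" and K: "K \<le> D"
    and top: "\<And>l. K < l \<Longrightarrow> l \<le> D \<Longrightarrow> P l = 0\<^sub>m N N"
    and f: "f \<in> carrier_vec N" "P K *\<^sub>v f = f"
    and b: "upper_triangular b" "b \<in> carrier (GL n)"
  shows "\<rho> b *\<^sub>v f = \<rho> (mat_diag n (\<lambda>i. b $$ (i, i))) *\<^sub>v f"
proof -
  have bc: "b \<in> carrier_mat n n" using b(2) by (simp add: GL_iff)
  note B = conj_torus[OF b(1) bc]
  note BG = B(7)[OF b(2)]
  define B' where "B' t = \<rho> (conj_torus b t)" for t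
  have "B' 1 *\<^sub>v f = B' 0 *\<^sub>v f"
  proof (rule contraction[OF g K])
    show "B' t \<in> carrier_mat N N" for t using c[OF BG] by (simp add: B'_def)
    show "polyfun (\<lambda>t. B' t $$ (i, j))" if ij: "i < N" "j < N" for i j
    proof (rule regularD[OF reg B(1,3) ij])
      fix f assume f: "polyfun f" "\<And>t. conj_torus b t \<in> carrier (GL n) \<Longrightarrow> \<rho> (conj_torus b t) $$ (i, j) = f t"
      then have "(\<lambda>t. B' t $$ (i, j)) = f" using BG by (auto simp: B'_def)
      then show ?thesis using f by simp
    qed
    show "\<rho> (torus n t) * B' 1 = B' t * \<rho> (torus n t)" if "t \<noteq> 0" for t
      using hom[OF torus_simps(4)[OF that] b(2)] hom[OF BG torus_simps(4)[OF that], of t] B(4)[of t]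
      by (simp add: B'_def B(5))
    show "\<rho> (torus n t) *\<^sub>v f = t ^ K \<cdot>\<^sub>v f" if "t \<noteq> 0" for t
      using graded_eigen[OF g K that f(1)] f(2) by simp
    show "P l *\<^sub>v (B' 1 *\<^sub>v f) = 0\<^sub>v N" if "K < l" "l \<le> D" for l
      using top[OF that] f(1) c[OF BG, of 1] mult_mat_vec_carrier[of "B' 1" N N f]
      by (simp add: B'_def zero_mat_mult_vec)
  qed (rule f(1))
  then show ?thesis by (simp add: B'_def B(5,6))
qed

lemma graded_transpose:
  assumes g: "graded N T D P"
  shows "graded N (\<lambda>t. transpose_mat (T t)) D (\<lambda>k. transpose_mat (P k))"
proof -
  note G = gradedD[OF g]
  have t: "y \<bullet> (transpose_mat A *\<^sub>v x) = x \<bullet> (A *\<^sub>v y)"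
    if "A \<in> carrier_mat N N" "x \<in> carrier_vec N" "y \<in> carrier_vec N" for A :: "complex mat" and x y
    using scalar_prod_mult_mat_vec[OF that(1,3,2)]
      comm_scalar_prod[of "transpose_mat A *\<^sub>v x" N y] mult_mat_vec_carrier[of "transpose_mat A" N N x] that
    by simp
  have "transpose_mat (P k) * transpose_mat (P l) = (if k = l then transpose_mat (P k) else 0\<^sub>m N N)"
    if "k \<le> D" "l \<le> D" for k l
    using transpose_mult[OF G(1) G(1), of l k] G(4)[OF that(2,1)] by auto
  then show ?thesis
    unfolding graded_def using G(1,2,3) by (auto simp: t)
qed

section \<open>Tableaux of maximal degree\<close>

lemma is_partition_nth_mono:
  assumes "lam \<turnstile> d" "i \<le> j" "j < length lam"
  shows "lam ! j \<le> lam ! i"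
  using assms sorted_wrt_nth_less[of "(\<ge>)" lam i j] by (cases "i = j") (auto simp: is_partition_def)

lemma finite_diagram: "finite (diagram lam)"
proof -
  have "diagram lam = (SIGMA i:{..<length lam}. {..<lam ! i})" by (auto simp: diagram_def)
  then show ?thesis by auto
qed

lemma schur_eq:
  "schur n lam x = (\<Sum>T \<in> ssyt n lam. \<Prod>c \<in> diagram lam. x (T c))"
  unfolding schur_def
proof (rule sum.cong[OF refl])
  fix T assume "T \<in> ssyt n lam"
  then have T: "T ` diagram lam \<subseteq> {..<n}" by (auto simp: ssyt_def)
  have "(\<Prod>i<n. x i ^ card {c \<in> diagram lam. T c = i}) = (\<Prod>i<n. \<Prod>c\<in>{c \<in> diagram lam. T c = i}. x (T c))"
    by (intro prod.cong refl) (simp add: prod_constant)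
  also have "\<dots> = (\<Prod>c \<in> diagram lam. x (T c))"
    by (rule prod.group[OF finite_diagram _ T]) simp
  finally show "(\<Prod>i<n. x i ^ card {c \<in> diagram lam. T c = i}) = (\<Prod>c \<in> diagram lam. x (T c))" .
qed

lemma finite_ssyt: "finite (ssyt n lam)"
  by (rule finite_subset[of _ "diagram lam \<rightarrow>\<^sub>E {..<n}"]) (auto simp: ssyt_def finite_PiE finite_diagram)

text \<open>Entries increase strictly down a column, starting from at least 0 in row 0.\<close>

lemma ssyt_ge_row:
  assumes lam: "lam \<turnstile> d" and T: "T \<in> ssyt n lam" and "(i, j) \<in> diagram lam"
  shows "i \<le> T (i, j)"
  using assms(3)
proof (induction i)
  case (Suc i)
  then have "(i, j) \<in> diagram lam"
    using is_partition_nth_mono[OF lam, of i "Suc i"] by (auto simp: diagram_def)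
  then have "i \<le> T (i, j)" "T (i, j) < T (Suc i, j)"
    using Suc T unfolding ssyt_def by auto
  then show ?case by simp
qed simp

lemma row_tableau:
  assumes lam: "lam \<turnstile> d" and "length lam \<le> n"
  shows "restrict fst (diagram lam) \<in> ssyt n lam"
  using assms(2) by (auto simp: ssyt_def diagram_def)

text \<open>The degree in \<open>t\<close> of the monomial of \<open>T\<close> once
  \<open>x i * t ^ (n - i)\<close> is put for \<open>x i\<close>, which is the effect of multiplying
  by \<open>torus n t\<close>. At \<open>fst\<close> it is the degree of the tableau whose row
  \<open>i\<close> consists of entries \<open>i\<close>.\<close>

abbreviation tab_weight :: "nat \<Rightarrow> nat list \<Rightarrow> (nat \<times> nat \<Rightarrow> nat) \<Rightarrow> nat" where
  "tab_weight n lam T \<equiv> (\<Sum>c \<in> diagram lam. n - T c)"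

text \<open>Each entry is at least its row index, so every summand is at most the one for
  \<open>fst\<close>. A single larger entry, being still below \<open>n\<close>, makes the sum
  strictly smaller.\<close>

lemma tab_weight_le:
  assumes lam: "lam \<turnstile> d" and T: "T \<in> ssyt n lam"
  shows "tab_weight n lam T \<le> tab_weight n lam fst"
    and "tab_weight n lam T = tab_weight n lam fst \<longleftrightarrow> T = restrict fst (diagram lam)"
proof -
  have ge: "fst c \<le> T c" "T c < n" if "c \<in> diagram lam" for c
    using ssyt_ge_row[OF lam T, of "fst c" "snd c"] T that by (auto simp: ssyt_def)
  show "tab_weight n lam T \<le> tab_weight n lam fst"
    using ge by (intro sum_mono) (auto intro: diff_le_mono2)
  show "tab_weight n lam T = tab_weight n lam fst \<longleftrightarrow> T = restrict fst (diagram lam)"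
  proof
    assume eq: "tab_weight n lam T = tab_weight n lam fst"
    have "T c = fst c" if "c \<in> diagram lam" for c
    proof (rule ccontr)
      assume "T c \<noteq> fst c"
      then have "n - T c < n - fst c" using ge[OF that] by simp
      then have "tab_weight n lam T < tab_weight n lam fst"
        using ge that by (intro sum_strict_mono_ex1 finite_diagram) (auto intro: diff_le_mono2)
      then show False using eq by simp
    qed
    then show "T = restrict fst (diagram lam)"
      using T by (auto simp: ssyt_def PiE_def extensional_def restrict_def)
  qed auto
qed

text \<open>\<open>v\<close> is a highest weight vector and \<open>\<phi>\<close> a lowest weight form, both of weight \<open>lam\<close>; the last
  property says that the rank one operator \<open>v \<phi>\<close> lies in the linear span of the group.\<close>

lemma highest_weight:
  assumes W: "is_W n lam R" and lam: "lam \<turnstile> d" and len: "length lam \<le> n"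
  obtains v \<phi> where "v \<in> carrier_vec (fst R)" "\<phi> \<in> carrier_vec (fst R)" "\<phi> \<bullet> v = 1"
    "\<And>b. b \<in> carrier (GL n) \<Longrightarrow> upper_triangular b \<Longrightarrow>
       snd R b *\<^sub>v v = (\<Prod>c\<in>diagram lam. b $$ (fst c, fst c)) \<cdot>\<^sub>v v"
    "\<And>b. b \<in> carrier (GL n) \<Longrightarrow> upper_triangular (transpose_mat b) \<Longrightarrow>
       transpose_mat (snd R b) *\<^sub>v \<phi> = (\<Prod>c\<in>diagram lam. b $$ (fst c, fst c)) \<cdot>\<^sub>v \<phi>"
    "\<And>Q. (\<And>g. g \<in> carrier (GL n) \<Longrightarrow> (\<Sum>i<fst R. \<Sum>j<fst R. Q i j * snd R g $$ (i, j)) = 0) \<Longrightarrow>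
       (\<Sum>i<fst R. \<Sum>j<fst R. Q i j * (v $ i * \<phi> $ j)) = 0"
proof -
  define N where "N = fst R"
  define \<rho> where "\<rho> = snd R"
  have poly: "polynomial_rep n R" and rep: "representation (GL n) R"
    and char: "\<And>x. (\<forall>i<n. x i \<noteq> 0) \<Longrightarrow> character n R x = schur n lam x"
    using W len by (auto simp: is_W_def polynomial_rep_def)
  have reg: "regular n N \<rho>" using polynomial_rep_regular[OF poly] by (simp add: N_def \<rho>_def)
  note r = repD[OF group_GL rep, folded N_def \<rho>_def, unfolded GL_simps(2,3)]
  define T where "T t = \<rho> (torus n t)" for t
  have Tc: "T t \<in> carrier_mat N N" if "t \<noteq> 0" for t
    using r(1) torus_simps(4)[OF that] by (simp add: T_def)
  obtain D P where g: "graded N T D P"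
  proof (rule graded_exists[of T N])
    show "T t \<in> carrier_mat N N" if "t \<noteq> 0" for t using Tc[OF that] .
    show "T (s * t) = T s * T t" if "s \<noteq> 0" "t \<noteq> 0" for s t
      using r(2)[OF torus_simps(4)[OF that(1)] torus_simps(4)[OF that(2)]] by (simp add: T_def torus_simps(2))
    show "\<exists>f. polyfun f \<and> (\<forall>t. t \<noteq> 0 \<longrightarrow> T t $$ (i, j) = f t)" if "i < N" "j < N" for i j
      using regularD[OF reg torus_simps(1) polyfun_torus that] torus_simps(4) unfolding T_def by metis
  qed
  note G = gradedD[OF g]
  have entT: "T t $$ (i, j) = (\<Sum>k\<le>D. t ^ k * P k $$ (i, j))" if "t \<noteq> 0" "i < N" "j < N" for t i j
  proof -
    have ent: "unit_vec N i \<bullet> (A *\<^sub>v unit_vec N j) = A $$ (i, j)" if "A \<in> carrier_mat N N" for A :: "complex mat"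
      using that \<open>i < N\<close> \<open>j < N\<close> mult_mat_unit_vec[OF that \<open>j < N\<close>] by simp
    show ?thesis using G(3)[OF that(1), of "unit_vec N j" "unit_vec N i"] ent[OF Tc[OF that(1)]] ent[OF G(1)] by simp
  qed
  \<comment> \<open>\<open>Q\<close> is an arbitrary linear functional on matrices: below it is the
    trace against \<open>\<rho> (mat_diag n x)\<close>, and at the end a functional that vanishes on
    the group.\<close>
  have lin: "(\<Sum>i<N. \<Sum>j<N. Q i j * T t $$ (i, j)) = (\<Sum>k\<le>D. t ^ k * (\<Sum>i<N. \<Sum>j<N. Q i j * P k $$ (i, j)))"
    if "t \<noteq> 0" for Q t
  proof -
    have "(\<Sum>i<N. \<Sum>j<N. Q i j * T t $$ (i, j)) = (\<Sum>i<N. \<Sum>j<N. \<Sum>k\<le>D. t ^ k * (Q i j * P k $$ (i, j)))"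
      by (intro sum.cong refl) (simp add: entT that sum_distrib_left mult_ac)
    also have "\<dots> = (\<Sum>k\<le>D. \<Sum>i<N. \<Sum>j<N. t ^ k * (Q i j * P k $$ (i, j)))"
      by (simp only: sum.swap[of _ "{..D}" "{..<N}"])
    finally show ?thesis by (simp add: sum_distrib_left)
  qed
  have tr_lin: "tr (X * A) = (\<Sum>i<N. \<Sum>j<N. X $$ (j, i) * A $$ (i, j))"
    if "X \<in> carrier_mat N N" "A \<in> carrier_mat N N" for X A
  proof -
    have "tr (X * A) = (\<Sum>j<N. \<Sum>i<N. X $$ (j, i) * A $$ (i, j))"
      using that by (auto simp: tr_def scalar_prod_def atLeast0LessThan intro!: sum.cong)
    then show ?thesis by (subst sum.swap)
  qed
  define K where "K = tab_weight n lam fst"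
  \<comment> \<open>The coefficient of \<open>t ^ k\<close> in the Schur polynomial at the point
    \<open>x i * t ^ (n - i)\<close>.\<close>
  define b where "b x k = (\<Sum>T\<in>{T \<in> ssyt n lam. tab_weight n lam T = k}. \<Prod>c\<in>diagram lam. x (T c))"
    for x :: "nat \<Rightarrow> complex" and k
  have bK: "b x K = (\<Prod>c\<in>diagram lam. x (fst c))" for x
  proof -
    have "{T \<in> ssyt n lam. tab_weight n lam T = K} = {restrict fst (diagram lam)}"
      using tab_weight_le(2)[OF lam] row_tableau[OF lam len] unfolding K_def by blast
    then show ?thesis by (simp add: b_def)
  qed
  have b0: "b x k = 0" if "k > K" for x k
  proof -
    have "{T \<in> ssyt n lam. tab_weight n lam T = k} = {}"
      using tab_weight_le(1)[OF lam] that unfolding K_def by fastforce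
    then show ?thesis by (simp only: b_def sum.empty)
  qed
  have trace: "tr (\<rho> (mat_diag n x) * T t) = (\<Sum>k\<le>K. t ^ k * b x k)"
    if x: "\<forall>i<n. x i \<noteq> 0" and t: "t \<noteq> 0" for x t
  proof -
    have "tr (\<rho> (mat_diag n x) * T t) = tr (\<rho> (mat_diag n (\<lambda>i. x i * t ^ (n - i))))"
      using r(2)[of "mat_diag n x" "torus n t"] x t torus_simps(4)[OF t]
      by (simp add: T_def mat_diag_GL torus_def mat_diag_diag)
    also have "\<dots> = character n R (\<lambda>i. x i * t ^ (n - i))"
      by (simp add: character_def tr_def Let_def \<rho>_def)
    also have "\<dots> = schur n lam (\<lambda>i. x i * t ^ (n - i))"
      using x t by (intro char) auto
    also have "\<dots> = (\<Sum>T \<in> ssyt n lam. t ^ tab_weight n lam T * (\<Prod>c \<in> diagram lam. x (T c)))"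
      unfolding schur_eq by (intro sum.cong refl) (simp add: prod.distrib power_sum mult.commute)
    also have "\<dots> = (\<Sum>k\<le>K. \<Sum>T\<in>{T \<in> ssyt n lam. tab_weight n lam T = k}.
        t ^ tab_weight n lam T * (\<Prod>c \<in> diagram lam. x (T c)))"
      using tab_weight_le(1)[OF lam] by (intro sum.group[symmetric] finite_ssyt) (auto simp: K_def)
    also have "\<dots> = (\<Sum>k\<le>K. t ^ k * b x k)"
      by (auto simp: b_def sum_distrib_left intro!: sum.cong)
    finally show ?thesis .
  qed
  \<comment> \<open>\<open>D\<close> and \<open>K\<close> are not yet compared, hence the value 0
    beyond \<open>D\<close> and the common bound \<open>M\<close>.\<close>
  have trP: "(if k \<le> D then tr (\<rho> (mat_diag n x) * P k) else 0) = b x k"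
    if x: "\<forall>i<n. x i \<noteq> 0" for x k
  proof -
    have X: "\<rho> (mat_diag n x) \<in> carrier_mat N N" using r(1) x by (simp add: mat_diag_GL)
    define a where "a k = (if k \<le> D then tr (\<rho> (mat_diag n x) * P k) else 0)" for k
    define M where "M = max k (max D K)"
    have "a k = b x k"
    proof (rule coeffs_unique[where D = M])
      fix t :: complex assume t: "t \<noteq> 0"
      have "(\<Sum>k\<le>M. t ^ k * a k) = (\<Sum>k\<le>D. t ^ k * a k)"
        by (intro sum.mono_neutral_right) (auto simp: M_def a_def)
      also have "\<dots> = (\<Sum>k\<le>D. t ^ k * tr (\<rho> (mat_diag n x) * P k))" by (simp add: a_def)
      also have "\<dots> = tr (\<rho> (mat_diag n x) * T t)"
        using lin[OF t, of "\<lambda>i j. \<rho> (mat_diag n x) $$ (j, i)"] by (simp add: tr_lin X G(1) Tc[OF t])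
      also have "\<dots> = (\<Sum>k\<le>K. t ^ k * b x k)" by (rule trace[OF x t])
      also have "\<dots> = (\<Sum>k\<le>M. t ^ k * b x k)"
        by (intro sum.mono_neutral_left) (auto simp: M_def b0)
      finally show "(\<Sum>k\<le>M. t ^ k * a k) = (\<Sum>k\<le>M. t ^ k * b x k)" .
    qed (simp add: M_def)
    then show ?thesis by (simp add: a_def)
  qed
  have one: "mat_diag n (\<lambda>i. 1) = (1\<^sub>m n :: complex mat)" by simp
  have "b (\<lambda>_. 1) K = 1" by (simp add: bK)
  \<comment> \<open>If \<open>K\<close> exceeded \<open>D\<close>, the trace formula would give 0
    for the coefficient just found to be 1.\<close>
  then have K: "K \<le> D" using trP[of "\<lambda>_. 1" K] by (auto split: if_splits)
  have idem: "P k * P k = P k" if "k \<le> D" for k using G(4)[OF that that] by simp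
  have tr1: "tr (P k) = b (\<lambda>_. 1) k" if "k \<le> D" for k
    using trP[of "\<lambda>_. 1" k] that G(1)[of k] r(3) one by simp
  \<comment> \<open>Beyond \<open>K\<close> the idempotents \<open>P k\<close> have trace 0.\<close>
  have top: "P k = 0\<^sub>m N N" if "K < k" "k \<le> D" for k
    using idempotent_tr_0[OF G(1) idem[OF that(2)]] tr1[OF that(2)] b0[OF that(1)] by simp
  have trK: "tr (P K) = 1" using tr1[OF K] by (simp add: bK)
  obtain v \<phi> where v: "v \<in> carrier_vec N" and \<phi>: "\<phi> \<in> carrier_vec N" and \<phi>v: "\<phi> \<bullet> v = 1"
    and PK: "\<And>i j. i < N \<Longrightarrow> j < N \<Longrightarrow> P K $$ (i, j) = v $ i * \<phi> $ j"
    by (rule idempotent_tr_1[OF G(1) idem[OF K] trK]) blast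
  have PKv: "P K *\<^sub>v x = (\<phi> \<bullet> x) \<cdot>\<^sub>v v" if "x \<in> carrier_vec N" for x
    using that v \<phi> G(1)[of K]
    by (intro eq_vecI) (auto simp: PK scalar_prod_def sum_distrib_left sum_distrib_right mult_ac)
  have PKt: "transpose_mat (P K) *\<^sub>v x = (v \<bullet> x) \<cdot>\<^sub>v \<phi>" if "x \<in> carrier_vec N" for x
    using that v \<phi> G(1)[of K]
    by (intro eq_vecI) (auto simp: PK scalar_prod_def sum_distrib_left sum_distrib_right mult_ac)
  have v\<phi>: "v \<bullet> \<phi> = 1" using \<phi>v comm_scalar_prod[OF v \<phi>] by simp
  \<comment> \<open>A diagonal matrix commutes with the torus, hence with \<open>P K\<close>. Since
    \<open>P K\<close> is the rank one operator \<open>v \<phi>\<close>, both \<open>v\<close> and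
    \<open>\<phi>\<close> are eigenvectors, and the eigenvalue is the trace against
    \<open>P K\<close>, that is, the top coefficient \<open>b x K\<close>.\<close>
  have wt: "\<rho> (mat_diag n x) *\<^sub>v v = (\<Prod>c\<in>diagram lam. x (fst c)) \<cdot>\<^sub>v v"
    "transpose_mat (\<rho> (mat_diag n x)) *\<^sub>v \<phi> = (\<Prod>c\<in>diagram lam. x (fst c)) \<cdot>\<^sub>v \<phi>"
    if x: "\<forall>i<n. x i \<noteq> 0" for x
  proof -
    define X where "X = \<rho> (mat_diag n x)"
    have XG: "mat_diag n x \<in> carrier (GL n)" using x by (simp add: mat_diag_GL)
    have X: "X \<in> carrier_mat N N" using r(1)[OF XG] by (simp add: X_def)
    have "X * T t = T t * X" if "t \<noteq> 0" for t
      using r(2)[OF XG torus_simps(4)[OF that]] r(2)[OF torus_simps(4)[OF that] XG]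
        mat_diag_mult_commute[of n x "\<lambda>i. t ^ (n - i)"] by (simp add: X_def T_def torus_def)
    from graded_commute[OF g X this K] have comm: "X * P K = P K * X" .
    have Xv: "X *\<^sub>v v \<in> carrier_vec N" using mult_mat_vec_carrier[OF X v] .
    have "tr (X * P K) = \<phi> \<bullet> (X *\<^sub>v v)"
      using tr_lin[OF X G(1)] bilinear_expand[OF X v \<phi>] PK
      by (subst tr_lin[OF X G(1)], subst sum.swap, auto simp: bilinear_expand[OF X v \<phi>] PK mult_ac intro!: sum.cong)
    then have tr: "\<phi> \<bullet> (X *\<^sub>v v) = (\<Prod>c\<in>diagram lam. x (fst c))"
      using trP[OF x, of K] K by (simp add: X_def bK)
    have "X *\<^sub>v v = X *\<^sub>v (P K *\<^sub>v v)" using PKv[OF v] \<phi>v by simp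
    also have "\<dots> = P K *\<^sub>v (X *\<^sub>v v)"
      using assoc_mult_mat_vec[OF X G(1) v, of K] assoc_mult_mat_vec[OF G(1) X v, of K] comm by simp
    finally show "\<rho> (mat_diag n x) *\<^sub>v v = (\<Prod>c\<in>diagram lam. x (fst c)) \<cdot>\<^sub>v v"
      using PKv[OF Xv] tr by (simp add: X_def)
    have Xt: "transpose_mat X \<in> carrier_mat N N" "transpose_mat (P K) \<in> carrier_mat N N" using X G(1)[of K] by auto
    have "transpose_mat X * transpose_mat (P K) = transpose_mat (P K) * transpose_mat X"
      using comm transpose_mult[OF X G(1), of K] transpose_mult[OF G(1) X, of K] by simp
    then have "transpose_mat X *\<^sub>v (transpose_mat (P K) *\<^sub>v \<phi>) = transpose_mat (P K) *\<^sub>v (transpose_mat X *\<^sub>v \<phi>)"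
      using assoc_mult_mat_vec[OF Xt \<phi>] assoc_mult_mat_vec[OF Xt(2,1) \<phi>] by simp
    then have "transpose_mat X *\<^sub>v \<phi> = (v \<bullet> (transpose_mat X *\<^sub>v \<phi>)) \<cdot>\<^sub>v \<phi>"
      using PKt[OF \<phi>] v\<phi> PKt[OF mult_mat_vec_carrier[OF Xt(1) \<phi>]] by simp
    moreover have "v \<bullet> (transpose_mat X *\<^sub>v \<phi>) = \<phi> \<bullet> (X *\<^sub>v v)"
      using scalar_prod_mult_mat_vec[OF X v \<phi>] comm_scalar_prod[OF v mult_mat_vec_carrier[OF Xt(1) \<phi>]] by simp
    ultimately show "transpose_mat (\<rho> (mat_diag n x)) *\<^sub>v \<phi> = (\<Prod>c\<in>diagram lam. x (fst c)) \<cdot>\<^sub>v \<phi>"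
      using tr by (simp add: X_def)
  qed
  have chi: "(\<Prod>c\<in>diagram lam. b $$ (fst c, fst c)) = (\<Prod>c\<in>diagram lam. (\<lambda>i. b $$ (i, i)) (fst c))" for b :: "complex mat"
    by simp
  show ?thesis
  proof (rule that[of v \<phi>])
    show "v \<in> carrier_vec (fst R)" "\<phi> \<in> carrier_vec (fst R)" "\<phi> \<bullet> v = 1"
      using v \<phi> \<phi>v by (auto simp: N_def)
    fix b assume b: "b \<in> carrier (GL n)"
    then have bc: "b \<in> carrier_mat n n" by (simp add: GL_iff)
    {
      assume u: "upper_triangular b"
      have "\<rho> b *\<^sub>v v = \<rho> (mat_diag n (\<lambda>i. b $$ (i, i))) *\<^sub>v v"
        by (rule top_vector_triangular[OF reg r(1) r(2) g[unfolded T_def] K top v _ u b])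
          (use PKv[OF v] \<phi>v in auto)
      then show "snd R b *\<^sub>v v = (\<Prod>c\<in>diagram lam. b $$ (fst c, fst c)) \<cdot>\<^sub>v v"
        using wt(1)[of "\<lambda>i. b $$ (i, i)"] b upper_triangular_GL[OF u bc] by (simp add: \<rho>_def)
    next
      assume u: "upper_triangular (transpose_mat b)"
      have bt: "transpose_mat b \<in> carrier_mat n n" "transpose_mat b \<in> carrier (GL n)"
        using bc b by (auto simp: GL_iff det_transpose)
      have TG: "transpose_mat h \<in> carrier (GL n)" if "h \<in> carrier (GL n)" for h
        using that by (auto simp: GL_iff det_transpose)
      \<comment> \<open>Transposing both the argument and the value gives a homomorphism again. It
        turns forms into vectors and lower triangular matrices into upper triangular ones, so that
        \<open>top_vector_triangular\<close> applies to \<open>\<phi>\<close>.\<close>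
      define \<rho>' where "\<rho>' h = transpose_mat (\<rho> (transpose_mat h))" for h
      have diag_t: "transpose_mat (mat_diag n x) = mat_diag n x" for x :: "nat \<Rightarrow> complex"
        by (intro eq_matI) (auto simp: mat_diag_def)
      have "\<rho>' (transpose_mat b) *\<^sub>v \<phi> = \<rho>' (mat_diag n (\<lambda>i. transpose_mat b $$ (i, i))) *\<^sub>v \<phi>"
      proof (rule top_vector_triangular[of n N \<rho>' D "\<lambda>k. transpose_mat (P k)" K])
        show "regular n N \<rho>'"
          unfolding regular_def
        proof (intro allI impI)
          fix M :: "complex \<Rightarrow> complex mat" and i j
          assume M: "\<forall>t. M t \<in> carrier_mat n n" "\<forall>i<n. \<forall>j<n. polyfun (\<lambda>t. M t $$ (i, j))" and ij: "i < N" "j < N"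
          have "dim_row (M t) = n" "dim_col (M t) = n" for t using M(1)[rule_format, of t] by auto
          then have Mt: "\<And>i j. i < n \<Longrightarrow> j < n \<Longrightarrow> polyfun (\<lambda>t. transpose_mat (M t) $$ (i, j))"
            "\<And>t. transpose_mat (M t) \<in> carrier_mat n n" using M by auto
          have "\<exists>f. polyfun f \<and> (\<forall>t. transpose_mat (M t) \<in> carrier (GL n) \<longrightarrow> \<rho> (transpose_mat (M t)) $$ (j, i) = f t)"
            by (rule regularD[OF reg Mt(2,1) ij(2,1)]) auto
          then obtain f where f: "polyfun f" "\<And>t. transpose_mat (M t) \<in> carrier (GL n) \<Longrightarrow> \<rho> (transpose_mat (M t)) $$ (j, i) = f t"
            by blast
          have "\<rho>' (M t) $$ (i, j) = f t" if "M t \<in> carrier (GL n)" for t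
            using f(2)[OF TG[OF that]] r(1)[OF TG[OF that]] ij by (simp add: \<rho>'_def)
          then show "\<exists>f. polyfun f \<and> (\<forall>t. M t \<in> carrier (GL n) \<longrightarrow> \<rho>' (M t) $$ (i, j) = f t)"
            using f(1) by blast
        qed
        show "\<rho>' h \<in> carrier_mat N N" if "h \<in> carrier (GL n)" for h
          using r(1)[OF TG[OF that]] by (simp add: \<rho>'_def)
        show "\<rho>' (h * k) = \<rho>' h * \<rho>' k" if hk: "h \<in> carrier (GL n)" "k \<in> carrier (GL n)" for h k
        proof -
          have "transpose_mat (h * k) = transpose_mat k * transpose_mat h"
            using hk by (intro transpose_mult) (auto simp: GL_iff)
          then show ?thesis
            using r(2)[OF TG[OF hk(2)] TG[OF hk(1)]]
              transpose_mult[OF r(1)[OF TG[OF hk(2)]] r(1)[OF TG[OF hk(1)]]] by (simp add: \<rho>'_def)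
        qed
        show "graded N (\<lambda>t. \<rho>' (torus n t)) D (\<lambda>k. transpose_mat (P k))"
          using graded_transpose[OF g] by (simp add: \<rho>'_def T_def torus_def diag_t)
        show "transpose_mat (P K) *\<^sub>v \<phi> = \<phi>" using PKt[OF \<phi>] v\<phi> by simp
      qed (use K top \<phi> u bt in auto)
      moreover have "mat_diag n (\<lambda>i. transpose_mat b $$ (i, i)) = mat_diag n (\<lambda>i. b $$ (i, i))"
        using bc by (intro eq_matI) (auto simp: mat_diag_def)
      ultimately have "transpose_mat (\<rho> b) *\<^sub>v \<phi> = transpose_mat (\<rho> (mat_diag n (\<lambda>i. b $$ (i, i)))) *\<^sub>v \<phi>"
        by (simp add: \<rho>'_def diag_t)
      then show "transpose_mat (snd R b) *\<^sub>v \<phi> = (\<Prod>c\<in>diagram lam. b $$ (fst c, fst c)) \<cdot>\<^sub>v \<phi>"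
        using wt(2)[of "\<lambda>i. b $$ (i, i)"] bt upper_triangular_GL[OF u bt(1)] bc by (simp add: \<rho>_def)
    }
  next
    fix Q assume Q: "\<And>g. g \<in> carrier (GL n) \<Longrightarrow> (\<Sum>i<fst R. \<Sum>j<fst R. Q i j * snd R g $$ (i, j)) = 0"
    \<comment> \<open>\<open>P K\<close> is a coefficient of the curve \<open>T t\<close>, which
      lies in the group, so a linear relation on the group passes to
      \<open>P K = v \<phi>\<close>.\<close>
    have "(\<Sum>k\<le>D. t ^ k * (\<Sum>i<N. \<Sum>j<N. Q i j * P k $$ (i, j))) = (\<Sum>k\<le>D. t ^ k * 0)" if "t \<noteq> 0" for t
      using Q[OF torus_simps(4)[OF that]] lin[OF that, of Q] by (simp add: T_def N_def \<rho>_def)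
    then have "(\<Sum>i<N. \<Sum>j<N. Q i j * P K $$ (i, j)) = 0"
      by (rule coeffs_unique[OF _ K, where b = "\<lambda>_. 0" and a = "\<lambda>k. \<Sum>i<N. \<Sum>j<N. Q i j * P k $$ (i, j)"])
    then show "(\<Sum>i<fst R. \<Sum>j<fst R. Q i j * (v $ i * \<phi> $ j)) = 0"
      by (simp add: PK flip: N_def)
  qed
qed

text \<open>Let \<open>Z\<close> be invariant, with a nonzero \<open>z\<close> in \<open>Z\<close>
  and a nonzero form \<open>y\<close> vanishing on \<open>Z\<close>. Choose \<open>h\<close> with
  \<open>\<phi> \<bullet> (h z) \<noteq> 0\<close> and \<open>g\<close> with
  \<open>y \<bullet> (g v) \<noteq> 0\<close>. The functional that sends \<open>A\<close> to
  \<open>y \<bullet> (g A h z)\<close> vanishes on the group by invariance, hence at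
  \<open>v \<phi>\<close>, where its value is the product of these two numbers.\<close>

lemma irreducibleI:
  assumes G: "group G" and rep: "representation G R"
    and v: "v \<in> carrier_vec (fst R)" and \<phi>: "\<phi> \<in> carrier_vec (fst R)" and "fst R > 0"
    and left: "\<And>x. x \<in> carrier_vec (fst R) \<Longrightarrow> (\<And>g. g \<in> carrier G \<Longrightarrow> \<phi> \<bullet> (snd R g *\<^sub>v x) = 0) \<Longrightarrow> x = 0\<^sub>v (fst R)"
    and right: "\<And>x. x \<in> carrier_vec (fst R) \<Longrightarrow> (\<And>g. g \<in> carrier G \<Longrightarrow> x \<bullet> (snd R g *\<^sub>v v) = 0) \<Longrightarrow> x = 0\<^sub>v (fst R)"
    and rank1: "\<And>Q. (\<And>g. g \<in> carrier G \<Longrightarrow> (\<Sum>i<fst R. \<Sum>j<fst R. Q i j * snd R g $$ (i, j)) = 0) \<Longrightarrow>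
       (\<Sum>i<fst R. \<Sum>j<fst R. Q i j * (v $ i * \<phi> $ j)) = 0"
  shows "irreducible_rep G R"
proof -
  interpret group G by fact
  define N where "N = fst R"
  note r = repD[OF G rep, folded N_def]
  note [folded N_def, simp] = v \<phi>
  have main: "Z = {0\<^sub>v N} \<or> Z = carrier_vec N"
    if Z: "Z \<subseteq> carrier_vec N" "0\<^sub>v N \<in> Z" "\<And>x y. x \<in> Z \<Longrightarrow> y \<in> Z \<Longrightarrow> x + y \<in> Z"
      "\<And>a x. x \<in> Z \<Longrightarrow> a \<cdot>\<^sub>v x \<in> Z" and inv: "\<And>g z. g \<in> carrier G \<Longrightarrow> z \<in> Z \<Longrightarrow> snd R g *\<^sub>v z \<in> Z" for Z
  proof (rule ccontr)
    assume contra: "\<not> (Z = {0\<^sub>v N} \<or> Z = carrier_vec N)"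
    then obtain z where z: "z \<in> Z" "z \<noteq> 0\<^sub>v N" using Z(2) by blast
    obtain y where y: "y \<in> carrier_vec N" "y \<noteq> 0\<^sub>v N" "\<And>z. z \<in> Z \<Longrightarrow> z \<bullet> y = 0"
      using subspace_eq_carrier[OF Z] contra by blast
    have zc: "z \<in> carrier_vec N" using z Z by auto
    obtain h where h: "h \<in> carrier G" "\<phi> \<bullet> (snd R h *\<^sub>v z) \<noteq> 0" using left[folded N_def, OF zc] z(2) by blast
    obtain g where g: "g \<in> carrier G" "y \<bullet> (snd R g *\<^sub>v v) \<noteq> 0" using right[folded N_def, OF y(1)] y(2) by blast
    define x where "x = snd R h *\<^sub>v z"
    define w where "w = transpose_mat (snd R g) *\<^sub>v y"
    have xw: "x \<in> carrier_vec N" "w \<in> carrier_vec N"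
      using r(1)[OF h(1)] r(1)[OF g(1)] zc y(1) by (auto simp: x_def w_def intro!: mult_mat_vec_carrier[of _ N N])
    have wy: "w \<bullet> u = y \<bullet> (snd R g *\<^sub>v u)" if "u \<in> carrier_vec N" for u
      unfolding w_def by (rule scalar_prod_mult_mat_vec[OF r(1)[OF g(1)] that y(1), symmetric])
    have "(\<Sum>i<N. \<Sum>j<N. (w $ i * x $ j) * snd R k $$ (i, j)) = 0" if k: "k \<in> carrier G" for k
    proof -
      have kx: "snd R k *\<^sub>v x \<in> Z" using inv[OF k inv[OF h(1) z(1)]] by (simp add: x_def)
      then have "snd R g *\<^sub>v (snd R k *\<^sub>v x) \<in> Z" using inv[OF g(1)] by simp
      then have "y \<bullet> (snd R g *\<^sub>v (snd R k *\<^sub>v x)) = 0"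
        using y(1,3) Z(1) comm_scalar_prod[OF y(1)] by auto
      then have "w \<bullet> (snd R k *\<^sub>v x) = 0" using wy[of "snd R k *\<^sub>v x"] kx Z(1) by auto
      then show ?thesis by (simp add: bilinear_expand[OF r(1)[OF k] xw] mult_ac)
    qed
    from rank1[folded N_def, OF this] have "(\<Sum>i<N. \<Sum>j<N. (w $ i * x $ j) * (v $ i * \<phi> $ j)) = 0" .
    moreover have "(\<Sum>i<N. \<Sum>j<N. (w $ i * x $ j) * (v $ i * \<phi> $ j)) = (w \<bullet> v) * (\<phi> \<bullet> x)"
    proof -
      have "(\<Sum>i<N. \<Sum>j<N. (w $ i * x $ j) * (v $ i * \<phi> $ j)) = (\<Sum>i<N. w $ i * v $ i) * (\<Sum>j<N. \<phi> $ j * x $ j)"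
        unfolding sum_product by (intro sum.cong refl) (simp add: mult_ac)
      then show ?thesis
        unfolding scalar_prod_def atLeast0LessThan carrier_vecD[OF xw(1)] carrier_vecD[OF v[folded N_def]] .
    qed
    ultimately show False using h g wy[of v] by (simp add: x_def)
  qed
  show ?thesis
    unfolding irreducible_rep_def subspace_iff N_def[symmetric]
  proof (intro conjI allI impI rep)
    show "0 < N" using \<open>fst R > 0\<close> by (simp add: N_def)
    fix Z assume "(Z \<subseteq> carrier_vec N \<and> 0\<^sub>v N \<in> Z \<and> (\<forall>x\<in>Z. \<forall>y\<in>Z. x + y \<in> Z) \<and> (\<forall>a. \<forall>x\<in>Z. a \<cdot>\<^sub>v x \<in> Z)) \<and>
      (\<forall>g\<in>carrier G. \<forall>z\<in>Z. snd R g *\<^sub>v z \<in> Z)"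
    then show "Z = {0\<^sub>v N} \<or> Z = carrier_vec N" by (intro main) blast+
  qed
qed

section \<open>Tensor products\<close>

lemma sum_grid:
  fixes f :: "nat \<Rightarrow> nat \<Rightarrow> 'a :: comm_monoid_add"
  shows "(\<Sum>k<M * N. f (k div N) (k mod N)) = (\<Sum>i<M. \<Sum>j<N. f i j)"
proof -
  have "(\<Sum>k<M * N. f (k div N) (k mod N)) = (\<Sum>i<M. \<Sum>k\<in>{i * N..<i * N + N}. f (k div N) (k mod N))"
    by (simp add: sum.nat_group)
  also have "\<dots> = (\<Sum>i<M. \<Sum>j<N. f i j)"
  proof (rule sum.cong[OF refl])
    fix i assume "i \<in> {..<M}"
    have "(\<Sum>k\<in>{i * N..<i * N + N}. f (k div N) (k mod N)) = (\<Sum>j\<in>{0..<N}. f ((j + i * N) div N) ((j + i * N) mod N))"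
      using sum.shift_bounds_nat_ivl[of "\<lambda>k. f (k div N) (k mod N)" 0 "i * N" N] by (simp add: add.commute)
    then show "(\<Sum>k\<in>{i * N..<i * N + N}. f (k div N) (k mod N)) = (\<Sum>j<N. f i j)"
      by (simp add: atLeast0LessThan)
  qed
  finally show ?thesis .
qed

lemma sum_grid':
  fixes f :: "nat \<Rightarrow> 'a :: comm_monoid_add"
  shows "(\<Sum>k<M * N. f k) = (\<Sum>i<M. \<Sum>j<N. f (i * N + j))"
  using sum_grid[of "\<lambda>i j. f (i * N + j)" N M] by simp

lemma grid_less: "i < M \<Longrightarrow> j < N \<Longrightarrow> i * N + j < M * (N :: nat)"
proof -
  assume "i < M" "j < N"
  then have "i * N + j < Suc i * N" by simp
  also have "\<dots> \<le> M * N" using \<open>i < M\<close> by (intro mult_le_mono1) simp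
  finally show ?thesis .
qed

lemma grid_div_mod: "k < M * N \<Longrightarrow> k div N < (M :: nat)" "k < M * N \<Longrightarrow> k mod N < N"
  by (auto simp: less_mult_imp_div_less intro!: mod_less_divisor gr0I)

definition vtensor :: "complex vec \<Rightarrow> complex vec \<Rightarrow> complex vec" where
  "vtensor u w = vec (dim_vec u * dim_vec w) (\<lambda>k. u $ (k div dim_vec w) * w $ (k mod dim_vec w))"

lemma vtensor_carrier: "u \<in> carrier_vec M \<Longrightarrow> w \<in> carrier_vec N \<Longrightarrow> vtensor u w \<in> carrier_vec (M * N)"
  by (auto simp: vtensor_def)

lemma kron_carrier: "A \<in> carrier_mat M M \<Longrightarrow> B \<in> carrier_mat N N \<Longrightarrow> kron A B \<in> carrier_mat (M * N) (M * N)"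
  by (auto simp: kron_def)

lemma index_kron:
  assumes "A \<in> carrier_mat M M" "B \<in> carrier_mat N N" "k < M * N" "l < M * N"
  shows "kron A B $$ (k, l) = A $$ (k div N, l div N) * B $$ (k mod N, l mod N)"
  using assms by (auto simp: kron_def)

lemma kron_mult:
  assumes "A \<in> carrier_mat M M" "B \<in> carrier_mat N N" "C \<in> carrier_mat M M" "D \<in> carrier_mat N N"
  shows "kron A B * kron C D = kron (A * C) (B * D)"
proof (rule eq_matI)
  have AC: "A * C \<in> carrier_mat M M" "B * D \<in> carrier_mat N N" using assms by auto
  fix k l assume "k < dim_row (kron (A * C) (B * D))" "l < dim_col (kron (A * C) (B * D))"
  then have kl: "k < M * N" "l < M * N" using kron_carrier[OF AC] by auto
  note dm = grid_div_mod[OF kl(1)] grid_div_mod[OF kl(2)]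
  have "(kron A B * kron C D) $$ (k, l) = (\<Sum>q<M * N. kron A B $$ (k, q) * kron C D $$ (q, l))"
    using kl kron_carrier[OF assms(1,2)] kron_carrier[OF assms(3,4)] by (simp add: scalar_prod_def atLeast0LessThan)
  also have "\<dots> = (\<Sum>q<M * N. A $$ (k div N, q div N) * B $$ (k mod N, q mod N) * (C $$ (q div N, l div N) * D $$ (q mod N, l mod N)))"
    using kl by (intro sum.cong refl) (simp add: index_kron[OF assms(1,2)] index_kron[OF assms(3,4)])
  also have "\<dots> = (\<Sum>i<M. \<Sum>j<N. A $$ (k div N, i) * B $$ (k mod N, j) * (C $$ (i, l div N) * D $$ (j, l mod N)))"
    by (rule sum_grid)
  also have "\<dots> = (\<Sum>i<M. A $$ (k div N, i) * C $$ (i, l div N)) * (\<Sum>j<N. B $$ (k mod N, j) * D $$ (j, l mod N))"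
    by (simp add: sum_product mult_ac)
  also have "\<dots> = kron (A * C) (B * D) $$ (k, l)"
    using assms dm by (simp add: index_kron[OF AC kl] scalar_prod_def atLeast0LessThan)
  finally show "(kron A B * kron C D) $$ (k, l) = kron (A * C) (B * D) $$ (k, l)" .
qed (use assms in \<open>auto simp: kron_def\<close>)

lemma kron_one: "kron (1\<^sub>m M) (1\<^sub>m N) = 1\<^sub>m (M * N)"
proof (rule eq_matI)
  fix k l assume "k < dim_row (1\<^sub>m (M * N) :: complex mat)" "l < dim_col (1\<^sub>m (M * N) :: complex mat)"
  then have kl: "k < M * N" "l < M * N" by auto
  have "k = l" if "k div N = l div N" "k mod N = l mod N"
    using that by (metis div_mult_mod_eq)
  then show "kron (1\<^sub>m M) (1\<^sub>m N) $$ (k, l) = 1\<^sub>m (M * N) $$ (k, l)"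
    using kl grid_div_mod[OF kl(1)] grid_div_mod[OF kl(2)] by (auto simp: index_kron[of _ M _ N])
qed (auto simp: kron_def)

lemma transpose_kron:
  assumes "A \<in> carrier_mat M M" "B \<in> carrier_mat N N"
  shows "transpose_mat (kron A B) = kron (transpose_mat A) (transpose_mat B)"
proof (rule eq_matI)
  fix k l assume "k < dim_row (kron (transpose_mat A) (transpose_mat B))" "l < dim_col (kron (transpose_mat A) (transpose_mat B))"
  then have kl: "k < M * N" "l < M * N" using assms by (auto simp: kron_def)
  show "transpose_mat (kron A B) $$ (k, l) = kron (transpose_mat A) (transpose_mat B) $$ (k, l)"
    using assms kl grid_div_mod[OF kl(1)] grid_div_mod[OF kl(2)] kron_carrier[OF assms]
    by (simp add: index_kron[OF assms] index_kron[of "transpose_mat A" M "transpose_mat B" N])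
qed (use assms in \<open>auto simp: kron_def\<close>)

lemma kron_sum:
  assumes "A \<in> carrier_mat M M" "B \<in> carrier_mat N N"
  shows "(\<Sum>k<M * N. \<Sum>l<M * N. Q k l * kron A B $$ (k, l)) =
    (\<Sum>i<M. \<Sum>i'<M. \<Sum>j<N. \<Sum>j'<N. Q (i * N + j) (i' * N + j') * (A $$ (i, i') * B $$ (j, j')))"
proof -
  have "(\<Sum>k<M * N. \<Sum>l<M * N. Q k l * kron A B $$ (k, l)) =
     (\<Sum>i<M. \<Sum>j<N. \<Sum>i'<M. \<Sum>j'<N. Q (i * N + j) (i' * N + j') * kron A B $$ (i * N + j, i' * N + j'))"
    by (simp add: sum_grid')
  also have "\<dots> = (\<Sum>i<M. \<Sum>j<N. \<Sum>i'<M. \<Sum>j'<N. Q (i * N + j) (i' * N + j') * (A $$ (i, i') * B $$ (j, j')))"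
    by (intro sum.cong refl) (simp add: index_kron[OF assms] grid_less)
  also have "\<dots> = (\<Sum>i<M. \<Sum>i'<M. \<Sum>j<N. \<Sum>j'<N. Q (i * N + j) (i' * N + j') * (A $$ (i, i') * B $$ (j, j')))"
    by (intro sum.cong refl sum.swap)
  finally show ?thesis .
qed

lemma kron_mult_vtensor:
  assumes "A \<in> carrier_mat M M" "B \<in> carrier_mat N N" "u \<in> carrier_vec M" "w \<in> carrier_vec N"
  shows "kron A B *\<^sub>v vtensor u w = vtensor (A *\<^sub>v u) (B *\<^sub>v w)"
proof (rule eq_vecI)
  fix k assume "k < dim_vec (vtensor (A *\<^sub>v u) (B *\<^sub>v w))"
  then have k: "k < M * N" using assms by (simp add: vtensor_def)
  note dm = grid_div_mod[OF k]
  have "(kron A B *\<^sub>v vtensor u w) $ k = (\<Sum>l<M * N. kron A B $$ (k, l) * vtensor u w $ l)"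
    using k kron_carrier[OF assms(1,2)] carrier_vecD[OF vtensor_carrier[OF assms(3,4)]]
    by (simp add: scalar_prod_def atLeast0LessThan)
  also have "\<dots> = (\<Sum>l<M * N. A $$ (k div N, l div N) * B $$ (k mod N, l mod N) * (u $ (l div N) * w $ (l mod N)))"
    using k assms by (intro sum.cong refl) (simp add: index_kron[OF assms(1,2)] vtensor_def)
  also have "\<dots> = (\<Sum>i<M. \<Sum>j<N. A $$ (k div N, i) * B $$ (k mod N, j) * (u $ i * w $ j))"
    by (rule sum_grid)
  also have "\<dots> = (\<Sum>i<M. A $$ (k div N, i) * u $ i) * (\<Sum>j<N. B $$ (k mod N, j) * w $ j)"
    by (simp add: sum_product mult_ac)
  also have "\<dots> = vtensor (A *\<^sub>v u) (B *\<^sub>v w) $ k"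
    using assms dm k by (simp add: vtensor_def scalar_prod_def atLeast0LessThan)
  finally show "(kron A B *\<^sub>v vtensor u w) $ k = vtensor (A *\<^sub>v u) (B *\<^sub>v w) $ k" .
qed (use assms in \<open>auto simp: kron_def vtensor_def\<close>)

lemma scalar_prod_vtensor:
  assumes "\<alpha> \<in> carrier_vec M" "\<beta> \<in> carrier_vec N" "u \<in> carrier_vec M" "w \<in> carrier_vec N"
  shows "vtensor \<alpha> \<beta> \<bullet> vtensor u w = (\<alpha> \<bullet> u) * (\<beta> \<bullet> w)"
proof -
  have "vtensor \<alpha> \<beta> \<bullet> vtensor u w = (\<Sum>k<M * N. \<alpha> $ (k div N) * \<beta> $ (k mod N) * (u $ (k div N) * w $ (k mod N)))"
    using assms by (simp add: vtensor_def scalar_prod_def atLeast0LessThan)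
  also have "\<dots> = (\<Sum>i<M. \<Sum>j<N. \<alpha> $ i * \<beta> $ j * (u $ i * w $ j))" by (rule sum_grid)
  finally show ?thesis using assms by (simp add: scalar_prod_def atLeast0LessThan sum_product mult_ac)
qed

text \<open>Cut \<open>x\<close> into slices \<open>X i\<close> along the first factor. Pairing them
  with a translate of \<open>\<beta>\<close> gives a vector \<open>y g\<close> of the first factor
  that all translates of \<open>\<alpha>\<close> kill, so it is zero; hence each slice is killed by
  all translates of \<open>\<beta>\<close>.\<close>

lemma tensor_separates:
  assumes A: "\<And>h. h \<in> H \<Longrightarrow> A h \<in> carrier_mat M M" and B: "\<And>g. g \<in> G \<Longrightarrow> B g \<in> carrier_mat N N"
    and \<alpha>: "\<alpha> \<in> carrier_vec M" and \<beta>: "\<beta> \<in> carrier_vec N"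
    and sepA: "\<And>x. x \<in> carrier_vec M \<Longrightarrow> (\<And>h. h \<in> H \<Longrightarrow> \<alpha> \<bullet> (A h *\<^sub>v x) = 0) \<Longrightarrow> x = 0\<^sub>v M"
    and sepB: "\<And>x. x \<in> carrier_vec N \<Longrightarrow> (\<And>g. g \<in> G \<Longrightarrow> \<beta> \<bullet> (B g *\<^sub>v x) = 0) \<Longrightarrow> x = 0\<^sub>v N"
    and x: "x \<in> carrier_vec (M * N)"
    and zero: "\<And>g h. g \<in> G \<Longrightarrow> h \<in> H \<Longrightarrow> vtensor \<alpha> \<beta> \<bullet> (kron (A h) (B g) *\<^sub>v x) = 0"
  shows "x = 0\<^sub>v (M * N)"
proof -
  define X where "X i = vec N (\<lambda>j. x $ (i * N + j))" for i
  have X: "X i \<in> carrier_vec N" for i by (simp add: X_def)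
  define y where "y g = vec M (\<lambda>i. \<beta> \<bullet> (B g *\<^sub>v X i))" for g
  have y: "y g \<in> carrier_vec M" for g by (simp add: y_def)
  have "\<alpha> \<bullet> (A h *\<^sub>v y g) = 0" if gh: "g \<in> G" "h \<in> H" for g h
  proof -
    have "vtensor \<alpha> \<beta> \<bullet> (kron (A h) (B g) *\<^sub>v x) =
        (\<Sum>k<M * N. \<Sum>l<M * N. (vtensor \<alpha> \<beta> $ k * x $ l) * kron (A h) (B g) $$ (k, l))"
      by (simp add: bilinear_expand[OF kron_carrier[OF A B] x vtensor_carrier[OF \<alpha> \<beta>]] gh mult_ac)
    also have "\<dots> = (\<Sum>i<M. \<Sum>i'<M. \<Sum>j<N. \<Sum>j'<N. (\<alpha> $ i * \<beta> $ j * x $ (i' * N + j')) * (A h $$ (i, i') * B g $$ (j, j')))"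
      unfolding kron_sum[OF A[OF gh(2)] B[OF gh(1)]]
      using \<alpha> \<beta> by (intro sum.cong refl) (simp add: vtensor_def grid_less)
    also have "\<dots> = (\<Sum>i<M. \<Sum>i'<M. \<alpha> $ i * A h $$ (i, i') * (\<Sum>j<N. \<Sum>j'<N. \<beta> $ j * B g $$ (j, j') * x $ (i' * N + j')))"
      by (simp add: sum_distrib_left mult_ac)
    also have "\<dots> = \<alpha> \<bullet> (A h *\<^sub>v y g)"
      unfolding bilinear_expand[OF A[OF gh(2)] y \<alpha>]
      using bilinear_expand[OF B[OF gh(1)] X \<beta>] by (intro sum.cong refl) (simp add: y_def X_def)
    finally show ?thesis using zero[OF gh] by simp
  qed
  then have "y g = 0\<^sub>v M" if "g \<in> G" for g using sepA[OF y] that by blast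
  then have "\<beta> \<bullet> (B g *\<^sub>v X i) = 0" if "g \<in> G" "i < M" for g i
    using that by (metis index_vec index_zero_vec(1) y_def)
  then have X0: "X i = 0\<^sub>v N" if "i < M" for i using sepB[OF X] that by blast
  show ?thesis
  proof (rule eq_vecI)
    fix k assume "k < dim_vec (0\<^sub>v (M * N) :: complex vec)"
    then have k: "k < M * N" by simp
    have "X (k div N) $ (k mod N) = 0" using X0 grid_div_mod[OF k] by simp
    then show "x $ k = 0\<^sub>v (M * N) $ k" using k grid_div_mod[OF k] by (simp add: X_def)
  qed (use x in simp)
qed

text \<open>A relation on all Kronecker products is, for fixed \<open>h\<close>, a relation on the
  matrices \<open>B g\<close>, in which \<open>B g\<close> may be replaced by the rank one matrix
  \<open>u \<beta>\<close>. What is left is a relation on the \<open>A h\<close>, to which the same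
  applies.\<close>

lemma tensor_rank1:
  assumes A: "\<And>h. h \<in> H \<Longrightarrow> A h \<in> carrier_mat M M" and B: "\<And>g. g \<in> G \<Longrightarrow> B g \<in> carrier_mat N N"
    and rA: "\<And>Q. (\<And>h. h \<in> H \<Longrightarrow> (\<Sum>i<M. \<Sum>j<M. Q i j * A h $$ (i, j)) = 0) \<Longrightarrow>
       (\<Sum>i<M. \<Sum>j<M. Q i j * (v $ i * \<alpha> $ j)) = 0"
    and rB: "\<And>Q. (\<And>g. g \<in> G \<Longrightarrow> (\<Sum>i<N. \<Sum>j<N. Q i j * B g $$ (i, j)) = 0) \<Longrightarrow>
       (\<Sum>i<N. \<Sum>j<N. Q i j * (u $ i * \<beta> $ j)) = 0"
    and c: "v \<in> carrier_vec M" "\<alpha> \<in> carrier_vec M" "u \<in> carrier_vec N" "\<beta> \<in> carrier_vec N"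
    and zero: "\<And>g h. g \<in> G \<Longrightarrow> h \<in> H \<Longrightarrow> (\<Sum>k<M * N. \<Sum>l<M * N. Q k l * kron (A h) (B g) $$ (k, l)) = 0"
  shows "(\<Sum>k<M * N. \<Sum>l<M * N. Q k l * (vtensor v u $ k * vtensor \<alpha> \<beta> $ l)) = 0"
proof -
  have swap: "(\<Sum>i<M. \<Sum>i'<M. \<Sum>j<N. \<Sum>j'<N. F i i' j j') = (\<Sum>j<N. \<Sum>j'<N. \<Sum>i<M. \<Sum>i'<M. F i i' j j')"
    for F :: "nat \<Rightarrow> nat \<Rightarrow> nat \<Rightarrow> nat \<Rightarrow> complex"
  proof -
    have "(\<Sum>i<M. \<Sum>i'<M. \<Sum>j<N. \<Sum>j'<N. F i i' j j') = (\<Sum>i<M. \<Sum>j<N. \<Sum>i'<M. \<Sum>j'<N. F i i' j j')"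
      by (intro sum.cong refl sum.swap)
    also have "\<dots> = (\<Sum>j<N. \<Sum>i<M. \<Sum>i'<M. \<Sum>j'<N. F i i' j j')" by (rule sum.swap)
    also have "\<dots> = (\<Sum>j<N. \<Sum>i<M. \<Sum>j'<N. \<Sum>i'<M. F i i' j j')" by (intro sum.cong refl sum.swap)
    also have "\<dots> = (\<Sum>j<N. \<Sum>j'<N. \<Sum>i<M. \<Sum>i'<M. F i i' j j')" by (intro sum.cong refl sum.swap)
    finally show ?thesis .
  qed
  define q where "q i i' j j' = Q (i * N + j) (i' * N + j')" for i i' j j'
  have "(\<Sum>i<M. \<Sum>i'<M. (\<Sum>j<N. \<Sum>j'<N. q i i' j j' * (u $ j * \<beta> $ j')) * A h $$ (i, i')) = 0" if h: "h \<in> H" for h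
  proof -
    have "(\<Sum>j<N. \<Sum>j'<N. (\<Sum>i<M. \<Sum>i'<M. q i i' j j' * A h $$ (i, i')) * B g $$ (j, j')) = 0" if g: "g \<in> G" for g
      using zero[OF g h] unfolding kron_sum[OF A[OF h] B[OF g]] swap
      by (simp add: q_def sum_distrib_right mult.assoc)
    from rB[OF this] show ?thesis
      using swap[of "\<lambda>i i' j j'. q i i' j j' * A h $$ (i, i') * (u $ j * \<beta> $ j')"]
      by (simp add: sum_distrib_left sum_distrib_right mult_ac)
  qed
  from rA[OF this] have *: "(\<Sum>i<M. \<Sum>i'<M. (\<Sum>j<N. \<Sum>j'<N. q i i' j j' * (u $ j * \<beta> $ j')) * (v $ i * \<alpha> $ i')) = 0" .
  have "(\<Sum>k<M * N. \<Sum>l<M * N. Q k l * (vtensor v u $ k * vtensor \<alpha> \<beta> $ l)) =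
      (\<Sum>i<M. \<Sum>j<N. \<Sum>i'<M. \<Sum>j'<N. q i i' j j' * (v $ i * u $ j * (\<alpha> $ i' * \<beta> $ j')))"
    using c by (simp add: sum_grid' q_def vtensor_def grid_less)
  also have "\<dots> = (\<Sum>i<M. \<Sum>i'<M. \<Sum>j<N. \<Sum>j'<N. q i i' j j' * (v $ i * u $ j * (\<alpha> $ i' * \<beta> $ j')))"
    by (intro sum.cong refl sum.swap)
  also have "\<dots> = (\<Sum>i<M. \<Sum>i'<M. (\<Sum>j<N. \<Sum>j'<N. q i i' j j' * (u $ j * \<beta> $ j')) * (v $ i * \<alpha> $ i'))"
    by (simp add: sum_distrib_left sum_distrib_right mult_ac)
  finally show ?thesis using * by simp
qed

section \<open>Tensor products as representations of the product group\<close>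

lemma group_GL_prod: "group (GL m \<times>\<times> GL n)"
  by (intro DirProd_group group_GL)

lemma GL_prod_simps:
  "carrier (GL m \<times>\<times> GL n) = carrier (GL m) \<times> carrier (GL n)"
  "(g, h) \<otimes>\<^bsub>GL m \<times>\<times> GL n\<^esub> (g', h') = (g * g', h * h')" "\<one>\<^bsub>GL m \<times>\<times> GL n\<^esub> = (1\<^sub>m m, 1\<^sub>m n)"
  by (simp_all add: GL_simps)

lemma representation_tensor:
  assumes V: "representation (GL n) V" and U: "representation (GL m) U"
  shows "representation (GL m \<times>\<times> GL n) (tensor_rep (pullback snd V) (pullback fst U))"
proof (rule representationI[OF group_GL_prod])
  note rV = repD[OF group_GL V, unfolded GL_simps(2,3)] and rU = repD[OF group_GL U, unfolded GL_simps(2,3)]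
  let ?R = "tensor_rep (pullback snd V) (pullback fst U)"
  fix g assume g: "g \<in> carrier (GL m \<times>\<times> GL n)"
  then show "snd ?R g \<in> carrier_mat (fst ?R) (fst ?R)"
    using rV(1) rU(1) by (auto simp: tensor_rep_def pullback_def GL_prod_simps(1) intro!: kron_carrier)
  fix h assume h: "h \<in> carrier (GL m \<times>\<times> GL n)"
  show "snd ?R (g \<otimes>\<^bsub>GL m \<times>\<times> GL n\<^esub> h) = snd ?R g * snd ?R h"
    using g h rV rU by (cases g, cases h)
      (simp add: tensor_rep_def pullback_def GL_prod_simps(1) GL_simps(2) kron_mult[of _ "fst V" _ "fst U"])
next
  note rV = repD[OF group_GL V, unfolded GL_simps(2,3)] and rU = repD[OF group_GL U, unfolded GL_simps(2,3)]
  let ?R = "tensor_rep (pullback snd V) (pullback fst U)"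
  show "snd ?R \<one>\<^bsub>GL m \<times>\<times> GL n\<^esub> = 1\<^sub>m (fst ?R)"
    by (simp add: tensor_rep_def pullback_def GL_prod_simps(1) GL_simps(3) rV(3) rU(3) kron_one)
qed

lemma separates_transpose:
  fixes A :: "'g \<Rightarrow> complex mat"
  assumes A: "\<And>g. g \<in> G \<Longrightarrow> A g \<in> carrier_mat N N" and v: "v \<in> carrier_vec N"
    and sep: "\<And>x. x \<in> carrier_vec N \<Longrightarrow> (\<And>g. g \<in> G \<Longrightarrow> x \<bullet> (A g *\<^sub>v v) = 0) \<Longrightarrow> x = 0\<^sub>v N"
    and x: "x \<in> carrier_vec N" "\<And>g. g \<in> G \<Longrightarrow> v \<bullet> (transpose_mat (A g) *\<^sub>v x) = 0"
  shows "x = 0\<^sub>v N"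
proof (rule sep[OF x(1)])
  fix g assume g: "g \<in> G"
  have "x \<bullet> (A g *\<^sub>v v) = (transpose_mat (A g) *\<^sub>v x) \<bullet> v"
    by (rule scalar_prod_mult_mat_vec[OF A[OF g] v x(1)])
  also have "\<dots> = v \<bullet> (transpose_mat (A g) *\<^sub>v x)"
    using A[OF g] v x(1) by (intro comm_scalar_prod[of _ N] mult_mat_vec_carrier[of _ N N]) auto
  finally show "x \<bullet> (A g *\<^sub>v v) = 0" using x(2)[OF g] by simp
qed

text \<open>In the second claim the coefficient \<open>c\<close> stays abstract: its values on
  products of triangular matrices and its polynomial dependence along curves determine it through
  \<open>big_cell_zero\<close>. The index set \<open>{lam}\<close> lets the summands be glued along
  the set of partitions.\<close>

lemma tensor_highest_weight:
  assumes V: "is_W n mu V" and mu: "mu \<turnstile> d" "length mu \<le> n"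
    and U: "is_W m lam U" and lam: "lam \<turnstile> d'" "length lam \<le> m"
  defines "L \<equiv> tensor_rep (pullback snd V) (pullback fst U)"
    and "chi1 \<equiv> \<lambda>b. \<Prod>c\<in>diagram lam. b $$ (fst c, fst c)" and "chi2 \<equiv> \<lambda>b. \<Prod>c\<in>diagram mu. b $$ (fst c, fst c)"
  shows "irreducible_rep (GL m \<times>\<times> GL n) L"
    and "\<exists>v \<phi> c. framed (GL m \<times>\<times> GL n) L {lam} v \<phi> (\<lambda>_. c) \<and>
      (\<forall>l u l' u'. l \<in> carrier (GL m) \<longrightarrow> u \<in> carrier (GL m) \<longrightarrow> l' \<in> carrier (GL n) \<longrightarrow> u' \<in> carrier (GL n) \<longrightarrow>
         upper_triangular (transpose_mat l) \<longrightarrow> upper_triangular u \<longrightarrow>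
         upper_triangular (transpose_mat l') \<longrightarrow> upper_triangular u' \<longrightarrow>
         c (l * u, l' * u') = chi1 l * chi1 u * (chi2 l' * chi2 u')) \<and>
      (\<forall>g h. (\<forall>t. g t \<in> carrier_mat m m) \<longrightarrow> (\<forall>t. h t \<in> carrier_mat n n) \<longrightarrow>
         (\<forall>i<m. \<forall>j<m. polyfun (\<lambda>t. g t $$ (i, j))) \<longrightarrow> (\<forall>i<n. \<forall>j<n. polyfun (\<lambda>t. h t $$ (i, j))) \<longrightarrow>
         (\<exists>f. polyfun f \<and> (\<forall>t. g t \<in> carrier (GL m) \<longrightarrow> h t \<in> carrier (GL n) \<longrightarrow> c (g t, h t) = f t)))"
    (is "\<exists>v \<phi> c. ?C v \<phi> c")
proof -
  define M where "M = fst V"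
  define N where "N = fst U"
  have polyV: "polynomial_rep n V" and irrV: "irreducible_rep (GL n) V" and repV: "representation (GL n) V"
    using V mu(2) by (auto simp: is_W_def irreducible_rep_def)
  have polyU: "polynomial_rep m U" and irrU: "irreducible_rep (GL m) U" and repU: "representation (GL m) U"
    using U lam(2) by (auto simp: is_W_def irreducible_rep_def)
  obtain v \<alpha> where v: "v \<in> carrier_vec M" and \<alpha>: "\<alpha> \<in> carrier_vec M" and \<alpha>v: "\<alpha> \<bullet> v = 1"
    and Vu: "\<And>b. b \<in> carrier (GL n) \<Longrightarrow> upper_triangular b \<Longrightarrow> snd V b *\<^sub>v v = chi2 b \<cdot>\<^sub>v v"
    and Vl: "\<And>b. b \<in> carrier (GL n) \<Longrightarrow> upper_triangular (transpose_mat b) \<Longrightarrow> transpose_mat (snd V b) *\<^sub>v \<alpha> = chi2 b \<cdot>\<^sub>v \<alpha>"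
    and Vr: "\<And>Q. (\<And>g. g \<in> carrier (GL n) \<Longrightarrow> (\<Sum>i<M. \<Sum>j<M. Q i j * snd V g $$ (i, j)) = 0) \<Longrightarrow>
       (\<Sum>i<M. \<Sum>j<M. Q i j * (v $ i * \<alpha> $ j)) = 0"
    by (rule highest_weight[OF V mu, folded M_def]) (simp only: chi2_def)
  obtain u \<beta> where u: "u \<in> carrier_vec N" and \<beta>: "\<beta> \<in> carrier_vec N" and \<beta>u: "\<beta> \<bullet> u = 1"
    and Uu: "\<And>b. b \<in> carrier (GL m) \<Longrightarrow> upper_triangular b \<Longrightarrow> snd U b *\<^sub>v u = chi1 b \<cdot>\<^sub>v u"
    and Ul: "\<And>b. b \<in> carrier (GL m) \<Longrightarrow> upper_triangular (transpose_mat b) \<Longrightarrow> transpose_mat (snd U b) *\<^sub>v \<beta> = chi1 b \<cdot>\<^sub>v \<beta>"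
    and Ur: "\<And>Q. (\<And>g. g \<in> carrier (GL m) \<Longrightarrow> (\<Sum>i<N. \<Sum>j<N. Q i j * snd U g $$ (i, j)) = 0) \<Longrightarrow>
       (\<Sum>i<N. \<Sum>j<N. Q i j * (u $ i * \<beta> $ j)) = 0"
    by (rule highest_weight[OF U lam, folded N_def]) (simp only: chi1_def)
  note rV = repD[OF group_GL repV, folded M_def, unfolded GL_simps(2,3)]
  note rU = repD[OF group_GL repU, folded N_def, unfolded GL_simps(2,3)]
  have nz: "v \<noteq> 0\<^sub>v M" "\<alpha> \<noteq> 0\<^sub>v M" "u \<noteq> 0\<^sub>v N" "\<beta> \<noteq> 0\<^sub>v N"
    using \<alpha>v \<beta>u v \<alpha> u \<beta> by auto
  note sV = irreducible_separates[OF group_GL irrV, folded M_def] and sU = irreducible_separates[OF group_GL irrU, folded N_def]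
  let ?G = "GL m \<times>\<times> GL n"
  have repL: "representation ?G L" unfolding L_def by (rule representation_tensor[OF repV repU])
  have L: "fst L = M * N" "\<And>g. snd L g = kron (snd V (snd g)) (snd U (fst g))"
    by (simp_all add: L_def tensor_rep_def pullback_def M_def N_def)
  define w where "w = vtensor v u"
  define \<theta> where "\<theta> = vtensor \<alpha> \<beta>"
  have wc: "w \<in> carrier_vec (fst L)" "\<theta> \<in> carrier_vec (fst L)"
    using vtensor_carrier v u \<alpha> \<beta> by (auto simp: L w_def \<theta>_def)
  have left: "x = 0\<^sub>v (fst L)" if x: "x \<in> carrier_vec (fst L)" and z: "\<And>g. g \<in> carrier ?G \<Longrightarrow> \<theta> \<bullet> (snd L g *\<^sub>v x) = 0" for x
    unfolding L
  proof (rule tensor_separates[of "carrier (GL n)" "snd V" M "carrier (GL m)" "snd U" N \<alpha> \<beta>])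
    show "vtensor \<alpha> \<beta> \<bullet> (kron (snd V h) (snd U g) *\<^sub>v x) = 0" if "g \<in> carrier (GL m)" "h \<in> carrier (GL n)" for g h
      using z[of "(g, h)"] that by (simp add: L GL_prod_simps(1) \<theta>_def)
  qed (use rV(1) rU(1) \<alpha> \<beta> sV(1)[OF \<alpha> nz(2)] sU(1)[OF \<beta> nz(4)] x in \<open>simp_all add: L\<close>)
  have Lc: "snd L g \<in> carrier_mat (M * N) (M * N)" if "g \<in> carrier ?G" for g
    using repD(1)[OF group_GL_prod repL that] by (simp add: L)
  \<comment> \<open>Transposed matrices exchange the roles of vectors and forms, so
    \<open>tensor_separates\<close> applies with \<open>v\<close> and \<open>u\<close> in place of
    \<open>\<alpha>\<close> and \<open>\<beta>\<close>.\<close>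
  have right: "x = 0\<^sub>v (fst L)" if x: "x \<in> carrier_vec (fst L)" and z: "\<And>g. g \<in> carrier ?G \<Longrightarrow> x \<bullet> (snd L g *\<^sub>v w) = 0" for x
    unfolding L
  proof (rule tensor_separates[of "carrier (GL n)" "\<lambda>h. transpose_mat (snd V h)" M "carrier (GL m)" "\<lambda>g. transpose_mat (snd U g)" N v u])
    show "y = 0\<^sub>v M" if "y \<in> carrier_vec M" "\<And>h. h \<in> carrier (GL n) \<Longrightarrow> v \<bullet> (transpose_mat (snd V h) *\<^sub>v y) = 0" for y
      by (rule separates_transpose[OF rV(1) v sV(2)[OF v nz(1)] that]) auto
    show "y = 0\<^sub>v N" if "y \<in> carrier_vec N" "\<And>h. h \<in> carrier (GL m) \<Longrightarrow> u \<bullet> (transpose_mat (snd U h) *\<^sub>v y) = 0" for y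
      by (rule separates_transpose[OF rU(1) u sU(2)[OF u nz(3)] that]) auto
    show "vtensor v u \<bullet> (kron (transpose_mat (snd V h)) (transpose_mat (snd U g)) *\<^sub>v x) = 0"
      if gh: "g \<in> carrier (GL m)" "h \<in> carrier (GL n)" for g h
    proof -
      have g: "(g, h) \<in> carrier ?G" using gh by (simp add: GL_prod_simps(1))
      have "0 = (transpose_mat (snd L (g, h)) *\<^sub>v x) \<bullet> w"
        using z[OF g] scalar_prod_mult_mat_vec[OF Lc[OF g], of w x] x wc by (simp add: L(1))
      also have "\<dots> = w \<bullet> (transpose_mat (snd L (g, h)) *\<^sub>v x)"
        using Lc[OF g] x wc by (intro comm_scalar_prod[of _ "M * N"] mult_mat_vec_carrier[of _ "M * N" "M * N"]) (auto simp: L(1))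
      finally show ?thesis
        by (simp add: L w_def transpose_kron[OF rV(1)[OF gh(2)] rU(1)[OF gh(1)]])
    qed
  qed (use rV(1) rU(1) v u x in \<open>simp_all add: L\<close>)
  show "irreducible_rep ?G L"
  proof (rule irreducibleI[OF group_GL_prod repL wc _ left right])
    show "fst L > 0" using \<alpha>v \<beta>u \<alpha> \<beta> v u by (cases M; cases N) (auto simp: L scalar_prod_def)
    show "(\<Sum>i<fst L. \<Sum>j<fst L. Q i j * (w $ i * \<theta> $ j)) = 0"
      if Q0: "\<And>g. g \<in> carrier ?G \<Longrightarrow> (\<Sum>i<fst L. \<Sum>j<fst L. Q i j * snd L g $$ (i, j)) = 0" for Q
      unfolding L w_def \<theta>_def
    proof (rule tensor_rank1[OF rV(1) rU(1) Vr Ur v \<alpha> u \<beta>])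
      show "(\<Sum>k<M * N. \<Sum>l<M * N. Q k l * kron (snd V h) (snd U g) $$ (k, l)) = 0"
        if "g \<in> carrier (GL m)" "h \<in> carrier (GL n)" for g h
        using Q0[of "(g, h)"] that by (simp add: L GL_prod_simps(1))
    qed
  qed
  define c where "c = (\<lambda>(g, h). (\<alpha> \<bullet> (snd V h *\<^sub>v v)) * (\<beta> \<bullet> (snd U g *\<^sub>v u)))"
  have coeff: "\<theta> \<bullet> (snd L g *\<^sub>v w) = c g" if "g \<in> carrier ?G" for g
  proof -
    obtain g1 g2 where g: "g = (g1, g2)" "g1 \<in> carrier (GL m)" "g2 \<in> carrier (GL n)"
      using \<open>g \<in> carrier ?G\<close> by (auto simp: GL_prod_simps(1))
    show ?thesis
      using scalar_prod_vtensor[OF \<alpha> \<beta>, of "snd V g2 *\<^sub>v v" "snd U g1 *\<^sub>v u"]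
        mult_mat_vec_carrier[OF rV(1)[OF g(3)] v] mult_mat_vec_carrier[OF rU(1)[OF g(2)] u]
      by (simp add: L g(1) w_def \<theta>_def c_def kron_mult_vtensor[OF rV(1)[OF g(3)] rU(1)[OF g(2)] v u])
  qed
  have "framed ?G L {lam} (\<lambda>_. w) (\<lambda>_. \<theta>) (\<lambda>_. c)"
    unfolding framed_def using repL wc left right coeff by auto
  moreover have "c (l * u1, l' * u1') = chi1 l * chi1 u1 * (chi2 l' * chi2 u1')"
    if G: "l \<in> carrier (GL m)" "u1 \<in> carrier (GL m)" "l' \<in> carrier (GL n)" "u1' \<in> carrier (GL n)"
      and tri: "upper_triangular (transpose_mat l)" "upper_triangular u1"
        "upper_triangular (transpose_mat l')" "upper_triangular u1'" for l u1 l' u1'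
  proof -
    have "\<alpha> \<bullet> (snd V (l' * u1') *\<^sub>v v) = \<alpha> \<bullet> (snd V l' *\<^sub>v (snd V u1' *\<^sub>v v))"
      using G rV(1) v by (simp add: rV(2) assoc_mult_mat_vec[of _ M M _ M])
    also have "\<dots> = (transpose_mat (snd V l') *\<^sub>v \<alpha>) \<bullet> (snd V u1' *\<^sub>v v)"
      using rV(1)[OF G(4)] v by (intro scalar_prod_mult_mat_vec[OF rV(1)[OF G(3)] _ \<alpha>]) auto
    also have "\<dots> = chi2 l' * chi2 u1'" using Vu[OF G(4) tri(4)] Vl[OF G(3) tri(3)] \<alpha> v \<alpha>v by simp
    finally have 1: "\<alpha> \<bullet> (snd V (l' * u1') *\<^sub>v v) = chi2 l' * chi2 u1'" .
    have "\<beta> \<bullet> (snd U (l * u1) *\<^sub>v u) = \<beta> \<bullet> (snd U l *\<^sub>v (snd U u1 *\<^sub>v u))"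
      using G rU(1) u by (simp add: rU(2) assoc_mult_mat_vec[of _ N N _ N])
    also have "\<dots> = (transpose_mat (snd U l) *\<^sub>v \<beta>) \<bullet> (snd U u1 *\<^sub>v u)"
      using rU(1)[OF G(2)] u by (intro scalar_prod_mult_mat_vec[OF rU(1)[OF G(1)] _ \<beta>]) auto
    also have "\<dots> = chi1 l * chi1 u1" using Uu[OF G(2) tri(2)] Ul[OF G(1) tri(1)] \<beta> u \<beta>u by simp
    finally show ?thesis using 1 by (simp add: c_def)
  qed
  moreover have "\<exists>f. polyfun f \<and> (\<forall>t. g t \<in> carrier (GL m) \<longrightarrow> h t \<in> carrier (GL n) \<longrightarrow> c (g t, h t) = f t)"
    if gh: "\<forall>t. g t \<in> carrier_mat m m" "\<forall>t. h t \<in> carrier_mat n n"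
      "\<forall>i<m. \<forall>j<m. polyfun (\<lambda>t. g t $$ (i, j))" "\<forall>i<n. \<forall>j<n. polyfun (\<lambda>t. h t $$ (i, j))" for g h
  proof -
    have "\<exists>f. polyfun f \<and> (\<forall>t. h t \<in> carrier (GL n) \<longrightarrow> \<alpha> \<bullet> (snd V (h t) *\<^sub>v v) = f t)"
      by (rule regular_bilinear[OF polynomial_rep_regular[OF polyV, folded M_def] rV(1) _ _ v \<alpha>, of h]) (use gh in auto)
    then obtain f1 where f1: "polyfun f1" "\<And>t. h t \<in> carrier (GL n) \<Longrightarrow> \<alpha> \<bullet> (snd V (h t) *\<^sub>v v) = f1 t" by blast
    have "\<exists>f. polyfun f \<and> (\<forall>t. g t \<in> carrier (GL m) \<longrightarrow> \<beta> \<bullet> (snd U (g t) *\<^sub>v u) = f t)"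
      by (rule regular_bilinear[OF polynomial_rep_regular[OF polyU, folded N_def] rU(1) _ _ u \<beta>, of g]) (use gh in auto)
    then obtain f2 where f2: "polyfun f2" "\<And>t. g t \<in> carrier (GL m) \<Longrightarrow> \<beta> \<bullet> (snd U (g t) *\<^sub>v u) = f2 t" by blast
    show ?thesis
      using f1 f2 by (intro exI[of _ "\<lambda>t. f1 t * f2 t"]) (auto simp: c_def intro: polyfun_mult)
  qed
  ultimately show "\<exists>v \<phi> c. ?C v \<phi> c"
    by blast
qed

section \<open>Direct sums\<close>

lemma framed_cong:
  assumes "group G" and "fst R = fst S" "\<And>g. g \<in> carrier G \<Longrightarrow> snd R g = snd S g"
  shows "framed G R I v \<phi> c \<longleftrightarrow> framed G S I v \<phi> c"
proof -
  interpret group G by fact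
  have "representation G R \<longleftrightarrow> representation G S"
    using assms(2,3) unfolding representation_def hom_def Pi_def by auto
  then show ?thesis using assms unfolding framed_def by simp
qed

text \<open>How the zero summands enter: in dimension 0 the empty family separates.\<close>

lemma framed_zero: "representation G R \<Longrightarrow> fst R = 0 \<Longrightarrow> framed G R {} v \<phi> c"
  by (auto simp: framed_def intro!: eq_vecI)

lemma block_mult_append:
  assumes "A \<in> carrier_mat M M" "B \<in> carrier_mat N N" "x \<in> carrier_vec M" "y \<in> carrier_vec N"
  shows "four_block_mat A (0\<^sub>m M N) (0\<^sub>m N M) B *\<^sub>v (x @\<^sub>v y) = (A *\<^sub>v x) @\<^sub>v (B *\<^sub>v (y :: complex vec))"
  using assms by (subst four_block_mat_mult_vec[OF assms(1) _ _ assms(2) assms(3,4)])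
    (auto simp: zero_mat_mult_vec)

text \<open>Vectors and forms from different blocks pair to 0, which is the value that
  \<open>framed\<close> demands for distinct indices.\<close>

lemma framed_direct_sum:
  assumes G: "group G" and F1: "framed G R I v \<phi> c" and F2: "framed G S J w \<theta> c" and IJ: "I \<inter> J = {}"
  shows "framed G (fst R + fst S, \<lambda>g. four_block_mat (snd R g) (0\<^sub>m (fst R) (fst S)) (0\<^sub>m (fst S) (fst R)) (snd S g))
     (I \<union> J) (\<lambda>i. if i \<in> I then v i @\<^sub>v 0\<^sub>v (fst S) else 0\<^sub>v (fst R) @\<^sub>v w i)
     (\<lambda>i. if i \<in> I then \<phi> i @\<^sub>v 0\<^sub>v (fst S) else 0\<^sub>v (fst R) @\<^sub>v \<theta> i) c"
proof -
  interpret group G by fact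
  define M where "M = fst R"
  define N where "N = fst S"
  note D = framedD[OF F1, folded M_def] and r = repD[OF G framedD(1)[OF F1], folded M_def]
  note D' = framedD[OF F2, folded N_def] and r' = repD[OF G framedD(1)[OF F2], folded N_def]
  define B where "B g = four_block_mat (snd R g) (0\<^sub>m M N) (0\<^sub>m N M) (snd S g)" for g
  define v' where "v' i = (if i \<in> I then v i @\<^sub>v 0\<^sub>v N else 0\<^sub>v M @\<^sub>v w i)" for i
  define \<phi>' where "\<phi>' i = (if i \<in> I then \<phi> i @\<^sub>v 0\<^sub>v N else 0\<^sub>v M @\<^sub>v \<theta> i)" for i
  have Bm: "B g *\<^sub>v (x @\<^sub>v y) = (snd R g *\<^sub>v x) @\<^sub>v (snd S g *\<^sub>v y)"
    if "g \<in> carrier G" "x \<in> carrier_vec M" "y \<in> carrier_vec N" for g x y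
    unfolding B_def by (rule block_mult_append[OF r(1)[OF that(1)] r'(1)[OF that(1)] that(2,3)])
  have Rc: "snd R g *\<^sub>v x \<in> carrier_vec M" if "g \<in> carrier G" "x \<in> carrier_vec M" for g x
    using mult_mat_vec_carrier[OF r(1)[OF that(1)] that(2)] .
  have Sc: "snd S g *\<^sub>v x \<in> carrier_vec N" if "g \<in> carrier G" "x \<in> carrier_vec N" for g x
    using mult_mat_vec_carrier[OF r'(1)[OF that(1)] that(2)] .
  have split: "\<exists>a b. a \<in> carrier_vec M \<and> b \<in> carrier_vec N \<and> x = a @\<^sub>v b"
    if "x \<in> carrier_vec (M + N)" for x :: "complex vec"
    using that vec_first_carrier vec_last_carrier vec_first_last_append by metis
  have rep: "representation G (M + N, B)"
  proof (rule representationI[OF G])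
    fix g h assume gh: "g \<in> carrier G" "h \<in> carrier G"
    show "snd (M + N, B) g \<in> carrier_mat (fst (M + N, B)) (fst (M + N, B))"
      using r(1)[OF gh(1)] r'(1)[OF gh(1)] by (auto simp: B_def)
    show "snd (M + N, B) (g \<otimes>\<^bsub>G\<^esub> h) = snd (M + N, B) g * snd (M + N, B) h"
      using mult_four_block_mat[OF r(1)[OF gh(1)] _ _ r'(1)[OF gh(1)] r(1)[OF gh(2)] _ _ r'(1)[OF gh(2)], of "0\<^sub>m M N" "0\<^sub>m N M" "0\<^sub>m M N" "0\<^sub>m N M"]
        r(1)[OF gh(1)] r'(1)[OF gh(1)] r(1)[OF gh(2)] r'(1)[OF gh(2)]
      by (simp add: B_def r(2)[OF gh] r'(2)[OF gh])
  next
    show "snd (M + N, B) \<one>\<^bsub>G\<^esub> = 1\<^sub>m (fst (M + N, B))"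
      by (simp add: B_def r(3) r'(3))
  qed
  have vI: "v' i = v i @\<^sub>v 0\<^sub>v N" "\<phi>' i = \<phi> i @\<^sub>v 0\<^sub>v N" if "i \<in> I" for i using that by (auto simp: v'_def \<phi>'_def)
  have vJ: "v' i = 0\<^sub>v M @\<^sub>v w i" "\<phi>' i = 0\<^sub>v M @\<^sub>v \<theta> i" if "i \<in> J" for i using that IJ by (auto simp: v'_def \<phi>'_def)
  have pair: "(a @\<^sub>v b) \<bullet> (B g *\<^sub>v (x @\<^sub>v y)) = a \<bullet> (snd R g *\<^sub>v x) + b \<bullet> (snd S g *\<^sub>v y)"
    if "g \<in> carrier G" "a \<in> carrier_vec M" "x \<in> carrier_vec M" "b \<in> carrier_vec N" "y \<in> carrier_vec N" for g a b x y
    unfolding Bm[OF that(1,3,5)] using that by (intro scalar_prod_append[of _ M _ N] Rc Sc)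
  have z: "0\<^sub>v M \<bullet> (snd R g *\<^sub>v x) = 0" "x \<bullet> (snd R g *\<^sub>v 0\<^sub>v M) = 0" if "g \<in> carrier G" "x \<in> carrier_vec M" for g x
    using that Rc[OF that] mult_mat_zero_vec[OF r(1)[OF that(1)]] by auto
  have z': "0\<^sub>v N \<bullet> (snd S g *\<^sub>v x) = 0" "x \<bullet> (snd S g *\<^sub>v 0\<^sub>v N) = 0" if "g \<in> carrier G" "x \<in> carrier_vec N" for g x
    using that Sc[OF that] mult_mat_zero_vec[OF r'(1)[OF that(1)]] by auto
  have left: "x = 0\<^sub>v (M + N)"
    if x: "x \<in> carrier_vec (M + N)" and zero: "\<And>i g. i \<in> I \<union> J \<Longrightarrow> g \<in> carrier G \<Longrightarrow> \<phi>' i \<bullet> (B g *\<^sub>v x) = 0" for x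
  proof -
    obtain a b where ab: "a \<in> carrier_vec M" "b \<in> carrier_vec N" "x = a @\<^sub>v b" using split[OF x] by blast
    have "a = 0\<^sub>v M"
    proof (rule D(4)[OF ab(1)])
      show "\<phi> i \<bullet> (snd R g *\<^sub>v a) = 0" if "i \<in> I" "g \<in> carrier G" for i g
        using zero[of i g] that ab D(3)[OF that(1)] by (simp add: vI pair z')
    qed
    moreover have "b = 0\<^sub>v N"
    proof (rule D'(4)[OF ab(2)])
      show "\<theta> i \<bullet> (snd S g *\<^sub>v b) = 0" if "i \<in> J" "g \<in> carrier G" for i g
        using zero[of i g] that ab D'(3)[OF that(1)] by (simp add: vJ pair z)
    qed
    ultimately show ?thesis using ab(3) by (auto intro!: eq_vecI)
  qed
  have right: "x = 0\<^sub>v (M + N)"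
    if x: "x \<in> carrier_vec (M + N)" and zero: "\<And>i g. i \<in> I \<union> J \<Longrightarrow> g \<in> carrier G \<Longrightarrow> x \<bullet> (B g *\<^sub>v v' i) = 0" for x
  proof -
    obtain a b where ab: "a \<in> carrier_vec M" "b \<in> carrier_vec N" "x = a @\<^sub>v b" using split[OF x] by blast
    have "a = 0\<^sub>v M"
    proof (rule D(5)[OF ab(1)])
      show "a \<bullet> (snd R g *\<^sub>v v i) = 0" if "i \<in> I" "g \<in> carrier G" for i g
        using zero[of i g] that ab D(2)[OF that(1)] by (simp add: vI pair z')
    qed
    moreover have "b = 0\<^sub>v N"
    proof (rule D'(5)[OF ab(2)])
      show "b \<bullet> (snd S g *\<^sub>v w i) = 0" if "i \<in> J" "g \<in> carrier G" for i g
        using zero[of i g] that ab D'(2)[OF that(1)] by (simp add: vJ pair z)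
    qed
    ultimately show ?thesis using ab(3) by (auto intro!: eq_vecI)
  qed
  have coeff: "\<phi>' i \<bullet> (B g *\<^sub>v v' j) = (if i = j then c i g else 0)"
    if "i \<in> I \<union> J" "j \<in> I \<union> J" "g \<in> carrier G" for i j g
    using that IJ D(2,3,6) D'(2,3,6)
    by (elim UnE) (auto simp: vI vJ pair z z')
  have "framed G (M + N, B) (I \<union> J) v' \<phi>' c"
    unfolding framed_def using rep left right coeff D(2,3) D'(2,3) vI vJ by auto
  then show ?thesis unfolding B_def v'_def \<phi>'_def M_def N_def .
qed

text \<open>\<open>{x} \<inter> B\<close> is either \<open>{x}\<close> or empty, so that summands
  with an index and zero summands go through one induction.\<close>

lemma framed_direct_sum_rep:
  assumes G: "group G" and "distinct xs"
    and F: "\<And>x. x \<in> set xs \<Longrightarrow> \<exists>v \<phi>. framed G (L x) ({x} \<inter> B) v \<phi> c"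
  shows "\<exists>v \<phi>. framed G (direct_sum_rep (map L xs)) (set xs \<inter> B) v \<phi> c"
  using assms(2,3)
proof (induction xs)
  case Nil
  have "representation G (direct_sum_rep (map L []))"
    by (rule representationI[OF G]) (auto simp: direct_sum_rep_def)
  then have "framed G (direct_sum_rep (map L [])) {} (\<lambda>_. 0\<^sub>v 0) (\<lambda>_. 0\<^sub>v 0) c"
    by (rule framed_zero) (simp add: direct_sum_rep_def)
  then show ?case by (simp only: list.set Int_empty_left) blast
next
  case (Cons x xs)
  let ?S = "direct_sum_rep (map L xs)"
  obtain v \<phi> where 1: "framed G (L x) ({x} \<inter> B) v \<phi> c"
    using Cons.prems(2)[OF list.set_intros(1)] by blast
  obtain w \<theta> where 2: "framed G ?S (set xs \<inter> B) w \<theta> c" using Cons by auto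
  have r: "snd (L x) g \<in> carrier_mat (fst (L x)) (fst (L x))" "snd ?S g \<in> carrier_mat (fst ?S) (fst ?S)"
    if "g \<in> carrier G" for g
    using repD(1)[OF G framedD(1)[OF 1] that] repD(1)[OF G framedD(1)[OF 2] that] by auto
  have "framed G (fst (L x) + fst ?S, \<lambda>g. four_block_mat (snd (L x) g) (0\<^sub>m (fst (L x)) (fst ?S)) (0\<^sub>m (fst ?S) (fst (L x))) (snd ?S g))
     (({x} \<inter> B) \<union> (set xs \<inter> B)) (\<lambda>i. if i \<in> {x} \<inter> B then v i @\<^sub>v 0\<^sub>v (fst ?S) else 0\<^sub>v (fst (L x)) @\<^sub>v w i)
     (\<lambda>i. if i \<in> {x} \<inter> B then \<phi> i @\<^sub>v 0\<^sub>v (fst ?S) else 0\<^sub>v (fst (L x)) @\<^sub>v \<theta> i) c" (is "framed G ?R ?I ?v ?p c")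
    by (rule framed_direct_sum[OF G 1 2]) (use Cons.prems in auto)
  note fr = this
  have 3: "snd ?R g = snd (direct_sum_rep (map L (x # xs))) g" if "g \<in> carrier G" for g
    using r[OF that] by (auto simp: direct_sum_rep_def Let_def comp_def)
  have 4: "fst ?R = fst (direct_sum_rep (map L (x # xs)))" by (simp add: direct_sum_rep_def)
  have "?I = set (x # xs) \<inter> B" by auto
  moreover have "framed G (direct_sum_rep (map L (x # xs))) ?I ?v ?p c"
    by (rule iffD1[OF framed_cong[OF G 4 3] fr])
  ultimately show ?case by (simp only:) blast
qed

section \<open>Triangular factorization\<close>

text \<open>In column \<open>j\<close> of \<open>B\<close>, let \<open>k\<close> be the last row at
  or below row \<open>i > j\<close> with a nonzero entry. Row \<open>k\<close> of \<open>A\<close>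
  starts at the diagonal, so entry \<open>(k, j)\<close> of \<open>A B\<close> is
  \<open>A $$ (k, k) * B $$ (k, j)\<close>, nonzero although it lies off the diagonal of the
  identity.\<close>

lemma upper_triangular_inverse:
  assumes A: "(A :: complex mat) \<in> carrier_mat n n" and u: "upper_triangular A" and d: "\<And>i. i < n \<Longrightarrow> A $$ (i, i) \<noteq> 0"
    and B: "B \<in> carrier_mat n n" and AB: "A * B = 1\<^sub>m n"
  shows "upper_triangular B"
proof
  fix i j assume ij: "j < i" "i < dim_row B"
  then have i: "i < n" using B by simp
  have "\<forall>k. i \<le> k \<longrightarrow> k < n \<longrightarrow> B $$ (k, j) = 0"
  proof (rule ccontr)
    assume "\<not> (\<forall>k. i \<le> k \<longrightarrow> k < n \<longrightarrow> B $$ (k, j) = 0)"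
    then have ex: "\<exists>k. i \<le> k \<and> k < n \<and> B $$ (k, j) \<noteq> 0" by blast
    define k where "k = (GREATEST k. i \<le> k \<and> k < n \<and> B $$ (k, j) \<noteq> 0)"
    have k: "i \<le> k \<and> k < n \<and> B $$ (k, j) \<noteq> 0"
      unfolding k_def by (rule GreatestI_ex_nat[OF ex, of n]) auto
    have max: "l \<le> k" if "i \<le> l \<and> l < n \<and> B $$ (l, j) \<noteq> 0" for l
      unfolding k_def by (rule Greatest_le_nat[of "\<lambda>k. i \<le> k \<and> k < n \<and> B $$ (k, j) \<noteq> 0", OF that, of n]) auto
    have "(A * B) $$ (k, j) = (\<Sum>l<n. A $$ (k, l) * B $$ (l, j))"
      using A B k ij i by (simp add: scalar_prod_def atLeast0LessThan)
    also have "\<dots> = (\<Sum>l<n. if l = k then A $$ (k, k) * B $$ (k, j) else 0)"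
    proof (intro sum.cong refl)
      fix l assume "l \<in> {..<n}"
      then have "A $$ (k, l) = 0" if "l < k" using u that k A by (auto simp: upper_triangular_def)
      moreover have "B $$ (l, j) = 0" if "k < l" using max[of l] that k \<open>l \<in> _\<close> by fastforce
      ultimately show "A $$ (k, l) * B $$ (l, j) = (if l = k then A $$ (k, k) * B $$ (k, j) else 0)"
        by (cases l k rule: linorder_cases) auto
    qed
    also have "\<dots> \<noteq> 0" using k d by simp
    finally show False using AB k ij i by simp
  qed
  then show "B $$ (i, j) = 0" using i by blast
qed

text \<open>A unit lower triangular \<open>L\<close> with \<open>L M\<close> upper triangular exists
  because clearing row \<open>i\<close> to the left of the diagonal is a linear system whose matrix
  is the transposed leading block of size \<open>i\<close>. The factors are the inverse of
  \<open>L\<close> and \<open>L M\<close>.\<close>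

lemma LU_factorization:
  assumes M: "M \<in> carrier_mat n n" and minors: "\<And>k. k \<le> n \<Longrightarrow> det (mat k k (\<lambda>(i, j). M $$ (i, j))) \<noteq> (0 :: complex)"
  shows "\<exists>l u. l \<in> carrier (GL n) \<and> u \<in> carrier (GL n) \<and> upper_triangular (transpose_mat l) \<and>
    upper_triangular u \<and> M = l * u"
proof -
  have "\<exists>a. \<forall>j<i. (\<Sum>k<i. a k * M $$ (k, j)) = - M $$ (i, j)" if i: "i < n" for i
  proof -
    define A where "A = mat i i (\<lambda>(j, k). M $$ (k, j))"
    have A: "A \<in> carrier_mat i i" by (simp add: A_def)
    have "A = transpose_mat (mat i i (\<lambda>(i, j). M $$ (i, j)))" by (intro eq_matI) (auto simp: A_def)
    then have "det A \<noteq> 0" using minors[of i] i by (simp add: det_transpose[of _ i])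
    from det_non_zero_imp_unit[OF A this, of "()"] obtain B where B: "B \<in> carrier_mat i i" "A * B = 1\<^sub>m i"
      by (auto simp: Units_def ring_mat_simps)
    define b where "b = vec i (\<lambda>j. - M $$ (i, j))"
    define a where "a = B *\<^sub>v b"
    have "b \<in> carrier_vec i" "a \<in> carrier_vec i" using B by (auto simp: b_def a_def)
    then have Aa: "A *\<^sub>v a = b" using assoc_mult_mat_vec[OF A B(1), of b] B(2) by (simp add: a_def)
    have "(\<Sum>k<i. a $ k * M $$ (k, j)) = - M $$ (i, j)" if j: "j < i" for j
    proof -
      have "(A *\<^sub>v a) $ j = (\<Sum>k<i. a $ k * M $$ (k, j))"
        using j \<open>a \<in> _\<close> by (simp add: A_def scalar_prod_def atLeast0LessThan mult.commute)
      then show ?thesis using Aa j by (simp add: b_def)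
    qed
    then show ?thesis by blast
  qed
  then obtain a where a: "\<And>i j. i < n \<Longrightarrow> j < i \<Longrightarrow> (\<Sum>k<i. a i k * M $$ (k, j)) = - M $$ (i, j)" by metis
  define L where "L = mat n n (\<lambda>(i, k). if k < i then a i k else if k = i then 1 else 0)"
  have L: "L \<in> carrier_mat n n" by (simp add: L_def)
  have Lt: "upper_triangular (transpose_mat L)" "transpose_mat L \<in> carrier_mat n n"
    "\<And>i. i < n \<Longrightarrow> transpose_mat L $$ (i, i) \<noteq> 0"
    by (auto simp: L_def)
  have "det L \<noteq> 0" using det_upper_triangular_prod[OF Lt(1,2)] Lt(3) det_transpose[OF L] by simp
  then have LG: "L \<in> carrier (GL n)" using L by (simp add: GL_iff)
  from det_non_zero_imp_unit[OF L \<open>det L \<noteq> 0\<close>, of "()"] obtain B where B: "B \<in> carrier_mat n n" "B * L = 1\<^sub>m n" "L * B = 1\<^sub>m n"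
    by (auto simp: Units_def ring_mat_simps)
  have "mat n n (\<lambda>(i, j). M $$ (i, j)) = M" using M by (intro eq_matI) auto
  then have "det M \<noteq> 0" using minors[of n] by simp
  then have "det (L * M) \<noteq> 0" using \<open>det L \<noteq> 0\<close> det_mult[OF L M] by simp
  then have uG: "L * M \<in> carrier (GL n)" using L M by (simp add: GL_iff)
  have "upper_triangular (L * M)"
  proof
    fix i j assume ij: "j < i" "i < dim_row (L * M)"
    then have i: "i < n" using L by simp
    have "(L * M) $$ (i, j) = (\<Sum>k<n. (if k < i then a i k else if k = i then 1 else 0) * M $$ (k, j))"
      using L M i ij by (simp add: L_def scalar_prod_def atLeast0LessThan)
    also have "\<dots> = (\<Sum>k\<in>{..i}. (if k < i then a i k else if k = i then 1 else 0) * M $$ (k, j))"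
      using i by (intro sum.mono_neutral_right) auto
    also have "\<dots> = (\<Sum>k<i. a i k * M $$ (k, j)) + M $$ (i, j)"
      by (simp add: lessThan_Suc_atMost[symmetric])
    also have "\<dots> = 0" using a[OF i ij(1)] by simp
    finally show "(L * M) $$ (i, j) = 0" .
  qed
  moreover have "upper_triangular (transpose_mat B)"
  proof (rule upper_triangular_inverse[OF Lt(2,1,3)])
    have "transpose_mat L * transpose_mat B = transpose_mat (B * L)" using transpose_mult[OF B(1) L] by simp
    then show "transpose_mat L * transpose_mat B = 1\<^sub>m n" using B(2) by simp
  qed (use B in auto)
  moreover have "M = B * (L * M)" using assoc_mult_mat[OF B(1) L M] B(2) M by simp
  moreover have "B \<in> carrier (GL n)" using GL_inverseI[OF B(1) L B(2)] .
  ultimately show ?thesis using uG by blast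
qed

text \<open>The big cell is dense: every invertible matrix is joined to the identity by a line that meets the
  complement of the big cell in finitely many points only.\<close>

lemma big_cell_zero:
  fixes F :: "complex mat \<Rightarrow> complex mat \<Rightarrow> complex"
  assumes poly: "\<And>g h. (\<And>t. g t \<in> carrier_mat m m) \<Longrightarrow> (\<And>t. h t \<in> carrier_mat n n) \<Longrightarrow>
      (\<And>i j. i < m \<Longrightarrow> j < m \<Longrightarrow> polyfun (\<lambda>t. g t $$ (i, j))) \<Longrightarrow>
      (\<And>i j. i < n \<Longrightarrow> j < n \<Longrightarrow> polyfun (\<lambda>t. h t $$ (i, j))) \<Longrightarrow>
      \<exists>f. polyfun f \<and> (\<forall>t. g t \<in> carrier (GL m) \<longrightarrow> h t \<in> carrier (GL n) \<longrightarrow> F (g t) (h t) = f t)"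
    and zero: "\<And>l u l' u'. l \<in> carrier (GL m) \<Longrightarrow> u \<in> carrier (GL m) \<Longrightarrow> l' \<in> carrier (GL n) \<Longrightarrow> u' \<in> carrier (GL n) \<Longrightarrow>
         upper_triangular (transpose_mat l) \<Longrightarrow> upper_triangular u \<Longrightarrow>
         upper_triangular (transpose_mat l') \<Longrightarrow> upper_triangular u' \<Longrightarrow> F (l * u) (l' * u') = 0"
    and g: "g \<in> carrier (GL m)" and h: "h \<in> carrier (GL n)"
  shows "F g h = 0"
proof -
  \<comment> \<open>The line \<open>1 + t (A - 1)\<close>. Its leading blocks are lines of the same
    form, so each leading minor is a polynomial in \<open>t\<close> with value 1 at
    \<open>t = 0\<close>.\<close>
  define line where "line k A t = mat k k (\<lambda>(i, j). (if i = j then 1 else 0) + t * (A $$ (i, j) - (if i = j then 1 else 0)))"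
    for k and A :: "complex mat" and t
  have lc: "line k A t \<in> carrier_mat k k" for k A t by (simp add: line_def)
  have lp: "polyfun (\<lambda>t. line k A t $$ (i, j))" if "i < k" "j < k" for k A i j
    using that by (simp add: line_def) (intro conjI impI polyfun_intros)
  have l1: "line k A 1 = A" if "A \<in> carrier_mat k k" for k A
    using that by (intro eq_matI) (auto simp: line_def)
  have fin: "finite {t. det (line k A t) = 0}" for k A
  proof (rule polyfun_nonzero_finite[of _ 0])
    show "polyfun (\<lambda>t. det (line k A t))" by (rule polyfun_det[OF lc lp])
    have "line k A 0 = 1\<^sub>m k" by (intro eq_matI) (auto simp: line_def)
    then show "det (line k A 0) \<noteq> 0" by simp
  qed
  define S where "S = (\<Union>k\<le>m. {t. det (line k g t) = 0}) \<union> (\<Union>k\<le>n. {t. det (line k h t) = 0})"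
  have S: "finite S" using fin by (auto simp: S_def)
  obtain f where f: "polyfun f" "\<And>t. line m g t \<in> carrier (GL m) \<Longrightarrow> line n h t \<in> carrier (GL n) \<Longrightarrow>
      F (line m g t) (line n h t) = f t"
    using poly[of "line m g" "line n h", OF lc lc lp lp] by blast
  have "f t = 0" if t: "t \<notin> S" for t
  proof -
    have "mat k k (\<lambda>(i, j). line q A t $$ (i, j)) = line k A t" if "k \<le> q" for k q A
      using that by (intro eq_matI) (auto simp: line_def)
    then have minors: "\<And>k. k \<le> m \<Longrightarrow> det (mat k k (\<lambda>(i, j). line m g t $$ (i, j))) \<noteq> 0"
      "\<And>k. k \<le> n \<Longrightarrow> det (mat k k (\<lambda>(i, j). line n h t $$ (i, j))) \<noteq> 0"
      using t by (auto simp: S_def)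
    obtain l u where lu: "l \<in> carrier (GL m)" "u \<in> carrier (GL m)" "upper_triangular (transpose_mat l)"
      "upper_triangular u" "line m g t = l * u" using LU_factorization[OF lc minors(1)] by blast
    obtain l' u' where lu': "l' \<in> carrier (GL n)" "u' \<in> carrier (GL n)" "upper_triangular (transpose_mat l')"
      "upper_triangular u'" "line n h t = l' * u'" using LU_factorization[OF lc minors(2)] by blast
    have "line m g t \<in> carrier (GL m)" "line n h t \<in> carrier (GL n)"
      using t lc by (auto simp: S_def GL_iff)
    then have "f t = F (line m g t) (line n h t)" using f(2)[of t] by simp
    also have "\<dots> = F (l * u) (l' * u')" unfolding lu(5) lu'(5) ..
    also have "\<dots> = 0" by (rule zero[OF lu(1,2) lu'(1,2) lu(3,4) lu'(3,4)])
    finally show ?thesis .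
  qed
  \<comment> \<open>The point \<open>t = 1\<close>, where the given pair sits, may itself lie in
    \<open>S\<close>; \<open>f\<close> vanishes there because it is a polynomial that vanishes off a
    finite set.\<close>
  then have "f 1 = 0" using polyfun_eq[OF f(1) polyfun_const S, of 0 1] by simp
  then show ?thesis using f(2)[of 1] g h l1[of g m] l1[of h n] by (simp add: GL_iff)
qed

section \<open>Partitions and their diagrams\<close>

lemma card_diagram: "card (diagram lam) = sum_list lam"
proof -
  have "diagram lam = (SIGMA i:{..<length lam}. {..<lam ! i})" by (auto simp: diagram_def)
  then have "card (diagram lam) = (\<Sum>i<length lam. lam ! i)" by simp
  then show ?thesis by (simp add: sum_list_sum_nth atLeast0LessThan)
qed

lemma diagram_down:
  assumes "lam \<turnstile> d" "(i, j) \<in> diagram lam" "i' \<le> i" "j' \<le> j"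
  shows "(i', j') \<in> diagram lam"
  using assms is_partition_nth_mono[OF assms(1,3)] by (auto simp: diagram_def)

lemma down_closed_nat:
  assumes "finite A" "\<And>x y. x \<in> A \<Longrightarrow> y < x \<Longrightarrow> y \<in> A"
  shows "A = {..<card (A :: nat set)}"
proof (cases "A = {}")
  case False
  have "A = {..Max A}"
    using Max_in[OF assms(1) False] assms Max_ge[OF assms(1)] by (auto simp: le_less)
  then show ?thesis by (metis card_atMost lessThan_Suc_atMost)
qed simp

lemma Max_parts: "Max (insert 0 (set lam)) \<le> k \<longleftrightarrow> (\<forall>i<length lam. lam ! i \<le> (k :: nat))"
  by (auto simp: all_set_conv_all_nth)

lemma length_conjugate: "length (conjugate_part lam) = Max (insert 0 (set lam))"
  by (simp add: conjugate_part_def)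

text \<open>The rows with more than \<open>j\<close> cells form an initial segment, so row
  \<open>i\<close> is among them exactly when \<open>i\<close> is below their number, which is entry
  \<open>j\<close> of the conjugate. The list starts with part 1, hence
  \<open>Suc j\<close>.\<close>

lemma diagram_conjugate:
  assumes lam: "lam \<turnstile> d"
  shows "diagram (conjugate_part lam) = prod.swap ` diagram lam"
proof -
  have "(j, i) \<in> diagram (conjugate_part lam) \<longleftrightarrow> (i, j) \<in> diagram lam" for i j
  proof -
    define A where "A = {i. i < length lam \<and> lam ! i \<ge> Suc j}"
    have "A = {..<card A}"
    proof (rule down_closed_nat)
      show "x' \<in> A" if "x \<in> A" "x' < x" for x x'
        using is_partition_nth_mono[OF lam, of x' x] that by (auto simp: A_def)
    qed (simp add: A_def)
    from arg_cong[OF this, of "\<lambda>X. i \<in> X"] have "i < card A \<longleftrightarrow> i < length lam \<and> j < lam ! i"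
      by (auto simp: A_def)
    moreover have "j < Max (insert 0 (set lam))" if "i < length lam" "j < lam ! i"
      using that Max_parts[of lam j] by (meson leD le_less_linear)
    moreover have "conjugate_part lam ! j = card A" if "j < Max (insert 0 (set lam))"
      using that by (simp add: conjugate_part_def A_def del: upt_Suc)
    ultimately show ?thesis by (auto simp: diagram_def length_conjugate)
  qed
  then show ?thesis by (force simp: prod.swap_def)
qed

lemma sorted_wrt_map_upt:
  "(\<And>i j. i \<le> j \<Longrightarrow> f j \<le> (f i :: nat)) \<Longrightarrow> sorted_wrt (\<ge>) (map f [a..<b])"
  by (auto simp: sorted_wrt_iff_nth_less)

lemma conjugate_partition:
  assumes lam: "lam \<turnstile> d"
  shows "conjugate_part lam \<turnstile> d"
proof -
  define f where "f i = card {j. j < length lam \<and> lam ! j \<ge> i}" for i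
  have c: "conjugate_part lam = map f [1 ..< Suc (Max (insert 0 (set lam)))]"
    by (simp add: conjugate_part_def f_def)
  have mono: "f j \<le> f i" if "i \<le> j" for i j
    unfolding f_def using that by (intro card_mono) auto
  have "sorted_wrt (\<ge>) (conjugate_part lam)"
    unfolding c by (rule sorted_wrt_map_upt[OF mono])
  moreover have "0 \<notin> set (conjugate_part lam)"
  proof
    assume "0 \<in> set (conjugate_part lam)"
    then obtain i where i: "1 \<le> i" "i \<le> Max (insert 0 (set lam))" "f i = 0" by (auto simp: c)
    then have "\<forall>j<length lam. lam ! j < i" by (auto simp: f_def)
    then have "Max (insert 0 (set lam)) < i" using i(1) by (auto simp: in_set_conv_nth)
    then show False using i(2) by linarith
  qed
  moreover have "sum_list (conjugate_part lam) = d"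
    using lam card_diagram[of "conjugate_part lam"] card_diagram[of lam] diagram_conjugate[OF lam]
    by (simp add: is_partition_def card_image)
  ultimately show ?thesis by (simp add: is_partition_def)
qed

lemma down_closed_diagram:
  assumes S: "finite S" "\<And>i j j'. (i, j) \<in> S \<Longrightarrow> j' < j \<Longrightarrow> (i, j') \<in> S"
    "\<And>i j i'. (i, j) \<in> S \<Longrightarrow> i' < i \<Longrightarrow> (i', j) \<in> S"
  shows "\<exists>lam. lam \<turnstile> card S \<and> diagram lam = S"
proof -
  define mu where "mu i = card {j. (i, j) \<in> S}" for i
  have fin: "finite {j. (i, j) \<in> S}" for i
    by (rule finite_subset[of _ "snd ` S"]) (use S(1) in force)+
  have row: "{j. (i, j) \<in> S} = {..<mu i}" for i
    unfolding mu_def by (rule down_closed_nat[OF fin]) (use S(2) in auto)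
  then have mem: "(i, j) \<in> S \<longleftrightarrow> j < mu i" for i j by blast
  have mono: "mu j \<le> mu i" if "i \<le> j" for i j
    unfolding mu_def using that S(3) by (intro card_mono fin) (auto simp: le_less)
  define A where "A = {i. 0 < mu i}"
  have "A \<subseteq> fst ` S" using mem[of _ 0] by (force simp: A_def)
  then have "finite A" using S(1) by (meson finite_imageI finite_subset)
  then have "A = {..<card A}"
  proof (rule down_closed_nat)
    show "x' \<in> A" if "x \<in> A" "x' < x" for x x' using mono[of x' x] that by (auto simp: A_def)
  qed
  from arg_cong[OF this, of "\<lambda>X. i \<in> X" for i] have "i \<in> A \<longleftrightarrow> i < card A" for i by simp
  then have A: "0 < mu i \<longleftrightarrow> i < card A" for i unfolding A_def mem_Collect_eq .
  define lam where "lam = map mu [0..<card A]"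
  have diag: "diagram lam = S"
  proof -
    have "i < card A" if "j < mu i" for i j using that A[of i] by simp
    then show ?thesis by (auto simp: diagram_def lam_def mem)
  qed
  have "sorted_wrt (\<ge>) lam"
    unfolding lam_def by (rule sorted_wrt_map_upt[OF mono])
  moreover have "0 \<notin> set lam"
  proof
    assume "0 \<in> set lam"
    then obtain i where "i < card A" "mu i = 0" by (auto simp: lam_def)
    then show False using A[of i] by simp
  qed
  moreover have "sum_list lam = card S" using card_diagram[of lam] diag by simp
  ultimately show ?thesis using diag by (auto simp: is_partition_def)
qed

text \<open>Counting, for each cell of \<open>S\<close>, the cells of \<open>S\<close> to its left and above it: these numbers are at most
  its coordinates, with equality throughout exactly for Young diagrams.\<close>

lemma diagram_criterion:
  assumes S: "finite (S :: (nat \<times> nat) set)"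
    and eq: "2 * (\<Sum>p\<in>S. fst p + snd p) = card {(p, q) \<in> S \<times> S. (fst p = fst q) \<noteq> (snd p = snd q)}"
  shows "\<exists>lam. lam \<turnstile> card S \<and> diagram lam = S"
proof -
  define A where "A p = {q \<in> S. fst q = fst p \<and> snd q < snd p}" for p
  define B where "B p = {q \<in> S. snd q = snd p \<and> fst q < fst p}" for p
  have Asub: "A p \<subseteq> Pair (fst p) ` {..<snd p}" for p by (force simp: A_def)
  have Bsub: "B p \<subseteq> (\<lambda>i. (i, snd p)) ` {..<fst p}" for p by (force simp: B_def)
  have cA: "card (Pair (fst p) ` {..<snd p}) = snd p" and cB: "card ((\<lambda>i. (i, snd p)) ` {..<fst p}) = fst p"
    for p :: "nat \<times> nat" by (auto simp: card_image inj_on_def)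
  have le: "card (A p) \<le> snd p" "card (B p) \<le> fst p" for p
    using card_mono[OF _ Asub[of p]] card_mono[OF _ Bsub[of p]] cA[of p] cB[of p] by auto
  have "card {(p, q) \<in> S \<times> S. (fst p = fst q) \<noteq> (snd p = snd q)} \<le> 2 * (\<Sum>p\<in>S. card (A p) + card (B p))"
  proof -
    \<comment> \<open>Pairs of cells in a common row or column, the one further right or further
      down coming first. The other order is supplied by \<open>prod.swap\<close>, whence the factor
      2.\<close>
    define X where "X = (SIGMA p:S. A p \<union> B p)"
    have X: "finite X" using S by (auto simp: X_def A_def B_def)
    have "{(p, q) \<in> S \<times> S. (fst p = fst q) \<noteq> (snd p = snd q)} \<subseteq> X \<union> prod.swap ` X"
    proof
      fix z assume "z \<in> {(p, q) \<in> S \<times> S. (fst p = fst q) \<noteq> (snd p = snd q)}"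
      then obtain p q where z: "z = (p, q)" "p \<in> S" "q \<in> S" "(fst p = fst q) \<noteq> (snd p = snd q)" by auto
      then have "(p, q) \<in> X \<or> (q, p) \<in> X"
        by (cases "fst p" "fst q" rule: linorder_cases; cases "snd p" "snd q" rule: linorder_cases)
          (auto simp: X_def A_def B_def)
      then show "z \<in> X \<union> prod.swap ` X" unfolding z(1) by (force simp: prod.swap_def)
    qed
    then have "card {(p, q) \<in> S \<times> S. (fst p = fst q) \<noteq> (snd p = snd q)} \<le> card (X \<union> prod.swap ` X)"
      by (rule card_mono[rotated]) (use X in auto)
    also have "\<dots> \<le> card X + card (prod.swap ` X)" by (rule card_Un_le)
    also have "\<dots> \<le> 2 * card X" using card_image_le[OF X, of prod.swap] by simp
    also have "card X = (\<Sum>p\<in>S. card (A p \<union> B p))" unfolding X_def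
      using S by (intro card_SigmaI) (auto simp: A_def B_def)
    also have "\<dots> \<le> (\<Sum>p\<in>S. card (A p) + card (B p))" by (intro sum_mono card_Un_le)
    finally show ?thesis by simp
  qed
  then have "(\<Sum>p\<in>S. fst p + snd p) \<le> (\<Sum>p\<in>S. card (A p) + card (B p))" using eq by simp
  then have tight: "card (A p) + card (B p) = fst p + snd p" if "p \<in> S" for p
  proof (rule_tac ccontr)
    assume ne: "card (A p) + card (B p) \<noteq> fst p + snd p"
    have "card (A p) + card (B p) \<le> fst p + snd p" for p using le[of p] by simp
    moreover from this[of p] ne have "card (A p) + card (B p) < fst p + snd p" by simp
    ultimately have "(\<Sum>p\<in>S. card (A p) + card (B p)) < (\<Sum>p\<in>S. fst p + snd p)"
      using that by (intro sum_strict_mono_ex1 S ballI bexI[of _ p]) auto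
    then show False using \<open>(\<Sum>p\<in>S. fst p + snd p) \<le> _\<close> by simp
  qed
  have full: "A p = Pair (fst p) ` {..<snd p}" "B p = (\<lambda>i. (i, snd p)) ` {..<fst p}" if "p \<in> S" for p
    using tight[OF that] le[of p] card_subset_eq[OF _ Asub[of p]] card_subset_eq[OF _ Bsub[of p]] cA[of p] cB[of p]
    by auto
  show ?thesis
  proof (rule down_closed_diagram[OF S])
    show "(i, j') \<in> S" if "(i, j) \<in> S" "j' < j" for i j j' using full(1)[OF that(1)] that(2) by (auto simp: A_def)
    show "(i', j) \<in> S" if "(i, j) \<in> S" "i' < i" for i j i' using full(2)[OF that(1)] that(2) by (auto simp: B_def)
  qed
qed

section \<open>Exterior powers\<close>

lemma ext_index_nth:
  assumes "k < ext_dim N d"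
  shows "length (ext_index N d ! k) = d" "sorted_wrt (<) (ext_index N d ! k)" "set (ext_index N d ! k) \<subseteq> {..<N}"
    "c < d \<Longrightarrow> ext_index N d ! k ! c < N"
proof -
  have "ext_index N d ! k \<in> set (ext_index N d)" using assms by (simp add: ext_dim_def)
  then show *: "length (ext_index N d ! k) = d" "sorted_wrt (<) (ext_index N d ! k)" "set (ext_index N d ! k) \<subseteq> {..<N}"
    by (auto simp: ext_index_iff)
  show "c < d \<Longrightarrow> ext_index N d ! k ! c < N" 
    by (rule subsetD[OF *(3) nth_mem, unfolded lessThan_iff]) (simp add: *(1))
qed

lemma ext_index_inj:
  assumes "k < ext_dim N d" "l < ext_dim N d" "set (ext_index N d ! k) = set (ext_index N d ! l)"
  shows "k = l"
  using strict_sorted_equal[OF ext_index_nth(2)[OF assms(1)] ext_index_nth(2)[OF assms(2)] assms(3)[symmetric]] assms(1,2)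
  by (simp add: ext_dim_def nth_eq_iff_index_eq distinct_ext_index)

lemma ext_index_ex:
  assumes "S \<subseteq> {..<N}" "card S = d"
  shows "\<exists>k<ext_dim N d. set (ext_index N d ! k) = S"
proof -
  have fin: "finite S" using assms(1) finite_subset by blast
  then have "sorted_list_of_set S \<in> set (ext_index N d)" using assms by (auto simp: ext_index_iff)
  then show ?thesis using fin by (metis ext_dim_def in_set_conv_nth set_sorted_list_of_set)
qed

lemma ext_mat_carrier: "ext_mat N d A \<in> carrier_mat (ext_dim N d) (ext_dim N d)"
  using mat_of_cols_carrier(1) by (metis ext_mat_def ext_dim_def length_map)

lemma ext_mat_unit:
  assumes A: "A \<in> carrier_mat N N" and k: "k < ext_dim N d"
  shows "ext_mat N d A *\<^sub>v unit_vec (ext_dim N d) k = wedge N (map (\<lambda>v. A *\<^sub>v v) (map (unit_vec N) (ext_index N d ! k)))"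
proof -
  have "ext_mat N d A *\<^sub>v wedge N (map (unit_vec N) (ext_index N d ! k)) =
      wedge N (map (\<lambda>v. A *\<^sub>v v) (map (unit_vec N) (ext_index N d ! k)))"
    by (rule ext_mat_wedge[OF A]) (use ext_index_nth(1)[OF k] in auto)
  then show ?thesis unfolding wedge_basis[OF k] .
qed

lemma index_ext_mat:
  assumes A: "A \<in> carrier_mat N N" and kl: "k < ext_dim N d" "l < ext_dim N d"
  shows "ext_mat N d A $$ (k, l) = det (mat d d (\<lambda>(r, c). A $$ (ext_index N d ! k ! r, ext_index N d ! l ! c)))"
proof -
  note I = ext_index_nth[OF kl(1)] ext_index_nth[OF kl(2)]
  define B where "B = mat d d (\<lambda>(r, c). A $$ (ext_index N d ! k ! r, ext_index N d ! l ! c))"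
  have B: "B \<in> carrier_mat d d" by (simp add: B_def)
  have "mat d d (\<lambda>(r, c). map (\<lambda>v. A *\<^sub>v v) (map (unit_vec N) (ext_index N d ! l)) ! r $ (ext_index N d ! k ! c)) = transpose_mat B"
    using I A mult_mat_unit_vec[OF A] by (intro eq_matI) (auto simp: B_def)
  then have "wedge N (map (\<lambda>v. A *\<^sub>v v) (map (unit_vec N) (ext_index N d ! l))) $ k = det (transpose_mat B)"
    using kl I(5) by (simp add: wedge_def Let_def)
  also have "\<dots> = det B" by (rule det_transpose[OF B])
  finally have "(ext_mat N d A *\<^sub>v unit_vec (ext_dim N d) l) $ k = det B" unfolding ext_mat_unit[OF A kl(2)] .
  moreover have "(ext_mat N d A *\<^sub>v unit_vec (ext_dim N d) l) $ k = ext_mat N d A $$ (k, l)"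
    using kl ext_mat_carrier[of N d A] by (simp add: mult_mat_unit_vec[OF ext_mat_carrier kl(2)])
  ultimately show ?thesis by (simp add: B_def)
qed

lemma ext_mat_one: "ext_mat N d (1\<^sub>m N) = 1\<^sub>m (ext_dim N d)"
proof (rule mat_col_eqI)
  fix k assume "k < dim_col (1\<^sub>m (ext_dim N d) :: complex mat)"
  then have k: "k < ext_dim N d" by simp
  have "map (\<lambda>v. 1\<^sub>m N *\<^sub>v v) (map (unit_vec N) (ext_index N d ! k)) =
      (map (unit_vec N) (ext_index N d ! k) :: complex vec list)"
    by simp
  then have "ext_mat N d (1\<^sub>m N) *\<^sub>v unit_vec (ext_dim N d) k = unit_vec (ext_dim N d) k"
    by (simp only: ext_mat_unit[OF one_carrier_mat k] wedge_basis[OF k])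
  then show "col (ext_mat N d (1\<^sub>m N)) k = col (1\<^sub>m (ext_dim N d)) k"
    using k by (simp add: mult_mat_unit_vec[OF ext_mat_carrier k])
qed (use ext_mat_carrier[of N d "1\<^sub>m N"] in auto)

lemma ext_mat_mult:
  assumes A: "A \<in> carrier_mat N N" and B: "B \<in> carrier_mat N N"
  shows "ext_mat N d (A * B) = ext_mat N d A * ext_mat N d B"
proof (rule mat_col_eqI)
  note E = ext_mat_carrier[of N d]
  fix k assume "k < dim_col (ext_mat N d A * ext_mat N d B)"
  then have k: "k < ext_dim N d" using E[of B] by simp
  let ?us = "map (unit_vec N) (ext_index N d ! k) :: complex vec list"
  have us: "length ?us = d" "set ?us \<subseteq> carrier_vec N" using ext_index_nth(1)[OF k] by auto
  have "map (\<lambda>v. (A * B) *\<^sub>v v) ?us = map (\<lambda>v. A *\<^sub>v v) (map (\<lambda>v. B *\<^sub>v v) ?us)"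
    using A B by (auto simp: assoc_mult_mat_vec[of _ N N _ N])
  then have "ext_mat N d (A * B) *\<^sub>v unit_vec (ext_dim N d) k = wedge N (map (\<lambda>v. A *\<^sub>v v) (map (\<lambda>v. B *\<^sub>v v) ?us))"
    by (simp only: ext_mat_unit[OF mult_carrier_mat[OF A B] k])
  also have "\<dots> = ext_mat N d A *\<^sub>v wedge N (map (\<lambda>v. B *\<^sub>v v) ?us)"
    by (rule ext_mat_wedge[OF A, symmetric]) (use us B in auto)
  also have "\<dots> = ext_mat N d A *\<^sub>v (ext_mat N d B *\<^sub>v unit_vec (ext_dim N d) k)"
    unfolding ext_mat_unit[OF B k] ..
  also have "\<dots> = (ext_mat N d A * ext_mat N d B) *\<^sub>v unit_vec (ext_dim N d) k"
    using E by (simp add: assoc_mult_mat_vec[of _ "ext_dim N d" "ext_dim N d" _ "ext_dim N d"])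
  finally show "col (ext_mat N d (A * B)) k = col (ext_mat N d A * ext_mat N d B) k"
    using mult_mat_unit_vec[OF E k] mult_mat_unit_vec[OF mult_carrier_mat[OF E E] k] by simp
qed (use ext_mat_carrier[of N d A] ext_mat_carrier[of N d B] ext_mat_carrier[of N d "A * B"] in auto)

lemma transpose_ext_mat:
  assumes A: "A \<in> carrier_mat N N"
  shows "transpose_mat (ext_mat N d A) = ext_mat N d (transpose_mat A)"
proof (rule eq_matI)
  note E = ext_mat_carrier[of N d]
  fix k l assume "k < dim_row (ext_mat N d (transpose_mat A))" "l < dim_col (ext_mat N d (transpose_mat A))"
  then have kl: "k < ext_dim N d" "l < ext_dim N d" using E[of "transpose_mat A"] by auto
  note I = ext_index_nth[OF kl(1)] ext_index_nth[OF kl(2)]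
  define B where "B = mat d d (\<lambda>(r, c). A $$ (ext_index N d ! l ! r, ext_index N d ! k ! c))"
  have "mat d d (\<lambda>(r, c). transpose_mat A $$ (ext_index N d ! k ! r, ext_index N d ! l ! c)) = transpose_mat B"
    using I A by (intro eq_matI) (auto simp: B_def)
  then have "ext_mat N d (transpose_mat A) $$ (k, l) = det (transpose_mat B)"
    using A by (simp add: index_ext_mat[OF _ kl])
  also have "\<dots> = det B" by (rule det_transpose[of _ d]) (simp add: B_def)
  also have "\<dots> = ext_mat N d A $$ (l, k)" unfolding B_def by (rule index_ext_mat[OF A kl(2,1), symmetric])
  finally show "transpose_mat (ext_mat N d A) $$ (k, l) = ext_mat N d (transpose_mat A) $$ (k, l)"
    using kl E[of A] by simp
qed (use ext_mat_carrier[of N d A] ext_mat_carrier[of N d "transpose_mat A"] in auto)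

lemma polyfun_ext_mat:
  assumes M: "\<And>t. M t \<in> carrier_mat N N" "\<And>i j. i < N \<Longrightarrow> j < N \<Longrightarrow> polyfun (\<lambda>t. M t $$ (i, j))"
    and kl: "k < ext_dim N d" "l < ext_dim N d"
  shows "polyfun (\<lambda>t. ext_mat N d (M t) $$ (k, l))"
  unfolding index_ext_mat[OF M(1) kl]
  by (rule polyfun_det[of _ d]) (use M(2) ext_index_nth(4)[OF kl(1)] ext_index_nth(4)[OF kl(2)] in auto)

text \<open>By \<open>inv\<close>, \<open>A\<close> preserves the span of the basis vectors listed
  at \<open>k\<close>, so their wedge is an eigenvector, with the determinant of the restriction as
  eigenvalue. For any other coordinate the minor has a row with index outside that list, and
  \<open>inv\<close> makes this row zero.\<close>

lemma ext_mat_triangular: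
  assumes A: "A \<in> carrier_mat N N" and u: "upper_triangular A" and k: "k < ext_dim N d"
    and inv: "\<And>i j. i < N \<Longrightarrow> i \<notin> set (ext_index N d ! k) \<Longrightarrow> j \<in> set (ext_index N d ! k) \<Longrightarrow> A $$ (i, j) = 0"
  shows "ext_mat N d A *\<^sub>v unit_vec (ext_dim N d) k = (\<Prod>j\<in>set (ext_index N d ! k). A $$ (j, j)) \<cdot>\<^sub>v unit_vec (ext_dim N d) k"
proof (rule eq_vecI)
  fix l assume "l < dim_vec ((\<Prod>j\<in>set (ext_index N d ! k). A $$ (j, j)) \<cdot>\<^sub>v unit_vec (ext_dim N d) k)"
  then have l: "l < ext_dim N d" by simp
  define J where "J l = ext_index N d ! l" for l
  note Jk = ext_index_nth[OF k, folded J_def] and Jl = ext_index_nth[OF l, folded J_def]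
  define B where "B = mat d d (\<lambda>(r, c). A $$ (J l ! r, J k ! c))"
  have B: "B \<in> carrier_mat d d" by (simp add: B_def)
  have *: "(ext_mat N d A *\<^sub>v unit_vec (ext_dim N d) k) $ l = det B"
    using l k ext_mat_carrier[of N d A]
    by (simp add: mult_mat_unit_vec[OF ext_mat_carrier k] index_ext_mat[OF A l k] B_def J_def)
  have dist: "distinct (J k)" "distinct (J l)" using Jk(2) Jl(2) strict_sorted_iff by blast+
  show "(ext_mat N d A *\<^sub>v unit_vec (ext_dim N d) k) $ l =
    ((\<Prod>j\<in>set (ext_index N d ! k). A $$ (j, j)) \<cdot>\<^sub>v unit_vec (ext_dim N d) k) $ l"
  proof (cases "l = k")
    case True
    have "J k ! c < J k ! r" if "c < r" "r < d" for c r
      using that Jk(1,2) by (auto simp: sorted_wrt_iff_nth_less)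
    then have "upper_triangular B" using u A Jk(4) unfolding B_def True upper_triangular_def by auto
    then have "det B = (\<Prod>r<d. A $$ (J k ! r, J k ! r))"
      using det_upper_triangular_prod[OF _ B] by (simp add: B_def True)
    also have "\<dots> = (\<Prod>j\<in>set (J k). A $$ (j, j))"
      using bij_betw_nth[OF dist(1) refl refl] Jk(1)
      by (intro prod.reindex_bij_betw[of "\<lambda>r. J k ! r" "{..<d}" "set (J k)" "\<lambda>j. A $$ (j, j)"]) (simp add: atLeast0LessThan)
    finally show ?thesis using * True k by (simp add: J_def)
  next
    case False
    then have "set (J l) \<noteq> set (J k)" using ext_index_inj[OF l k] by (auto simp: J_def)
    moreover have "card (set (J l)) = card (set (J k))" using dist Jk(1) Jl(1) by (simp add: distinct_card)
    ultimately have "\<not> set (J l) \<subseteq> set (J k)" using card_subset_eq[of "set (J k)" "set (J l)"] by auto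
    then obtain r where r: "r < d" "J l ! r \<notin> set (J k)" using Jl(1) by (metis in_set_conv_nth subsetI)
    have zero: "A $$ (J l ! r, J k ! c) = 0" if "c < d" for c
      by (rule inv) (use r that Jk(1) Jl(4) in \<open>auto simp: J_def\<close>)
    have "B = mat\<^sub>r d d (\<lambda>i. if i = r then 0\<^sub>v d else row B i)"
      using zero by (intro eq_matI) (auto simp: B_def)
    then have "det B = det (mat\<^sub>r d d (\<lambda>i. if i = r then 0\<^sub>v d else row B i))" by (rule arg_cong)
    also have "\<dots> = 0" using r(1) by (intro det_row_0) (auto simp: B_def)
    finally show ?thesis using * False l k by simp
  qed
qed (use ext_mat_carrier[of N d A] in simp)

section \<open>Highest weight vectors in the exterior power\<close>

lemma wedge_carrier: "length vs = d \<Longrightarrow> wedge N vs \<in> carrier_vec (ext_dim N d)"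
  by (auto simp: wedge_def Let_def)

text \<open>The slots are perturbed one after another, \<open>k\<close> counting the perturbed ones,
  and expanded by linearity. The list \<open>us\<close> varies in the induction because opening slot
  \<open>k\<close> also produces the list with \<open>ws ! k\<close> in that slot.\<close>

lemma wedge_first_order:
  assumes f: "f \<in> carrier_vec (ext_dim N d)" and ws: "length ws = d" "set ws \<subseteq> carrier_vec N"
    and "k \<le> d" "length us = d" "set us \<subseteq> carrier_vec N"
  shows "\<exists>q. polyfun q \<and> (\<forall>s. f \<bullet> wedge N (map (\<lambda>r. if r < k then us ! r + s \<cdot>\<^sub>v ws ! r else us ! r) [0..<d]) =
    f \<bullet> wedge N us + s * (\<Sum>r<k. f \<bullet> wedge N (us[r := ws ! r])) + s ^ 2 * q s)"
  using assms(4-)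
proof (induction k arbitrary: us)
  case 0
  have "map (\<lambda>r. if r < 0 then us ! r + s \<cdot>\<^sub>v ws ! r else us ! r) [0..<d] = us" for s
    using 0 by (intro nth_equalityI) auto
  then show ?case by (intro exI[of _ "\<lambda>_. 0"]) (simp add: polyfun_const)
next
  case (Suc k)
  have k: "k < d" using Suc.prems by simp
  define L where "L k us s = map (\<lambda>r. if r < k then us ! r + s \<cdot>\<^sub>v ws ! r else us ! r) [0..<d]"
    for k and us :: "complex vec list" and s :: complex
  have wk: "ws ! r \<in> carrier_vec N" if "r < d" for r using ws that by auto
  have uk: "us ! r \<in> carrier_vec N" if "r < d" for r using Suc.prems that by auto
  define us' where "us' = us[k := ws ! k]"
  have us': "length us' = d" "set us' \<subseteq> carrier_vec N"
    using Suc.prems(2) set_update_carrier[OF Suc.prems(3) wk[OF k]] by (simp_all add: us'_def)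
  have LL: "length (L k us s) = d" "set (L k us s) \<subseteq> carrier_vec N" for s
    using wk uk by (auto simp: L_def)
  have L1: "L (Suc k) us s = (L k us s)[k := us ! k + s \<cdot>\<^sub>v ws ! k]" for s
    using k by (intro nth_equalityI) (auto simp: L_def nth_list_update less_Suc_eq)
  have L2: "(L k us s)[k := us ! k] = L k us s" for s
    using k by (intro nth_equalityI) (auto simp: L_def nth_list_update)
  have L3: "(L k us s)[k := ws ! k] = L k us' s" for s
    using k Suc.prems by (intro nth_equalityI) (auto simp: L_def us'_def nth_list_update)
  have step: "f \<bullet> wedge N (L (Suc k) us s) = f \<bullet> wedge N (L k us s) + s * (f \<bullet> wedge N (L k us' s))" for s
  proof -
    have "wedge N (L (Suc k) us s) = wedge N (L k us s) + s \<cdot>\<^sub>v wedge N (L k us' s)"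
      unfolding L1 using alternatingD(2,3)[OF alternating_wedge LL k] uk[OF k] wk[OF k] by (simp add: L2 L3)
    then show ?thesis
      using f wedge_carrier[of _ d N] LL(1)[of s] by (simp add: scalar_prod_add_distrib[of _ "ext_dim N d"] L_def)
  qed
  obtain q where q: "polyfun q" "\<And>s. f \<bullet> wedge N (L k us s) =
      f \<bullet> wedge N us + s * (\<Sum>r<k. f \<bullet> wedge N (us[r := ws ! r])) + s ^ 2 * q s"
    using Suc.IH[OF _ Suc.prems(2,3)] k unfolding L_def by auto
  obtain q' where q': "polyfun q'" "\<And>s. f \<bullet> wedge N (L k us' s) =
      f \<bullet> wedge N us' + s * (\<Sum>r<k. f \<bullet> wedge N (us'[r := ws ! r])) + s ^ 2 * q' s"
    using Suc.IH[OF _ us'] k unfolding L_def by auto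
  show ?case
  proof (intro exI conjI allI)
    show "polyfun (\<lambda>s. q s + ((\<Sum>r<k. f \<bullet> wedge N (us'[r := ws ! r])) + s * q' s))"
      using q(1) q'(1) by (intro polyfun_intros)
    fix s
    show "f \<bullet> wedge N (map (\<lambda>r. if r < Suc k then us ! r + s \<cdot>\<^sub>v ws ! r else us ! r) [0..<d]) =
      f \<bullet> wedge N us + s * (\<Sum>r<Suc k. f \<bullet> wedge N (us[r := ws ! r])) +
      s ^ 2 * (q s + ((\<Sum>r<k. f \<bullet> wedge N (us'[r := ws ! r])) + s * q' s))"
      unfolding L_def[symmetric] step q(2) q'(2) by (simp add: us'_def power2_eq_square algebra_simps)
  qed
qed

text \<open>The derivative at \<open>s = 0\<close> of the invariance of \<open>f\<close> under
  \<open>A s = 1 + s y\<close>. The transpose appears because \<open>f\<close> acts as a form on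
  wedges.\<close>

lemma infinitesimal_invariance:
  assumes f: "f \<in> carrier_vec (ext_dim N d)"
    and A: "\<And>s. A s \<in> carrier_mat N N" "\<And>s. ext_mat N d (transpose_mat (A s)) *\<^sub>v f = f"
    and y: "\<And>q. q < N \<Longrightarrow> y q \<in> carrier_vec N" "\<And>s q. q < N \<Longrightarrow> A s *\<^sub>v unit_vec N q = unit_vec N q + s \<cdot>\<^sub>v y q"
    and qs: "length qs = d" "set qs \<subseteq> {..<N}"
  shows "(\<Sum>r<d. f \<bullet> wedge N ((map (unit_vec N) qs)[r := y (qs ! r)])) = 0"
proof -
  define us :: "complex vec list" where "us = map (unit_vec N) qs"
  define ws where "ws = map y qs"
  have us: "length us = d" "set us \<subseteq> carrier_vec N" and ws: "length ws = d" "set ws \<subseteq> carrier_vec N"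
    using qs y(1) by (auto simp: us_def ws_def)
  define c where "c = (\<Sum>r<d. f \<bullet> wedge N (us[r := ws ! r]))"
  obtain q where q: "polyfun q" "\<And>s. f \<bullet> wedge N (map (\<lambda>r. if r < d then us ! r + s \<cdot>\<^sub>v ws ! r else us ! r) [0..<d]) =
    f \<bullet> wedge N us + s * c + s ^ 2 * q s"
    using wedge_first_order[OF f ws order_refl us] unfolding c_def by blast
  have const: "s * c + s ^ 2 * q s = 0" for s
  proof -
    have "map (\<lambda>r. if r < d then us ! r + s \<cdot>\<^sub>v ws ! r else us ! r) [0..<d] = map (\<lambda>v. A s *\<^sub>v v) us"
      using qs y(2) by (intro nth_equalityI) (auto simp: us_def ws_def subset_iff)
    then have "f \<bullet> wedge N (map (\<lambda>r. if r < d then us ! r + s \<cdot>\<^sub>v ws ! r else us ! r) [0..<d]) =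
        f \<bullet> (ext_mat N d (A s) *\<^sub>v wedge N us)"
      using ext_mat_wedge[OF A(1) us] by simp
    also have "\<dots> = (ext_mat N d (transpose_mat (A s)) *\<^sub>v f) \<bullet> wedge N us"
      unfolding transpose_ext_mat[OF A(1), symmetric]
      by (rule scalar_prod_mult_mat_vec[OF ext_mat_carrier wedge_carrier[OF us(1)] f])
    finally show ?thesis using q(2)[of s] A(2) by simp
  qed
  \<comment> \<open>One factor \<open>s\<close> is cancelled away from 0; the identity of
    polynomials then holds at \<open>s = 0\<close> as well and leaves \<open>c = 0\<close>.\<close>
  have "c + s * q s = 0" if "s \<noteq> 0" for s
  proof -
    have "s * (c + s * q s) = 0" using const[of s] by (simp add: power2_eq_square algebra_simps)
    then show ?thesis using that by simp
  qed
  then have "c + 0 * q 0 = 0"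
    by (intro polyfun_eq[of "\<lambda>s. c + s * q s" "\<lambda>_. 0" "{0}" 0]) (auto intro!: polyfun_intros q(1))
  moreover have "ws ! r = y (qs ! r)" if "r < d" for r using that qs by (simp add: ws_def)
  ultimately show ?thesis by (simp add: c_def us_def)
qed

text \<open>Applying \<open>E_ba E_ab\<close> for rows and for columns swaps the rows, respectively the columns, of two cells.
  As \<open>F\<close> alternates, the two kinds of swap cancel unless the cells share a row or a column, and what
  remains is a scalar.\<close>

lemma swap_cancellation:
  fixes F :: "nat list \<Rightarrow> complex"
  assumes row: "\<And>qs a b. length qs = d \<Longrightarrow> set qs \<subseteq> {..<m * n} \<Longrightarrow> b < a \<Longrightarrow> a < m \<Longrightarrow>
      (\<Sum>r<d. if qs ! r div n = b then F (qs[r := a * n + qs ! r mod n]) else 0) = 0"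
    and col: "\<And>qs a b. length qs = d \<Longrightarrow> set qs \<subseteq> {..<m * n} \<Longrightarrow> b < a \<Longrightarrow> a < n \<Longrightarrow>
      (\<Sum>r<d. if qs ! r mod n = b then F (qs[r := qs ! r div n * n + a]) else 0) = 0"
    and swap: "\<And>i j x y. i < d \<Longrightarrow> j < d \<Longrightarrow> i \<noteq> j \<Longrightarrow> x < m * n \<Longrightarrow> y < m * n \<Longrightarrow>
      F (B[i := x, j := y]) = - F (B[i := y, j := x])"
    and B: "length B = d" "set B \<subseteq> {..<m * n}" and F: "F B \<noteq> 0"
  shows "2 * (\<Sum>s<d. B ! s div n + B ! s mod n) =
    card {(s, r) \<in> {..<d} \<times> {..<d}. (B ! s div n = B ! r div n) \<noteq> (B ! s mod n = B ! r mod n)}"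
proof -
  define R where "R s = B ! s div n" for s
  define C where "C s = B ! s mod n" for s
  have lt: "B ! s < m * n" if "s < d" for s using B that nth_mem by blast
  have RC: "R s < m" "C s < n" if "s < d" for s
    using grid_div_mod[OF lt[OF that]] by (auto simp: R_def C_def)
  have cell: "R s * n + C s = B ! s" for s by (simp add: R_def C_def)
  have dm: "(i * n + j) div n = i" "(i * n + j) mod n = j" if "j < n" for i j using that by auto
  \<comment> \<open>Cells \<open>s\<close> and \<open>r\<close> exchange their rows and keep their
    columns. Exchanging the columns instead gives the same two cells in the other order, hence
    \<open>- G s r\<close> when \<open>s \<noteq> r\<close>.\<close>
  define G where "G s r = F (B[s := R r * n + C s, r := R s * n + C r])" for s r
  have Gsym: "G s r = G r s" if "s \<noteq> r" for s r
    unfolding G_def using that by (simp add: list_update_swap)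
  have upd: "set (B[s := x]) \<subseteq> {..<m * n}" if "x < m * n" for s x
    using B(2) that set_update_subset_insert[of B s x] by auto
  have rows: "of_nat (R s) * F B + (\<Sum>r<d. if R r < R s then G s r else 0) = 0" if s: "s < d" for s
  proof -
    \<comment> \<open>Move cell \<open>s\<close> up to row \<open>b\<close> and apply the relation
      \<open>row\<close> from row \<open>b\<close> to row \<open>R s\<close>: the term
      \<open>r = s\<close> moves it back and gives \<open>F B\<close>, and every other term
      completes an exchange of rows.\<close>
    have 1: "F B + (\<Sum>r<d. if r \<noteq> s \<and> R r = b then G s r else 0) = 0" if b: "b < R s" for b
    proof -
      define B' where "B' = B[s := b * n + C s]"
      have "b * n + C s < m * n" using b RC[OF s] by (intro grid_less) auto
      then have "(\<Sum>r<d. if B' ! r div n = b then F (B'[r := R s * n + B' ! r mod n]) else 0) = 0"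
        using B(1) b RC[OF s] upd by (intro row) (auto simp: B'_def)
      moreover have "(if B' ! r div n = b then F (B'[r := R s * n + B' ! r mod n]) else 0) =
        (if r = s then F B else 0) + (if r \<noteq> s \<and> R r = b then G s r else 0)" if r: "r < d" for r
      proof (cases "r = s")
        case True
        have "B' ! s = b * n + C s" using s B(1) by (simp add: B'_def)
        moreover have "B[s := R s * n + C s] = B" by (simp add: cell)
        ultimately show ?thesis using True dm[OF RC(2)[OF s]] by (simp add: B'_def)
      next
        case False
        then have "B' ! r = B ! r" by (simp add: B'_def)
        then show ?thesis using False by (auto simp: G_def B'_def R_def[of r] C_def[of r])
      qed
      ultimately show ?thesis using s by (simp add: sum.distrib)
    qed
    have "(\<Sum>b<R s. F B + (\<Sum>r<d. if r \<noteq> s \<and> R r = b then G s r else 0)) = 0" using 1 by simp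
    moreover have "(\<Sum>b<R s. \<Sum>r<d. if r \<noteq> s \<and> R r = b then G s r else 0) = (\<Sum>r<d. if R r < R s then G s r else 0)"
    proof -
      have "(\<Sum>b<R s. if r \<noteq> s \<and> R r = b then G s r else 0) = (if R r < R s then G s r else 0)" for r
        by (cases "r = s") (auto simp: sum.delta)
      then show ?thesis by (subst sum.swap) simp
    qed
    ultimately show ?thesis by (simp add: sum.distrib)
  qed
  have cols: "of_nat (C s) * F B - (\<Sum>r<d. if C r < C s then G s r else 0) = 0" if s: "s < d" for s
  proof -
    have 1: "F B + (\<Sum>r<d. if r \<noteq> s \<and> C r = b then - G s r else 0) = 0" if b: "b < C s" for b
    proof -
      define B' where "B' = B[s := R s * n + b]"
      have "R s * n + b < m * n" using b RC[OF s] by (intro grid_less) auto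
      then have "(\<Sum>r<d. if B' ! r mod n = b then F (B'[r := B' ! r div n * n + C s]) else 0) = 0"
        using B(1) b RC[OF s] upd by (intro col) (auto simp: B'_def)
      moreover have "(if B' ! r mod n = b then F (B'[r := B' ! r div n * n + C s]) else 0) =
        (if r = s then F B else 0) + (if r \<noteq> s \<and> C r = b then - G s r else 0)" if r: "r < d" for r
      proof (cases "r = s")
        case True
        have "B' ! s = R s * n + b" using s B(1) by (simp add: B'_def)
        moreover have "b < n" using b RC(2)[OF s] by simp
        moreover have "B[s := R s * n + C s] = B" by (simp add: cell)
        ultimately show ?thesis using True dm[of b] by (simp add: B'_def)
      next
        case False
        have "F (B[s := R s * n + C r, r := R r * n + C s]) = - G s r"
          unfolding G_def using False s r RC[OF s] RC[OF r] by (intro swap grid_less) auto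
        moreover have "B' ! r = B ! r" using False by (simp add: B'_def)
        ultimately show ?thesis using False by (auto simp: B'_def R_def[of r] C_def[of r])
      qed
      ultimately show ?thesis using s by (simp add: sum.distrib)
    qed
    have "(\<Sum>b<C s. F B + (\<Sum>r<d. if r \<noteq> s \<and> C r = b then - G s r else 0)) = 0" using 1 by simp
    moreover have "(\<Sum>b<C s. \<Sum>r<d. if r \<noteq> s \<and> C r = b then - G s r else 0) = - (\<Sum>r<d. if C r < C s then G s r else 0)"
    proof -
      have "(\<Sum>b<C s. if r \<noteq> s \<and> C r = b then - G s r else 0) = - (if C r < C s then G s r else 0)" for r
        by (cases "r = s") (auto simp: sum.delta)
      then show ?thesis by (subst sum.swap) (simp add: sum_negf)
    qed
    ultimately show ?thesis by (simp add: sum.distrib)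
  qed
  define X where "X s r \<longleftrightarrow> (R s = R r) \<noteq> (C s = C r)" for s r
  define h where "h s r = (if R r < R s then G s r else 0) - (if C r < C s then G s r else 0)" for s r
  \<comment> \<open>For a pair in different rows and columns the two exchanges cancel. In a common
    row \<open>G\<close> is \<open>F B\<close> and only the column term occurs; in a common column
    \<open>G\<close> is \<open>- F B\<close> and only the row term occurs.\<close>
  have hh: "h s r + h r s = (if X s r then - F B else 0)" if sr: "s < d" "r < d" for s r
  proof (cases "s = r")
    case True
    then show ?thesis by (simp add: h_def X_def)
  next
    case ne: False
    have G1: "G s r = F B" if "R s = R r"
      unfolding G_def using that cell[of s] cell[of r] by simp
    have G2: "G s r = - F B" if "C s = C r"
    proof -
      have "G s r = F (B[s := B ! r, r := B ! s])" unfolding G_def using that cell[of s] cell[of r] by simp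
      also have "\<dots> = - F (B[s := B ! s, r := B ! r])" using sr ne lt by (intro swap) auto
      finally show ?thesis by simp
    qed
    show ?thesis
      by (cases "R s" "R r" rule: linorder_cases; cases "C s" "C r" rule: linorder_cases)
        (use G1 G2 Gsym[OF ne] in \<open>auto simp: h_def X_def\<close>)
  qed
  have "(\<Sum>s<d. of_nat (R s + C s) * F B + (\<Sum>r<d. h s r)) = 0"
  proof (intro sum.neutral ballI)
    fix s assume "s \<in> {..<d}"
    then have s: "s < d" by simp
    have "(\<Sum>r<d. h s r) = (\<Sum>r<d. if R r < R s then G s r else 0) - (\<Sum>r<d. if C r < C s then G s r else 0)"
      by (simp add: h_def sum_subtractf)
    then have "of_nat (R s + C s) * F B + (\<Sum>r<d. h s r) =
      (of_nat (R s) * F B + (\<Sum>r<d. if R r < R s then G s r else 0)) +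
      (of_nat (C s) * F B - (\<Sum>r<d. if C r < C s then G s r else 0))" by (simp add: algebra_simps)
    then show "of_nat (R s + C s) * F B + (\<Sum>r<d. h s r) = 0" using rows[OF s] cols[OF s] by simp
  qed
  then have 1: "of_nat (\<Sum>s<d. R s + C s) * F B + (\<Sum>s<d. \<Sum>r<d. h s r) = 0"
    by (simp add: sum.distrib sum_distrib_left algebra_simps)
  have "2 * (\<Sum>s<d. \<Sum>r<d. h s r) = (\<Sum>s<d. \<Sum>r<d. h s r) + (\<Sum>s<d. \<Sum>r<d. h r s)"
    by (subst (3) sum.swap) simp
  also have "\<dots> = (\<Sum>s<d. \<Sum>r<d. if X s r then - F B else 0)"
    using hh by (simp add: sum.distrib[symmetric])
  also have "\<dots> = (\<Sum>z\<in>{..<d} \<times> {..<d}. if X (fst z) (snd z) then - F B else 0)"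
    by (simp add: sum.cartesian_product case_prod_unfold)
  also have "\<dots> = - (of_nat (card {z \<in> {..<d} \<times> {..<d}. X (fst z) (snd z)}) * F B)"
    by (subst sum.inter_filter[symmetric]) auto
  finally have 2: "2 * (\<Sum>s<d. \<Sum>r<d. h s r) = - (of_nat (card {z \<in> {..<d} \<times> {..<d}. X (fst z) (snd z)}) * F B)" .
  have "(2 * T - c) * x = 0" if "T * x + H = 0" "2 * H = - (c * x)" for T c x H :: complex
  proof -
    have "(2 * T - c) * x = 2 * (T * x + H) - (2 * H + c * x)" by (simp add: algebra_simps)
    then show ?thesis using that by simp
  qed
  from this[OF 1 2] have "(2 * of_nat (\<Sum>s<d. R s + C s) - of_nat (card {z \<in> {..<d} \<times> {..<d}. X (fst z) (snd z)})) * F B = 0" .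
  then have "of_nat (2 * (\<Sum>s<d. R s + C s)) = (of_nat (card {z \<in> {..<d} \<times> {..<d}. X (fst z) (snd z)}) :: complex)"
    using F by simp
  then have "2 * (\<Sum>s<d. R s + C s) = card {z \<in> {..<d} \<times> {..<d}. X (fst z) (snd z)}"
    using of_nat_eq_iff by blast
  moreover have "{z \<in> {..<d} \<times> {..<d}. X (fst z) (snd z)} =
    {(s, r) \<in> {..<d} \<times> {..<d}. (B ! s div n = B ! r div n) \<noteq> (B ! s mod n = B ! r mod n)}"
    by (auto simp: X_def R_def C_def)
  ultimately show ?thesis by (simp add: R_def C_def)
qed

text \<open>The coordinates of \<open>f\<close> are treated one at a time: a nonzero one forces the
  identity of \<open>swap_cancellation\<close> for its own index set, in which
  \<open>diagram_criterion\<close> recognises a Young diagram.\<close>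

lemma unipotent_fixed_support:
  assumes f: "f \<in> carrier_vec (ext_dim (m * n) d)"
    and inv: "\<And>g h. g \<in> carrier_mat m m \<Longrightarrow> h \<in> carrier_mat n n \<Longrightarrow> upper_triangular g \<Longrightarrow> upper_triangular h \<Longrightarrow>
      (\<And>i. i < m \<Longrightarrow> g $$ (i, i) = 1) \<Longrightarrow> (\<And>i. i < n \<Longrightarrow> h $$ (i, i) = 1) \<Longrightarrow>
      ext_mat (m * n) d (kron g h) *\<^sub>v f = f"
    and k: "k < ext_dim (m * n) d" and nz: "f $ k \<noteq> 0"
  shows "\<exists>lam. lam \<turnstile> d \<and> (\<lambda>(i, j). i * n + j) ` diagram lam = set (ext_index (m * n) d ! k) \<and>
    (\<forall>(i, j) \<in> diagram lam. i < m \<and> j < n)"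
proof -
  define N where "N = m * n"
  define B where "B = ext_index N d ! k"
  note Bk = ext_index_nth[OF k, folded N_def, folded B_def]
  \<comment> \<open>\<open>f\<close> as an alternating function of lists of indices in any order and
    with repetitions, since moving cells leads out of the increasing lists.\<close>
  define F where "F qs = f \<bullet> wedge N (map (unit_vec N) qs)" for qs
  have fN: "f \<in> carrier_vec (ext_dim N d)" using f by (simp add: N_def)
  \<comment> \<open>The matrix \<open>1 + s E\<close>, used with \<open>b < a\<close>, so with its
    entry below the diagonal. Its transpose is upper unipotent and fixes \<open>f\<close>, so
    \<open>f\<close>, read as a form, is invariant under \<open>el\<close> itself.\<close>
  define el where "el q a b s = mat q q (\<lambda>(i, j). if i = j then 1 else if i = a \<and> j = b then s else 0)"
    for q a b :: nat and s :: complex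
  have el: "el q a b s \<in> carrier_mat q q" "transpose_mat (el q a b s) \<in> carrier_mat q q"
    "b < a \<Longrightarrow> upper_triangular (transpose_mat (el q a b s))" "i < q \<Longrightarrow> transpose_mat (el q a b s) $$ (i, i) = 1"
    for q a b s i by (auto simp: el_def upper_triangular_def)
  have one: "upper_triangular (1\<^sub>m q :: complex mat)" for q by auto
  have mem: "qs ! r < N" if "length qs = d" "set qs \<subseteq> {..<N}" "r < d" for qs r
    using that by (metis lessThan_iff nth_mem subsetD)
  have F0: "f \<bullet> wedge N ((map (unit_vec N) qs)[r := 0\<^sub>v N]) = 0" if "length qs = d" "set qs \<subseteq> {..<N}" "r < d" for qs r
  proof -
    have us: "length (map (unit_vec N) qs) = d" "set (map (unit_vec N) qs) \<subseteq> (carrier_vec N :: complex vec set)"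
      using that by auto
    have "wedge N ((map (unit_vec N) qs)[r := 0 \<cdot>\<^sub>v 0\<^sub>v N]) = 0 \<cdot>\<^sub>v wedge N ((map (unit_vec N) qs)[r := 0\<^sub>v N])"
      by (rule alternatingD(3)[OF alternating_wedge us that(3)]) simp
    moreover have "0 \<cdot>\<^sub>v 0\<^sub>v N = (0\<^sub>v N :: complex vec)" by auto
    ultimately have "wedge N ((map (unit_vec N) qs)[r := 0\<^sub>v N]) = 0 \<cdot>\<^sub>v wedge N ((map (unit_vec N) qs)[r := 0\<^sub>v N])"
      by metis
    then have "f \<bullet> wedge N ((map (unit_vec N) qs)[r := 0\<^sub>v N]) = 0 * (f \<bullet> wedge N ((map (unit_vec N) qs)[r := 0\<^sub>v N]))"
      using fN wedge_carrier[of "(map (unit_vec N) qs)[r := 0\<^sub>v N]" d N] that(1)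
      by (metis length_list_update length_map scalar_prod_smult_distrib)
    then show ?thesis by simp
  qed
  have row: "(\<Sum>r<d. if qs ! r div n = b then F (qs[r := a * n + qs ! r mod n]) else 0) = 0"
    if qs: "length qs = d" "set qs \<subseteq> {..<N}" and ab: "b < a" "a < m" for qs a b
  proof -
    \<comment> \<open>The first-order term of the elementary matrix: it moves a cell of row
      \<open>b\<close> to row \<open>a\<close> and kills all other cells.\<close>
    define y where "y q = (if q div n = b then unit_vec N (a * n + q mod n) else 0\<^sub>v N :: complex vec)" for q
    have "(\<Sum>r<d. f \<bullet> wedge N ((map (unit_vec N) qs)[r := y (qs ! r)])) = 0"
    proof (rule infinitesimal_invariance[OF fN _ _ _ _ qs, where A = "\<lambda>s. kron (el m a b s) (1\<^sub>m n)"])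
      show "kron (el m a b s) (1\<^sub>m n) \<in> carrier_mat N N" for s
        unfolding N_def by (rule kron_carrier[OF el(1) one_carrier_mat])
      show "ext_mat N d (transpose_mat (kron (el m a b s) (1\<^sub>m n))) *\<^sub>v f = f" for s
        unfolding transpose_kron[OF el(1) one_carrier_mat] N_def
        using inv[OF el(2) one_carrier_mat el(3)[OF ab(1)] one el(4), of s] by simp
      show "y q \<in> carrier_vec N" if "q < N" for q by (simp add: y_def)
      fix s q assume q: "q < N"
      show "kron (el m a b s) (1\<^sub>m n) *\<^sub>v unit_vec N q = unit_vec N q + s \<cdot>\<^sub>v y q"
      proof (rule eq_vecI)
        fix p assume "p < dim_vec (unit_vec N q + s \<cdot>\<^sub>v y q)"
        then have p: "p < N" by (auto simp: y_def split: if_splits)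
        note pm = grid_div_mod[OF p[unfolded N_def]] and qm = grid_div_mod[OF q[unfolded N_def]]
        have "(kron (el m a b s) (1\<^sub>m n) *\<^sub>v unit_vec N q) $ p = kron (el m a b s) (1\<^sub>m n) $$ (p, q)"
          using p q kron_carrier[OF el(1) one_carrier_mat, of m a b s n]
          by (simp add: mult_mat_unit_vec[of _ N N] N_def)
        also have "\<dots> = el m a b s $$ (p div n, q div n) * (if p mod n = q mod n then 1 else 0)"
          using p q pm qm by (simp add: index_kron[OF el(1) one_carrier_mat] N_def)
        also have "\<dots> = (if p = q then 1 else 0) + s * (if q div n = b \<and> p = a * n + q mod n then 1 else 0)"
        proof -
          have 1: "p = q \<longleftrightarrow> p div n = q div n \<and> p mod n = q mod n" by (metis div_mult_mod_eq)
          have 2: "p = a * n + q mod n \<longleftrightarrow> p div n = a \<and> p mod n = q mod n"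
          proof
            assume "p div n = a \<and> p mod n = q mod n"
            then show "p = a * n + q mod n" using div_mult_mod_eq[of p n] by simp
          qed (use qm(2) in simp)
          show ?thesis unfolding 1 2 using pm qm ab by (auto simp: el_def)
        qed
        also have "\<dots> = (unit_vec N q + s \<cdot>\<^sub>v y q) $ p"
          using p q ab qm by (auto simp: y_def N_def grid_less)
        finally show "(kron (el m a b s) (1\<^sub>m n) *\<^sub>v unit_vec N q) $ p = (unit_vec N q + s \<cdot>\<^sub>v y q) $ p" .
      qed (auto simp: y_def kron_def el_def N_def)
    qed
    moreover have "f \<bullet> wedge N ((map (unit_vec N) qs)[r := y (qs ! r)]) =
        (if qs ! r div n = b then F (qs[r := a * n + qs ! r mod n]) else 0)" if "r < d" for r
      using F0[OF qs that] by (auto simp: y_def F_def map_update)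
    ultimately show ?thesis by simp
  qed
  have col: "(\<Sum>r<d. if qs ! r mod n = b then F (qs[r := qs ! r div n * n + a]) else 0) = 0"
    if qs: "length qs = d" "set qs \<subseteq> {..<N}" and ab: "b < a" "a < n" for qs a b
  proof -
    define y where "y q = (if q mod n = b then unit_vec N (q div n * n + a) else 0\<^sub>v N :: complex vec)" for q
    have "(\<Sum>r<d. f \<bullet> wedge N ((map (unit_vec N) qs)[r := y (qs ! r)])) = 0"
    proof (rule infinitesimal_invariance[OF fN _ _ _ _ qs, where A = "\<lambda>s. kron (1\<^sub>m m) (el n a b s)"])
      show "kron (1\<^sub>m m) (el n a b s) \<in> carrier_mat N N" for s
        unfolding N_def by (rule kron_carrier[OF one_carrier_mat el(1)])
      show "ext_mat N d (transpose_mat (kron (1\<^sub>m m) (el n a b s))) *\<^sub>v f = f" for s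
        unfolding transpose_kron[OF one_carrier_mat el(1)] N_def
        using inv[OF one_carrier_mat el(2) one el(3)[OF ab(1)] _ el(4), of s] by simp
      show "y q \<in> carrier_vec N" if "q < N" for q by (simp add: y_def)
      fix s q assume q: "q < N"
      show "kron (1\<^sub>m m) (el n a b s) *\<^sub>v unit_vec N q = unit_vec N q + s \<cdot>\<^sub>v y q"
      proof (rule eq_vecI)
        fix p assume "p < dim_vec (unit_vec N q + s \<cdot>\<^sub>v y q)"
        then have p: "p < N" by (auto simp: y_def split: if_splits)
        note pm = grid_div_mod[OF p[unfolded N_def]] and qm = grid_div_mod[OF q[unfolded N_def]]
        have "(kron (1\<^sub>m m) (el n a b s) *\<^sub>v unit_vec N q) $ p = kron (1\<^sub>m m) (el n a b s) $$ (p, q)"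
          using p q kron_carrier[OF one_carrier_mat el(1), of m n a b s]
          by (simp add: mult_mat_unit_vec[of _ N N] N_def)
        also have "\<dots> = (if p div n = q div n then 1 else 0) * el n a b s $$ (p mod n, q mod n)"
          using p q pm qm by (simp add: index_kron[OF one_carrier_mat el(1)] N_def)
        also have "\<dots> = (if p = q then 1 else 0) + s * (if q mod n = b \<and> p = q div n * n + a then 1 else 0)"
        proof -
          have 1: "p = q \<longleftrightarrow> p div n = q div n \<and> p mod n = q mod n" by (metis div_mult_mod_eq)
          have 2: "p = q div n * n + a \<longleftrightarrow> p div n = q div n \<and> p mod n = a"
          proof
            assume "p div n = q div n \<and> p mod n = a"
            then show "p = q div n * n + a" using div_mult_mod_eq[of p n] by simp
          qed (use ab(2) in simp)
          show ?thesis unfolding 1 2 using pm qm ab by (auto simp: el_def)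
        qed
        also have "\<dots> = (unit_vec N q + s \<cdot>\<^sub>v y q) $ p"
          using p q ab qm by (auto simp: y_def N_def grid_less)
        finally show "(kron (1\<^sub>m m) (el n a b s) *\<^sub>v unit_vec N q) $ p = (unit_vec N q + s \<cdot>\<^sub>v y q) $ p" .
      qed (auto simp: y_def kron_def el_def N_def)
    qed
    moreover have "f \<bullet> wedge N ((map (unit_vec N) qs)[r := y (qs ! r)]) =
        (if qs ! r mod n = b then F (qs[r := qs ! r div n * n + a]) else 0)" if "r < d" for r
      using F0[OF qs that] by (auto simp: y_def F_def map_update)
    ultimately show ?thesis by simp
  qed
  have swap: "F (B[i := x, j := y]) = - F (B[i := y, j := x])" if "i < d" "j < d" "i \<noteq> j" "x < N" "y < N" for i j x y
  proof -
    have us: "length (map (unit_vec N) B) = d" "set (map (unit_vec N) B) \<subseteq> (carrier_vec N :: complex vec set)"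
      using Bk by auto
    have c: "wedge N (map (unit_vec N) (B[i := x, j := y])) \<in> carrier_vec (ext_dim N d)" for x y
      using Bk(1) by (intro wedge_carrier) simp
    have "wedge N (map (unit_vec N) (B[i := x, j := y])) + wedge N (map (unit_vec N) (B[i := y, j := x])) = 0\<^sub>v (ext_dim N d)"
      using alternating_swap[OF alternating_wedge us that(1-3) unit_vec_carrier[of N x] unit_vec_carrier[of N y]]
      by (simp add: map_update)
    then have "f \<bullet> (wedge N (map (unit_vec N) (B[i := x, j := y])) + wedge N (map (unit_vec N) (B[i := y, j := x]))) = 0"
      using fN by simp
    then show ?thesis
      unfolding F_def by (subst (asm) scalar_prod_add_distrib[OF fN c c]) (simp add: eq_neg_iff_add_eq_0)
  qed
  have "F B = f $ k" using k fN wedge_basis[of k N d] by (simp add: F_def B_def N_def)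
  then have FB: "F B \<noteq> 0" using nz by simp
  have eq: "2 * (\<Sum>s<d. B ! s div n + B ! s mod n) =
    card {(s, r) \<in> {..<d} \<times> {..<d}. (B ! s div n = B ! r div n) \<noteq> (B ! s mod n = B ! r mod n)}"
    by (rule swap_cancellation[of d m n F B, OF row col swap Bk(1) Bk(3)[unfolded N_def] FB]) (simp_all add: N_def)
  define c where "c s = (B ! s div n, B ! s mod n)" for s
  define S where "S = c ` {..<d}"
  have dist: "distinct B" using Bk(2) strict_sorted_iff by blast
  have inj: "inj_on c {..<d}"
  proof (rule inj_onI)
    fix s r assume sr: "s \<in> {..<d}" "r \<in> {..<d}" "c s = c r"
    then have "B ! s = B ! r" unfolding c_def by (metis div_mult_mod_eq prod.inject)
    then show "s = r" using dist sr Bk(1) by (simp add: nth_eq_iff_index_eq)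
  qed
  have cS: "card S = d" using card_image[OF inj] by (simp add: S_def)
  have "\<exists>lam. lam \<turnstile> card S \<and> diagram lam = S"
  proof (rule diagram_criterion)
    have "{(p, q) \<in> S \<times> S. (fst p = fst q) \<noteq> (snd p = snd q)} =
      map_prod c c ` {(s, r) \<in> {..<d} \<times> {..<d}. (B ! s div n = B ! r div n) \<noteq> (B ! s mod n = B ! r mod n)}"
    proof (intro equalityI subsetI)
      fix z assume "z \<in> {(p, q) \<in> S \<times> S. (fst p = fst q) \<noteq> (snd p = snd q)}"
      then obtain s r where sr: "s < d" "r < d" "z = (c s, c r)" "(fst (c s) = fst (c r)) \<noteq> (snd (c s) = snd (c r))"
        unfolding S_def by blast
      then show "z \<in> map_prod c c ` {(s, r) \<in> {..<d} \<times> {..<d}. (B ! s div n = B ! r div n) \<noteq> (B ! s mod n = B ! r mod n)}"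
        by (intro image_eqI[of _ _ "(s, r)"]) (auto simp: c_def)
    next
      fix z assume "z \<in> map_prod c c ` {(s, r) \<in> {..<d} \<times> {..<d}. (B ! s div n = B ! r div n) \<noteq> (B ! s mod n = B ! r mod n)}"
      then obtain s r where "s < d" "r < d" "z = (c s, c r)" "(B ! s div n = B ! r div n) \<noteq> (B ! s mod n = B ! r mod n)"
        by auto
      moreover from this have "c s \<in> S" "c r \<in> S" by (auto simp: S_def)
      ultimately show "z \<in> {(p, q) \<in> S \<times> S. (fst p = fst q) \<noteq> (snd p = snd q)}" by (simp add: c_def)
    qed
    moreover have "inj_on (map_prod c c) {(s, r) \<in> {..<d} \<times> {..<d}. (B ! s div n = B ! r div n) \<noteq> (B ! s mod n = B ! r mod n)}"
      by (rule inj_on_subset[OF map_prod_inj_on[OF inj inj]]) auto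
    ultimately have "card {(p, q) \<in> S \<times> S. (fst p = fst q) \<noteq> (snd p = snd q)} =
      card {(s, r) \<in> {..<d} \<times> {..<d}. (B ! s div n = B ! r div n) \<noteq> (B ! s mod n = B ! r mod n)}"
      by (simp add: card_image)
    then show "2 * (\<Sum>p\<in>S. fst p + snd p) = card {(p, q) \<in> S \<times> S. (fst p = fst q) \<noteq> (snd p = snd q)}"
      using eq sum.reindex[OF inj, of "\<lambda>p. fst p + snd p"] by (simp add: S_def c_def)
  qed (simp add: S_def)
  then obtain lam where lam: "lam \<turnstile> d" "diagram lam = S" using cS by auto
  have "(\<lambda>(i, j). i * n + j) ` S = (\<lambda>s. B ! s) ` {..<d}" by (auto simp: S_def c_def image_image)
  also have "\<dots> = set B" using Bk(1) by (auto simp: set_conv_nth)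
  finally have "(\<lambda>(i, j). i * n + j) ` diagram lam = set B" using lam(2) by simp
  moreover have "\<forall>(i, j) \<in> diagram lam. i < m \<and> j < n"
    unfolding lam(2) S_def c_def using grid_div_mod[OF mem[OF Bk(1,3), unfolded N_def]] by auto
  ultimately show ?thesis using lam(1) by (auto simp: B_def N_def)
qed

section \<open>Skew Howe duality\<close>

text \<open>The partitions whose diagrams lie in a box of \<open>m\<close> rows and \<open>n\<close>
  columns, that is, those for which both tensor factors are nonzero.\<close>

definition fitting :: "nat \<Rightarrow> nat \<Rightarrow> nat \<Rightarrow> nat list set" where
  "fitting m n d = {lam. lam \<turnstile> d \<and> length lam \<le> m \<and> length (conjugate_part lam) \<le> n}"

lemma is_partition_nth_pos: "lam \<turnstile> d \<Longrightarrow> i < length lam \<Longrightarrow> 0 < lam ! i"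
  by (metis gr0I is_partition_def nth_mem)

lemma fitting_iff: "lam \<in> fitting m n d \<longleftrightarrow> lam \<turnstile> d \<and> (\<forall>(i, j) \<in> diagram lam. i < m \<and> j < n)"
proof (cases "lam \<turnstile> d")
  case lam: True
  have "length lam \<le> m \<longleftrightarrow> (\<forall>(i, j) \<in> diagram lam. i < m)"
  proof
    assume *: "\<forall>(i, j) \<in> diagram lam. i < m"
    show "length lam \<le> m"
    proof (rule ccontr)
      assume "\<not> length lam \<le> m"
      then have "(m, 0) \<in> diagram lam" using is_partition_nth_pos[OF lam, of m] by (simp add: diagram_def)
      then show False using * by auto
    qed
  qed (auto simp: diagram_def)
  moreover have "length (conjugate_part lam) \<le> n \<longleftrightarrow> (\<forall>(i, j) \<in> diagram lam. j < n)"
    unfolding length_conjugate Max_parts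
  proof
    assume *: "\<forall>(i, j) \<in> diagram lam. j < n"
    show "\<forall>i<length lam. lam ! i \<le> n"
    proof (intro allI impI, rule ccontr)
      fix i assume "i < length lam" "\<not> lam ! i \<le> n"
      then have "(i, n) \<in> diagram lam" by (simp add: diagram_def)
      then show False using * by auto
    qed
  qed (auto simp: diagram_def)
  ultimately show ?thesis using lam by (auto simp: fitting_def)
qed (simp add: fitting_def)

section \<open>Diagrams as basis vectors of the exterior power\<close>

lemma diagram_inj:
  assumes "lam \<turnstile> d" "mu \<turnstile> d'" and eq: "diagram lam = diagram mu"
  shows "lam = mu"
proof -
  have len: "i < length lam \<longleftrightarrow> (i, 0) \<in> diagram lam" if "lam \<turnstile> d" for lam d i
    using is_partition_nth_pos[OF that, of i] by (auto simp: diagram_def)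
  have "i < length lam \<longleftrightarrow> i < length mu" for i using len[OF assms(1)] len[OF assms(2)] eq by simp
  then have l: "length lam = length mu" by (metis linorder_neqE_nat less_irrefl)
  show ?thesis
  proof (rule nth_equalityI[OF l])
    fix i assume "i < length lam"
    then have "j < lam ! i \<longleftrightarrow> j < mu ! i" for j using arg_cong[OF eq, of "\<lambda>X. (i, j) \<in> X"] l by (simp add: diagram_def)
    then show "lam ! i = mu ! i" by (metis linorder_neqE_nat less_irrefl)
  qed
qed

definition cells :: "nat \<Rightarrow> nat list \<Rightarrow> nat set" where
  "cells n lam = (\<lambda>(i, j). i * n + j) ` diagram lam"

text \<open>The position of \<open>w\<^sub>\<lambda>\<close> among the basis vectors of the exterior
  power; the increasing order used in \<open>ext_index\<close> fixes its sign.\<close>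

definition diagram_index :: "nat \<Rightarrow> nat \<Rightarrow> nat \<Rightarrow> nat list \<Rightarrow> nat" where
  "diagram_index m n d lam = (SOME k. k < ext_dim (m * n) d \<and> set (ext_index (m * n) d ! k) = cells n lam)"

lemma inj_on_cell: "inj_on (\<lambda>(i, j). i * n + j) {(i, j). j < (n :: nat)}"
proof (rule inj_onI)
  fix p q :: "nat \<times> nat"
  assume pq: "p \<in> {(i, j). j < n}" "q \<in> {(i, j). j < n}" and eq: "(\<lambda>(i, j). i * n + j) p = (\<lambda>(i, j). i * n + j) q"
  have dm: "(i * n + j) div n = i" "(i * n + j) mod n = j" if "j < n" for i j using that by auto
  obtain i j i' j' where p: "p = (i, j)" "q = (i', j')" by (cases p, cases q)
  have e: "i * n + j = i' * n + j'" and j: "j < n" "j' < n" using pq eq unfolding p by auto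
  have "i = i'" using dm(1)[OF j(1), of i] dm(1)[OF j(2), of i'] unfolding e by (rule box_equals[OF refl])
  moreover have "j = j'" using dm(2)[OF j(1), of i] dm(2)[OF j(2), of i'] unfolding e by (rule box_equals[OF refl])
  ultimately show "p = q" by (simp add: p)
qed

lemma diagram_index:
  assumes "lam \<in> fitting m n d"
  shows "diagram_index m n d lam < ext_dim (m * n) d"
    and "set (ext_index (m * n) d ! diagram_index m n d lam) = cells n lam"
proof -
  have lam: "lam \<turnstile> d" and box: "\<And>i j. (i, j) \<in> diagram lam \<Longrightarrow> i < m \<and> j < n"
    using assms by (auto simp: fitting_iff)
  have "inj_on (\<lambda>(i, j). i * n + j) (diagram lam)"
    by (rule inj_on_subset[OF inj_on_cell]) (use box in auto)
  then have "card (cells n lam) = d"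
    using lam card_diagram[of lam] by (simp add: cells_def card_image is_partition_def)
  moreover have "cells n lam \<subseteq> {..<m * n}" using box by (auto simp: cells_def grid_less)
  ultimately have "\<exists>k<ext_dim (m * n) d. set (ext_index (m * n) d ! k) = cells n lam" by (intro ext_index_ex)
  then have "diagram_index m n d lam < ext_dim (m * n) d \<and> set (ext_index (m * n) d ! diagram_index m n d lam) = cells n lam"
    unfolding diagram_index_def by (rule someI_ex)
  then show "diagram_index m n d lam < ext_dim (m * n) d"
    "set (ext_index (m * n) d ! diagram_index m n d lam) = cells n lam" by auto
qed

lemma diagram_index_inj:
  assumes "lam \<in> fitting m n d" "mu \<in> fitting m n d" "diagram_index m n d lam = diagram_index m n d mu"
  shows "lam = mu"
proof -
  have "cells n lam = cells n mu" using diagram_index(2)[OF assms(1)] diagram_index(2)[OF assms(2)] assms(3) by simp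
  moreover have "diagram lam \<subseteq> {(i, j). j < n}" "diagram mu \<subseteq> {(i, j). j < n}"
    using assms(1,2) by (auto simp: fitting_iff)
  ultimately have "diagram lam = diagram mu"
    unfolding cells_def using inj_on_image_eq_iff[OF inj_on_cell[of n]] by metis
  then show ?thesis using diagram_inj assms(1,2) by (auto simp: fitting_def)
qed

lemma upper_triangular_kron:
  assumes g: "g \<in> carrier_mat m m" "upper_triangular g" and h: "h \<in> carrier_mat n n" "upper_triangular h"
  shows "upper_triangular (kron g h)"
proof
  fix k l assume kl: "l < k" "k < dim_row (kron g h)"
  then have k: "k < m * n" "l < m * n" using kron_carrier[OF g(1) h(1)] by auto
  note dm = grid_div_mod[OF k(1)] grid_div_mod[OF k(2)]
  have "l div n \<le> k div n" using kl(1) by (intro div_le_mono) simp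
  moreover have "l mod n < k mod n" if "l div n = k div n"
    using that kl(1) by (metis add_less_cancel_left div_mult_mod_eq)
  ultimately have "l div n < k div n \<or> l mod n < k mod n" by linarith
  then show "kron g h $$ (k, l) = 0"
    unfolding index_kron[OF g(1) h(1) k] using g h dm by (auto simp: upper_triangular_def)
qed

text \<open>Upper triangular matrices move a cell only up and to the left, so the cells of a diagram
  span an invariant subspace and \<open>ext_mat_triangular\<close> applies. The rows give the weight
  \<open>lam\<close>, the columns, read through \<open>diagram_conjugate\<close>, the weight
  \<open>conjugate_part lam\<close>.\<close>

lemma diagram_vector_triangular:
  assumes lam: "lam \<in> fitting m n d"
    and g: "g \<in> carrier_mat m m" "upper_triangular g" and h: "h \<in> carrier_mat n n" "upper_triangular h"
  defines "w \<equiv> unit_vec (ext_dim (m * n) d) (diagram_index m n d lam)"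
  shows "ext_mat (m * n) d (kron g h) *\<^sub>v w =
    ((\<Prod>c\<in>diagram lam. g $$ (fst c, fst c)) * (\<Prod>c\<in>diagram (conjugate_part lam). h $$ (fst c, fst c))) \<cdot>\<^sub>v w"
proof -
  have part: "lam \<turnstile> d" and box: "\<And>i j. (i, j) \<in> diagram lam \<Longrightarrow> i < m \<and> j < n"
    using lam by (auto simp: fitting_iff)
  note I = diagram_index[OF lam]
  have dm: "(i * n + j) div n = i" "(i * n + j) mod n = j" if "j < n" for i j using that by auto
  have zero: "kron g h $$ (k, l) = 0" if k: "k < m * n" "k \<notin> cells n lam" and l: "l \<in> cells n lam" for k l
  proof -
    obtain i j where ij: "(i, j) \<in> diagram lam" "l = i * n + j" using l by (auto simp: cells_def)
    have b: "i < m" "j < n" using box[OF ij(1)] by auto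
    note km = grid_div_mod[OF k(1)]
    have "\<not> (k div n \<le> i \<and> k mod n \<le> j)"
    proof
      assume "k div n \<le> i \<and> k mod n \<le> j"
      then have "(k div n, k mod n) \<in> diagram lam" using diagram_down[OF part ij(1)] by blast
      then have "k div n * n + k mod n \<in> cells n lam" unfolding cells_def by force
      then show False using k(2) by simp
    qed
    then have "g $$ (k div n, i) = 0 \<or> h $$ (k mod n, j) = 0"
      using g h km by (auto simp: upper_triangular_def)
    then show ?thesis
      using index_kron[OF g(1) h(1) k(1), of l] grid_less[OF b] by (auto simp: ij(2) b dm[OF b(2)])
  qed
  have inj: "inj_on (\<lambda>(i, j). i * n + j) (diagram lam)"
    by (rule inj_on_subset[OF inj_on_cell]) (use box in auto)
  have "(\<Prod>q\<in>cells n lam. kron g h $$ (q, q)) = (\<Prod>c\<in>diagram lam. kron g h $$ (fst c * n + snd c, fst c * n + snd c))"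
    unfolding cells_def prod.reindex[OF inj] by (simp add: case_prod_unfold)
  also have "\<dots> = (\<Prod>c\<in>diagram lam. g $$ (fst c, fst c) * h $$ (snd c, snd c))"
  proof (intro prod.cong refl)
    fix c assume "c \<in> diagram lam"
    then have b: "fst c < m" "snd c < n" using box[of "fst c" "snd c"] by auto
    show "kron g h $$ (fst c * n + snd c, fst c * n + snd c) = g $$ (fst c, fst c) * h $$ (snd c, snd c)"
      using index_kron[OF g(1) h(1) grid_less[OF b] grid_less[OF b]] by (simp add: dm[OF b(2)] b)
  qed
  also have "\<dots> = (\<Prod>c\<in>diagram lam. g $$ (fst c, fst c)) * (\<Prod>c\<in>diagram (conjugate_part lam). h $$ (fst c, fst c))"
    unfolding diagram_conjugate[OF part] by (subst prod.reindex) (auto simp: prod.distrib)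
  finally show ?thesis
    using ext_mat_triangular[OF kron_carrier[OF g(1) h(1)] upper_triangular_kron[OF g h] I(1), unfolded I(2)] zero
    unfolding w_def by simp
qed

section \<open>The exterior power under the pair of groups\<close>

lemma ext_kron_mult:
  assumes "g \<in> carrier_mat m m" "h \<in> carrier_mat n n" "g' \<in> carrier_mat m m" "h' \<in> carrier_mat n n"
  shows "ext_mat (m * n) d (kron (g * g') (h * h')) = ext_mat (m * n) d (kron g h) * ext_mat (m * n) d (kron g' h')"
  unfolding kron_mult[OF assms, symmetric]
  by (rule ext_mat_mult[OF kron_carrier[OF assms(1,2)] kron_carrier[OF assms(3,4)]])

lemma polyfun_ext_kron:
  assumes g: "\<And>t. g t \<in> carrier_mat m m" "\<And>i j. i < m \<Longrightarrow> j < m \<Longrightarrow> polyfun (\<lambda>t. g t $$ (i, j))"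
    and h: "\<And>t. h t \<in> carrier_mat n n" "\<And>i j. i < n \<Longrightarrow> j < n \<Longrightarrow> polyfun (\<lambda>t. h t $$ (i, j))"
    and kl: "k < ext_dim (m * n) d" "l < ext_dim (m * n) d"
  shows "polyfun (\<lambda>t. ext_mat (m * n) d (kron (g t) (h t)) $$ (k, l))"
proof (rule polyfun_ext_mat[OF kron_carrier[OF g(1) h(1)] _ kl])
  fix i j assume ij: "i < m * n" "j < m * n"
  show "polyfun (\<lambda>t. kron (g t) (h t) $$ (i, j))"
    unfolding index_kron[OF g(1) h(1) ij]
    by (intro polyfun_mult g(2) h(2) grid_div_mod[OF ij(1)] grid_div_mod[OF ij(2)])
qed

text \<open>The vectors killed by all translates of the forms are an invariant subspace
  \<open>Y\<close>. If it were nonzero, a nonzero component \<open>f\<close> of top torus degree in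
  \<open>Y\<close> would be fixed by all unipotent triangular pairs, so a nonzero coordinate of
  \<open>f\<close> would sit at a diagram. But the form of that diagram, at the identity, reads off
  this very coordinate.\<close>

lemma exterior_separates:
  assumes x: "x \<in> carrier_vec (ext_dim (m * n) d)"
    and zero: "\<And>lam g h. lam \<in> fitting m n d \<Longrightarrow> g \<in> carrier (GL m) \<Longrightarrow> h \<in> carrier (GL n) \<Longrightarrow>
      unit_vec (ext_dim (m * n) d) (diagram_index m n d lam) \<bullet> (ext_mat (m * n) d (kron g h) *\<^sub>v x) = 0"
  shows "x = 0\<^sub>v (ext_dim (m * n) d)"
proof (rule ccontr)
  define E where "E = ext_dim (m * n) d"
  define w :: "nat list \<Rightarrow> complex vec" where "w lam = unit_vec E (diagram_index m n d lam)" for lam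
  define \<rho> where "\<rho> g h = ext_mat (m * n) d (kron g h)" for g h
  have wc: "w lam \<in> carrier_vec E" for lam by (simp add: w_def)
  have rc: "\<rho> g h \<in> carrier_mat E E" for g h unfolding \<rho>_def E_def by (rule ext_mat_carrier)
  have rm: "\<rho> (g * g') (h * h') = \<rho> g h * \<rho> g' h'"
    if "g \<in> carrier_mat m m" "h \<in> carrier_mat n n" "g' \<in> carrier_mat m m" "h' \<in> carrier_mat n n" for g h g' h'
    unfolding \<rho>_def by (rule ext_kron_mult[OF that])
  have r1: "\<rho> (1\<^sub>m m) (1\<^sub>m n) = 1\<^sub>m E" by (simp add: \<rho>_def E_def kron_one ext_mat_one)
  define Y where "Y = {y \<in> carrier_vec E. \<forall>lam\<in>fitting m n d. \<forall>g\<in>carrier (GL m). \<forall>h\<in>carrier (GL n).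
    w lam \<bullet> (\<rho> g h *\<^sub>v y) = 0}"
  have Yinv: "\<rho> g h *\<^sub>v y \<in> Y" if y: "y \<in> Y" and gh: "g \<in> carrier (GL m)" "h \<in> carrier (GL n)" for g h y
  proof -
    have yc: "y \<in> carrier_vec E" using y by (simp add: Y_def)
    have "w lam \<bullet> (\<rho> g' h' *\<^sub>v (\<rho> g h *\<^sub>v y)) = 0"
      if "lam \<in> fitting m n d" "g' \<in> carrier (GL m)" "h' \<in> carrier (GL n)" for lam g' h'
    proof -
      have "g' * g \<in> carrier (GL m)" "h' * h \<in> carrier (GL n)"
        using gh that monoid.m_closed[OF group.is_monoid[OF group_GL]] by (metis GL_simps(2))+
      then have "w lam \<bullet> (\<rho> (g' * g) (h' * h) *\<^sub>v y) = 0" using y that(1) by (simp add: Y_def)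
      then show ?thesis
        using rm[of g' h' g h] gh that(2,3) assoc_mult_mat_vec[OF rc rc yc] by (simp add: GL_iff)
    qed
    then show ?thesis using mult_mat_vec_carrier[OF rc yc] by (simp add: Y_def)
  qed
  \<comment> \<open>One parameter for both tori, so that conjugation contracts both triangular
    matrices at once.\<close>
  define T where "T t = \<rho> (torus m t) (torus n t)" for t
  obtain D P where g: "graded E T D P"
  proof (rule graded_exists[of T E])
    show "T t \<in> carrier_mat E E" for t by (simp add: T_def rc)
    show "T (s * t) = T s * T t" for s t by (simp add: T_def torus_simps(2) rm torus_simps(1))
    show "\<exists>f. polyfun f \<and> (\<forall>t. t \<noteq> 0 \<longrightarrow> T t $$ (i, j) = f t)" if "i < E" "j < E" for i j
      by (intro exI[of _ "\<lambda>t. T t $$ (i, j)"] conjI)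
        (use that in \<open>auto simp: T_def \<rho>_def E_def intro!: polyfun_ext_kron torus_simps(1) polyfun_torus\<close>)
  qed
  note G = gradedD[OF g]
  have Pc: "P k *\<^sub>v y \<in> carrier_vec E" if "y \<in> carrier_vec E" for k y using mult_mat_vec_carrier[OF G(1) that] .
  \<comment> \<open>\<open>T t y\<close> stays in \<open>Y\<close> for every
    \<open>t \<noteq> 0\<close>, so each coefficient in \<open>t\<close> of a vanishing pairing
    vanishes.\<close>
  have YP: "P k *\<^sub>v y \<in> Y" if y: "y \<in> Y" and k: "k \<le> D" for k y
  proof -
    have yc: "y \<in> carrier_vec E" using y by (simp add: Y_def)
    have "w lam \<bullet> (\<rho> g' h' *\<^sub>v (P k *\<^sub>v y)) = 0"
      if a: "lam \<in> fitting m n d" "g' \<in> carrier (GL m)" "h' \<in> carrier (GL n)" for lam g' h'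
    proof -
      define z where "z = transpose_mat (\<rho> g' h') *\<^sub>v w lam"
      have z: "z \<in> carrier_vec E" unfolding z_def using rc wc by (intro mult_mat_vec_carrier[of _ E E]) auto
      have zy: "z \<bullet> u = w lam \<bullet> (\<rho> g' h' *\<^sub>v u)" if "u \<in> carrier_vec E" for u
        unfolding z_def by (rule scalar_prod_mult_mat_vec[OF rc that wc, symmetric])
      have "(\<Sum>k\<le>D. t ^ k * (z \<bullet> (P k *\<^sub>v y))) = (\<Sum>k\<le>D. t ^ k * 0)" if t: "t \<noteq> 0" for t
      proof -
        have "T t *\<^sub>v y \<in> Y" unfolding T_def by (intro Yinv y torus_simps(4) t)
        then have "z \<bullet> (T t *\<^sub>v y) = 0" using zy[of "T t *\<^sub>v y"] a by (auto simp: Y_def)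
        then show ?thesis using G(3)[OF t yc z] by simp
      qed
      then have "z \<bullet> (P k *\<^sub>v y) = 0"
        by (rule coeffs_unique[OF _ k, where b = "\<lambda>_. 0" and a = "\<lambda>k. z \<bullet> (P k *\<^sub>v y)"])
      then show ?thesis using zy[OF Pc[OF yc]] by simp
    qed
    then show ?thesis using Pc[OF yc] by (simp add: Y_def)
  qed
  assume "x \<noteq> 0\<^sub>v (ext_dim (m * n) d)"
  moreover have xY: "x \<in> Y" using x zero by (auto simp: Y_def E_def w_def \<rho>_def)
  ultimately obtain k0 where k0: "k0 \<le> D" "P k0 *\<^sub>v x \<noteq> 0\<^sub>v E"
    using graded_separates[OF g, of x] x by (auto simp: E_def T_def torus_simps(3) r1[unfolded E_def])
  \<comment> \<open>The degrees that occur in \<open>Y\<close>, possibly fewer than those of the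
    whole space. This is why \<open>contraction\<close> asks about higher degrees only at
    \<open>B 1 f\<close>.\<close>
  define Q where "Q k \<longleftrightarrow> k \<le> D \<and> (\<exists>y\<in>Y. P k *\<^sub>v y \<noteq> 0\<^sub>v E)" for k
  define K where "K = (GREATEST k. Q k)"
  have "Q k0" using k0 xY by (auto simp: Q_def)
  then have QK: "Q K" unfolding K_def by (rule GreatestI_nat[where b = D]) (simp add: Q_def)
  have max: "l \<le> K" if "Q l" for l
    unfolding K_def using that by (rule Greatest_le_nat[where b = D]) (simp add: Q_def)
  have K: "K \<le> D" using QK by (simp add: Q_def)
  obtain y where y: "y \<in> Y" "P K *\<^sub>v y \<noteq> 0\<^sub>v E" using QK by (auto simp: Q_def)
  define f where "f = P K *\<^sub>v y"
  have fY: "f \<in> Y" unfolding f_def by (rule YP[OF y(1) K])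
  then have fc: "f \<in> carrier_vec E" by (simp add: Y_def)
  have upper: "\<rho> a b *\<^sub>v f = \<rho> (mat_diag m (\<lambda>i. a $$ (i, i))) (mat_diag n (\<lambda>i. b $$ (i, i))) *\<^sub>v f"
    if a: "upper_triangular a" "a \<in> carrier (GL m)" and b: "upper_triangular b" "b \<in> carrier (GL n)" for a b
  proof -
    have ac: "a \<in> carrier_mat m m" and bc: "b \<in> carrier_mat n n" using a(2) b(2) by (auto simp: GL_iff)
    note A = conj_torus[OF a(1) ac] and B = conj_torus[OF b(1) bc]
    define C where "C t = \<rho> (conj_torus a t) (conj_torus b t)" for t
    have "C 1 *\<^sub>v f = C 0 *\<^sub>v f"
    proof (rule contraction[OF g K])
      show "C t \<in> carrier_mat E E" for t by (simp add: C_def rc)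
      show "polyfun (\<lambda>t. C t $$ (i, j))" if "i < E" "j < E" for i j
        unfolding C_def \<rho>_def using that by (intro polyfun_ext_kron A(1,3) B(1,3)) (auto simp: E_def)
      show "T t * C 1 = C t * T t" for t
        unfolding C_def T_def A(5) B(5)
        by (simp add: rm[OF torus_simps(1) torus_simps(1) ac bc, symmetric]
          rm[OF A(1) B(1) torus_simps(1) torus_simps(1), symmetric] A(4) B(4))
      show "T t *\<^sub>v f = t ^ K \<cdot>\<^sub>v f" if "t \<noteq> 0" for t
        unfolding f_def using y(1) by (intro graded_eigen[OF g K that]) (simp add: Y_def)
      show "P l *\<^sub>v (C 1 *\<^sub>v f) = 0\<^sub>v E" if "K < l" "l \<le> D" for l
      proof (rule ccontr)
        assume "P l *\<^sub>v (C 1 *\<^sub>v f) \<noteq> 0\<^sub>v E"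
        moreover have "C 1 *\<^sub>v f \<in> Y" unfolding C_def A(5) B(5) by (rule Yinv[OF fY a(2) b(2)])
        ultimately have "Q l" using that(2) by (auto simp: Q_def)
        then show False using max[of l] that(1) by simp
      qed
    qed (rule fc)
    then show ?thesis by (simp add: C_def A(5,6) B(5,6))
  qed
  have "f = 0\<^sub>v E"
  proof (rule eq_vecI)
    fix k assume "k < dim_vec (0\<^sub>v E :: complex vec)"
    then have k: "k < ext_dim (m * n) d" by (simp add: E_def)
    show "f $ k = 0\<^sub>v E $ k"
    proof (rule ccontr)
      assume "f $ k \<noteq> 0\<^sub>v E $ k"
      then have nz: "f $ k \<noteq> 0" using k by (simp add: E_def)
      have inv: "ext_mat (m * n) d (kron a b) *\<^sub>v f = f"
        if ab: "a \<in> carrier_mat m m" "b \<in> carrier_mat n n" "upper_triangular a" "upper_triangular b"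
          and one: "\<And>i. i < m \<Longrightarrow> a $$ (i, i) = 1" "\<And>i. i < n \<Longrightarrow> b $$ (i, i) = 1" for a b
      proof -
        have "a \<in> carrier (GL m)" "b \<in> carrier (GL n)"
          using upper_triangular_GL[OF ab(3,1)] upper_triangular_GL[OF ab(4,2)] one by auto
        moreover have "mat_diag m (\<lambda>i. a $$ (i, i)) = 1\<^sub>m m" "mat_diag n (\<lambda>i. b $$ (i, i)) = 1\<^sub>m n"
          using one by (auto simp: mat_diag_def intro!: eq_matI)
        ultimately show ?thesis using upper[OF ab(3) _ ab(4), of] r1 fc by (simp add: \<rho>_def)
      qed
      obtain lam where lam: "lam \<turnstile> d" "cells n lam = set (ext_index (m * n) d ! k)" "\<forall>(i, j) \<in> diagram lam. i < m \<and> j < n"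
        using unipotent_fixed_support[OF fc[unfolded E_def] inv k nz] unfolding cells_def by blast
      then have fit: "lam \<in> fitting m n d" by (simp add: fitting_iff)
      have "diagram_index m n d lam = k"
        by (rule ext_index_inj[OF diagram_index(1)[OF fit] k]) (simp add: diagram_index(2)[OF fit] lam(2))
      then have "w lam \<bullet> (\<rho> (1\<^sub>m m) (1\<^sub>m n) *\<^sub>v f) = f $ k" using fc k by (simp add: r1 w_def E_def)
      moreover have "w lam \<bullet> (\<rho> (1\<^sub>m m) (1\<^sub>m n) *\<^sub>v f) = 0"
        using fY fit by (simp add: Y_def GL_iff)
      ultimately show False using nz by simp
    qed
  qed (use fc in simp)
  then show False using y(2) by (simp add: f_def)
qed

text \<open>The same basis vectors serve as vectors and as forms, because transposing the action
  amounts to transposing both group elements; for the same reason separation by the forms yields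
  separation by the vectors. The coefficient \<open>c\<close> is an entry of \<open>ext_mat\<close>,
  hence polynomial along every polynomial curve of pairs of matrices.\<close>

lemma exterior_framed:
  fixes m n d :: nat
  defines "W \<equiv> ext_rep d (tensor_rep (pullback fst (defining_rep m)) (pullback snd (defining_rep n)))"
    and "w \<equiv> \<lambda>lam. unit_vec (ext_dim (m * n) d) (diagram_index m n d lam)"
    and "c \<equiv> \<lambda>lam g. ext_mat (m * n) d (kron (fst g) (snd g)) $$ (diagram_index m n d lam, diagram_index m n d lam)"
    and "chi1 \<equiv> \<lambda>lam b. \<Prod>c\<in>diagram lam. b $$ (fst c, fst c)"
  shows "framed (GL m \<times>\<times> GL n) W (fitting m n d) w w c"
    and "lam \<in> fitting m n d \<Longrightarrow> l \<in> carrier (GL m) \<Longrightarrow> u \<in> carrier (GL m) \<Longrightarrow> l' \<in> carrier (GL n) \<Longrightarrow> u' \<in> carrier (GL n) \<Longrightarrow>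
      upper_triangular (transpose_mat l) \<Longrightarrow> upper_triangular u \<Longrightarrow>
      upper_triangular (transpose_mat l') \<Longrightarrow> upper_triangular u' \<Longrightarrow>
      c lam (l * u, l' * u') = chi1 lam l * chi1 lam u * (chi1 (conjugate_part lam) l' * chi1 (conjugate_part lam) u')"
proof -
  define E where "E = ext_dim (m * n) d"
  define \<rho> where "\<rho> g h = ext_mat (m * n) d (kron g h)" for g h
  have rc: "\<rho> g h \<in> carrier_mat E E" for g h unfolding \<rho>_def E_def by (rule ext_mat_carrier)
  have rm: "\<rho> (g * g') (h * h') = \<rho> g h * \<rho> g' h'"
    if "g \<in> carrier_mat m m" "h \<in> carrier_mat n n" "g' \<in> carrier_mat m m" "h' \<in> carrier_mat n n" for g h g' h'
    unfolding \<rho>_def by (rule ext_kron_mult[OF that])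
  have rt: "transpose_mat (\<rho> g h) = \<rho> (transpose_mat g) (transpose_mat h)"
    if "g \<in> carrier_mat m m" "h \<in> carrier_mat n n" for g h
    unfolding \<rho>_def transpose_kron[OF that, symmetric] by (rule transpose_ext_mat[OF kron_carrier[OF that]])
  have r1: "\<rho> (1\<^sub>m m) (1\<^sub>m n) = 1\<^sub>m E" by (simp add: \<rho>_def E_def kron_one ext_mat_one)
  have W: "fst W = E" "\<And>g. snd W g = \<rho> (fst g) (snd g)"
    by (simp_all add: W_def E_def \<rho>_def ext_rep_def tensor_rep_def pullback_def defining_rep_def)
  have wc: "w lam \<in> carrier_vec E" for lam by (simp add: w_def E_def)
  have rep: "representation (GL m \<times>\<times> GL n) W"
  proof (rule representationI[OF group_GL_prod])
    show "snd W g \<in> carrier_mat (fst W) (fst W)" for g by (simp add: W rc)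
    show "snd W (g \<otimes>\<^bsub>GL m \<times>\<times> GL n\<^esub> h) = snd W g * snd W h"
      if "g \<in> carrier (GL m \<times>\<times> GL n)" "h \<in> carrier (GL m \<times>\<times> GL n)" for g h
      using that rm by (cases g; cases h) (simp add: W GL_prod_simps(1) GL_simps(2) GL_iff)
    show "snd W \<one>\<^bsub>GL m \<times>\<times> GL n\<^esub> = 1\<^sub>m (fst W)" by (simp add: W GL_simps(3) r1)
  qed
  have w_upper: "\<rho> g h *\<^sub>v w lam = (chi1 lam g * chi1 (conjugate_part lam) h) \<cdot>\<^sub>v w lam"
    if "lam \<in> fitting m n d" "g \<in> carrier_mat m m" "upper_triangular g" "h \<in> carrier_mat n n" "upper_triangular h" for lam g h
    unfolding \<rho>_def w_def chi1_def by (rule diagram_vector_triangular[OF that])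
  have chi_t: "chi1 lam (transpose_mat g) = chi1 lam g" if "lam \<in> fitting m n d" "g \<in> carrier_mat m m" for lam g
    unfolding chi1_def using that by (intro prod.cong refl) (auto simp: fitting_iff)
  have chi_t': "chi1 (conjugate_part lam) (transpose_mat g) = chi1 (conjugate_part lam) g"
    if "lam \<in> fitting m n d" "g \<in> carrier_mat n n" for lam g
  proof -
    have "diagram (conjugate_part lam) = prod.swap ` diagram lam"
      using that(1) by (intro diagram_conjugate[of lam d]) (simp add: fitting_def)
    then show ?thesis unfolding chi1_def using that by (intro prod.cong refl) (auto simp: fitting_iff)
  qed
  have big: "w lam \<bullet> (\<rho> (l * u) (l' * u') *\<^sub>v w mu) =
      chi1 lam l * chi1 (conjugate_part lam) l' * (chi1 mu u * chi1 (conjugate_part mu) u') * (w lam \<bullet> w mu)"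
    if lm: "lam \<in> fitting m n d" "mu \<in> fitting m n d"
      and G: "l \<in> carrier (GL m)" "u \<in> carrier (GL m)" "l' \<in> carrier (GL n)" "u' \<in> carrier (GL n)"
      and tri: "upper_triangular (transpose_mat l)" "upper_triangular u"
        "upper_triangular (transpose_mat l')" "upper_triangular u'" for lam mu l u l' u'
  proof -
    have cm: "l \<in> carrier_mat m m" "u \<in> carrier_mat m m" "l' \<in> carrier_mat n n" "u' \<in> carrier_mat n n"
      using G by (auto simp: GL_iff)
    have "w lam \<bullet> (\<rho> (l * u) (l' * u') *\<^sub>v w mu) = w lam \<bullet> (\<rho> l l' *\<^sub>v (\<rho> u u' *\<^sub>v w mu))"
      unfolding rm[OF cm(1,3,2,4)] assoc_mult_mat_vec[OF rc rc wc] ..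
    also have "\<dots> = (\<rho> (transpose_mat l) (transpose_mat l') *\<^sub>v w lam) \<bullet> (\<rho> u u' *\<^sub>v w mu)"
      unfolding rt[OF cm(1,3), symmetric]
      by (rule scalar_prod_mult_mat_vec[OF rc mult_mat_vec_carrier[OF rc wc] wc])
    also have "\<dots> = ((chi1 lam l * chi1 (conjugate_part lam) l') \<cdot>\<^sub>v w lam) \<bullet> ((chi1 mu u * chi1 (conjugate_part mu) u') \<cdot>\<^sub>v w mu)"
      using w_upper[OF lm(1) _ tri(1) _ tri(3)] w_upper[OF lm(2) cm(2) tri(2) cm(4) tri(4)] cm
      by (simp add: chi_t[OF lm(1) cm(1)] chi_t'[OF lm(1) cm(3)])
    finally show ?thesis using wc[of lam] wc[of mu] by simp
  qed
  have ww: "w lam \<bullet> w mu = (if lam = mu then 1 else 0)" if "lam \<in> fitting m n d" "mu \<in> fitting m n d" for lam mu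
    using that diagram_index(1)[OF that(1)] diagram_index(1)[OF that(2)] diagram_index_inj[OF that]
    by (auto simp: w_def)
  have entry: "w lam \<bullet> (\<rho> g h *\<^sub>v w mu) = \<rho> g h $$ (diagram_index m n d lam, diagram_index m n d mu)"
    if "lam \<in> fitting m n d" "mu \<in> fitting m n d" for lam mu g h
    using diagram_index(1)[OF that(1)] diagram_index(1)[OF that(2)] rc[of g h]
    by (simp add: w_def mult_mat_unit_vec[of _ E E] E_def)
  show "c lam (l * u, l' * u') = chi1 lam l * chi1 lam u * (chi1 (conjugate_part lam) l' * chi1 (conjugate_part lam) u')"
    if lm: "lam \<in> fitting m n d"
      and G: "l \<in> carrier (GL m)" "u \<in> carrier (GL m)" "l' \<in> carrier (GL n)" "u' \<in> carrier (GL n)"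
      and tri: "upper_triangular (transpose_mat l)" "upper_triangular u"
        "upper_triangular (transpose_mat l')" "upper_triangular u'" for lam l u l' u'
    using big[OF lm lm G tri] ww[OF lm lm] entry[OF lm lm] by (simp add: c_def \<rho>_def mult_ac)
  \<comment> \<open>On products of lower and upper triangular matrices the coefficient is a multiple
    of \<open>w lam \<bullet> w mu = 0\<close>; \<open>big_cell_zero\<close> extends this to the
    whole group.\<close>
  have off: "w lam \<bullet> (\<rho> g h *\<^sub>v w mu) = 0"
    if lm: "lam \<in> fitting m n d" "mu \<in> fitting m n d" "lam \<noteq> mu" and gh: "g \<in> carrier (GL m)" "h \<in> carrier (GL n)" for lam mu g h
  proof (rule big_cell_zero[of m n "\<lambda>g h. w lam \<bullet> (\<rho> g h *\<^sub>v w mu)", OF _ _ gh])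
    fix g h :: "complex \<Rightarrow> complex mat"
    assume "\<And>t. g t \<in> carrier_mat m m" "\<And>t. h t \<in> carrier_mat n n"
      "\<And>i j. i < m \<Longrightarrow> j < m \<Longrightarrow> polyfun (\<lambda>t. g t $$ (i, j))" "\<And>i j. i < n \<Longrightarrow> j < n \<Longrightarrow> polyfun (\<lambda>t. h t $$ (i, j))"
    then have "polyfun (\<lambda>t. \<rho> (g t) (h t) $$ (diagram_index m n d lam, diagram_index m n d mu))"
      unfolding \<rho>_def by (intro polyfun_ext_kron diagram_index(1) lm)
    then show "\<exists>f. polyfun f \<and> (\<forall>t. g t \<in> carrier (GL m) \<longrightarrow> h t \<in> carrier (GL n) \<longrightarrow> w lam \<bullet> (\<rho> (g t) (h t) *\<^sub>v w mu) = f t)"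
      unfolding entry[OF lm(1,2)] by blast
  qed (use big[OF lm(1,2)] ww[OF lm(1,2)] lm(3) in simp)
  have left: "x = 0\<^sub>v E" if x: "x \<in> carrier_vec E"
    and z: "\<And>lam g h. lam \<in> fitting m n d \<Longrightarrow> g \<in> carrier (GL m) \<Longrightarrow> h \<in> carrier (GL n) \<Longrightarrow> w lam \<bullet> (\<rho> g h *\<^sub>v x) = 0" for x
    unfolding E_def by (rule exterior_separates[OF x[unfolded E_def]]) (use z in \<open>simp add: w_def \<rho>_def\<close>)
  have right: "x = 0\<^sub>v E" if x: "x \<in> carrier_vec E"
    and z: "\<And>lam g h. lam \<in> fitting m n d \<Longrightarrow> g \<in> carrier (GL m) \<Longrightarrow> h \<in> carrier (GL n) \<Longrightarrow> x \<bullet> (\<rho> g h *\<^sub>v w lam) = 0" for x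
  proof (rule left[OF x])
    fix lam g h assume a: "lam \<in> fitting m n d" "g \<in> carrier (GL m)" "h \<in> carrier (GL n)"
    have gh: "g \<in> carrier_mat m m" "h \<in> carrier_mat n n"
      "transpose_mat g \<in> carrier (GL m)" "transpose_mat h \<in> carrier (GL n)"
      using a by (auto simp: GL_iff det_transpose)
    have "w lam \<bullet> (\<rho> g h *\<^sub>v x) = (\<rho> (transpose_mat g) (transpose_mat h) *\<^sub>v w lam) \<bullet> x"
      unfolding rt[OF gh(1,2), symmetric] by (rule scalar_prod_mult_mat_vec[OF rc x wc])
    also have "\<dots> = x \<bullet> (\<rho> (transpose_mat g) (transpose_mat h) *\<^sub>v w lam)"
      by (rule comm_scalar_prod[OF mult_mat_vec_carrier[OF rc wc] x])
    finally show "w lam \<bullet> (\<rho> g h *\<^sub>v x) = 0" using z[OF a(1) gh(3,4)] by simp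
  qed
  show "framed (GL m \<times>\<times> GL n) W (fitting m n d) w w c"
    unfolding framed_def W GL_prod_simps(1)
  proof (intro conjI ballI impI rep)
    fix x assume "x \<in> carrier_vec E" "\<forall>i\<in>fitting m n d. \<forall>g\<in>carrier (GL m) \<times> carrier (GL n). w i \<bullet> (\<rho> (fst g) (snd g) *\<^sub>v x) = 0"
    then show "x = 0\<^sub>v E" by (intro left) auto
  next
    fix x assume "x \<in> carrier_vec E" "\<forall>i\<in>fitting m n d. \<forall>g\<in>carrier (GL m) \<times> carrier (GL n). x \<bullet> (\<rho> (fst g) (snd g) *\<^sub>v w i) = 0"
    then show "x = 0\<^sub>v E" by (intro right) auto
  next
    fix i j g assume "i \<in> fitting m n d" "j \<in> fitting m n d" "g \<in> carrier (GL m) \<times> carrier (GL n)"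
    then show "w i \<bullet> (\<rho> (fst g) (snd g) *\<^sub>v w j) = (if i = j then c i g else 0)"
      using off[of i j "fst g" "snd g"] entry[of i j] by (auto simp: c_def \<rho>_def)
  qed (rule wc)+
qed

theorem theorem21:
  fixes m n d :: nat
    and U V :: "nat list \<Rightarrow> complex mat rep"
    and parts :: "nat list list"
  assumes "m \<ge> 1" and "n \<ge> 1"
    and "\<And>lam. lam \<turnstile> d \<Longrightarrow> is_W m lam (U lam)"
    and "\<And>lam. lam \<turnstile> d \<Longrightarrow> is_W n lam (V lam)"
    and "distinct parts" and "set parts = {lam. lam \<turnstile> d}"
  shows "rep_iso (GL m \<times>\<times> GL n)
           (ext_rep d (tensor_rep (pullback fst (defining_rep m)) (pullback snd (defining_rep n))))
           (direct_sum_rep (map (\<lambda>lam. tensor_rep (pullback snd (V (conjugate_part lam)))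
                                              (pullback fst (U lam))) parts)) \<and>
         (\<forall>lam. lam \<turnstile> d \<and> length lam \<le> m \<and> length (conjugate_part lam) \<le> n \<longrightarrow>
            irreducible_rep (GL m \<times>\<times> GL n)
              (tensor_rep (pullback snd (V (conjugate_part lam))) (pullback fst (U lam))))"
proof
  define L where "L lam = tensor_rep (pullback snd (V (conjugate_part lam))) (pullback fst (U lam))" for lam
  define c where "c = (\<lambda>lam g. ext_mat (m * n) d (kron (fst g) (snd g)) $$ (diagram_index m n d lam, diagram_index m n d lam))"
  let ?G = "GL m \<times>\<times> GL n"
  note W = exterior_framed[where m = m and n = n and d = d, folded c_def]
  have UV: "is_W m lam (U lam)" "is_W n (conjugate_part lam) (V (conjugate_part lam))" "conjugate_part lam \<turnstile> d"
    if "lam \<turnstile> d" for lam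
    using assms(3,4) that conjugate_partition[OF that] by auto
  show "\<forall>lam. lam \<turnstile> d \<and> length lam \<le> m \<and> length (conjugate_part lam) \<le> n \<longrightarrow>
      irreducible_rep ?G (tensor_rep (pullback snd (V (conjugate_part lam))) (pullback fst (U lam)))"
    using UV tensor_highest_weight(1) by blast
  have "\<exists>v \<phi>. framed ?G (L lam) ({lam} \<inter> fitting m n d) v \<phi> c" if "lam \<in> set parts" for lam
  proof (cases "lam \<in> fitting m n d")
    case True
    then have lam: "lam \<turnstile> d" "length lam \<le> m" "length (conjugate_part lam) \<le> n" by (auto simp: fitting_def)
    note UVl = UV[OF lam(1)]
    obtain v \<phi> c' where F: "framed ?G (L lam) {lam} v \<phi> (\<lambda>_. c')"
      and big: "\<And>l u l' u'. l \<in> carrier (GL m) \<Longrightarrow> u \<in> carrier (GL m) \<Longrightarrow> l' \<in> carrier (GL n) \<Longrightarrow> u' \<in> carrier (GL n) \<Longrightarrow>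
         upper_triangular (transpose_mat l) \<Longrightarrow> upper_triangular u \<Longrightarrow>
         upper_triangular (transpose_mat l') \<Longrightarrow> upper_triangular u' \<Longrightarrow>
         c' (l * u, l' * u') = (\<Prod>c\<in>diagram lam. l $$ (fst c, fst c)) * (\<Prod>c\<in>diagram lam. u $$ (fst c, fst c)) *
           ((\<Prod>c\<in>diagram (conjugate_part lam). l' $$ (fst c, fst c)) * (\<Prod>c\<in>diagram (conjugate_part lam). u' $$ (fst c, fst c)))"
      and poly: "\<And>g h. (\<forall>t. g t \<in> carrier_mat m m) \<Longrightarrow> (\<forall>t. h t \<in> carrier_mat n n) \<Longrightarrow>
         (\<forall>i<m. \<forall>j<m. polyfun (\<lambda>t. g t $$ (i, j))) \<Longrightarrow> (\<forall>i<n. \<forall>j<n. polyfun (\<lambda>t. h t $$ (i, j))) \<Longrightarrow>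
         (\<exists>f. polyfun f \<and> (\<forall>t. g t \<in> carrier (GL m) \<longrightarrow> h t \<in> carrier (GL n) \<longrightarrow> c' (g t, h t) = f t))"
      using tensor_highest_weight(2)[OF UVl(2,3) lam(3) UVl(1) lam(1,2)] unfolding L_def by blast
    \<comment> \<open>On products of triangular matrices both coefficients are the same product of
      weights, whatever models \<open>U\<close> and \<open>V\<close> are given.\<close>
    have "c' (g, h) - c lam (g, h) = 0" if gh: "g \<in> carrier (GL m)" "h \<in> carrier (GL n)" for g h
    proof (rule big_cell_zero[of m n "\<lambda>g h. c' (g, h) - c lam (g, h)", OF _ _ gh])
      fix g h :: "complex \<Rightarrow> complex mat"
      assume gh: "\<And>t. g t \<in> carrier_mat m m" "\<And>t. h t \<in> carrier_mat n n"
        "\<And>i j. i < m \<Longrightarrow> j < m \<Longrightarrow> polyfun (\<lambda>t. g t $$ (i, j))" "\<And>i j. i < n \<Longrightarrow> j < n \<Longrightarrow> polyfun (\<lambda>t. h t $$ (i, j))"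
      then have p: "polyfun (\<lambda>t. c lam (g t, h t))"
        unfolding c_def fst_conv snd_conv by (intro polyfun_ext_kron diagram_index(1)[OF True])
      obtain f where f: "polyfun f" "\<And>t. g t \<in> carrier (GL m) \<Longrightarrow> h t \<in> carrier (GL n) \<Longrightarrow> c' (g t, h t) = f t"
        using poly[of g h] gh by auto
      show "\<exists>f. polyfun f \<and> (\<forall>t. g t \<in> carrier (GL m) \<longrightarrow> h t \<in> carrier (GL n) \<longrightarrow> c' (g t, h t) - c lam (g t, h t) = f t)"
        by (intro exI[of _ "\<lambda>t. f t - c lam (g t, h t)"] conjI polyfun_diff f(1) p) (simp add: f(2))
    qed (use big W(2)[OF True] in \<open>simp add: c_def\<close>)
    then have "framed ?G (L lam) {lam} v \<phi> c"
      using F unfolding framed_def GL_prod_simps(1) by auto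
    then show ?thesis using True by auto
  next
    case False
    have lam: "lam \<turnstile> d" using that assms(6) by simp
    note UVl = UV[OF lam]
    \<comment> \<open>A diagram outside the box has too many rows for \<open>GL m\<close> or too
      many columns for \<open>GL n\<close>, so one factor is zero by the convention in
      \<open>is_W\<close>.\<close>
    have dim: "fst (L lam) = 0"
      using False lam UVl by (auto simp: fitting_def is_W_def L_def tensor_rep_def pullback_def split: if_splits)
    have "representation ?G (L lam)"
      unfolding L_def using UVl
      by (intro representation_tensor) (auto simp: is_W_def polynomial_rep_def split: if_splits)
    from framed_zero[OF this dim] have "framed ?G (L lam) ({lam} \<inter> fitting m n d) (\<lambda>_. 0\<^sub>v 0) (\<lambda>_. 0\<^sub>v 0) c"
      using False by simp
    then show ?thesis by blast
  qed
  then obtain v \<phi> where "framed ?G (direct_sum_rep (map L parts)) (set parts \<inter> fitting m n d) v \<phi> c"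
    using framed_direct_sum_rep[OF group_GL_prod assms(5)] by blast
  \<comment> \<open>The zero summands contribute no index, so both representations are framed over
    the same set.\<close>
  moreover have "set parts \<inter> fitting m n d = fitting m n d" using assms(6) by (auto simp: fitting_def)
  ultimately have "framed ?G (direct_sum_rep (map L parts)) (fitting m n d) v \<phi> c" by simp
  from framed_iso[OF group_GL_prod W(1) this]
  show "rep_iso ?G (ext_rep d (tensor_rep (pullback fst (defining_rep m)) (pullback snd (defining_rep n))))
      (direct_sum_rep (map (\<lambda>lam. tensor_rep (pullback snd (V (conjugate_part lam))) (pullback fst (U lam))) parts))"
    unfolding L_def .
qed

end
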